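(* Assume $rs^{-1}$ is not a root of unity, let $V$ be the natural $n$-dimensional module of $\widetilde U=U_{r,s}(\mathfrak{gl}_n)$, let $k\ge1$, and consider the algebra homomorphism $H_k(r,s)\to\operatorname{End}_{\widetilde U}(V^{\otimes k})$, $T_i\mapsto sR_i$ ($1\le i<k$). Then: (i) $H_k(r,s)$ maps surjectively onto $\operatorname{End}_{\widetilde U}(V^{\otimes k})$ under this homomorphism. (ii) If $n\ge k$, then $H_k(r,s)$ is isomorphic to $\operatorname{End}_{\widetilde U}(V^{\otimes k})$ via this homomorphism.
   Context: $\mathbb K$ is an algebraically closed field, $n$ a positive integer, $r,s\in\mathbb K$ nonzero with $r\ne s$. Let $\epsilon_1,\dots,\epsilon_n$ be an orthonormal basis of a Euclidean space with inner product $\langle\ ,\ \rangle$, and $\alpha_j=\epsilon_j-\epsilon_{j+1}$ ($1\le j<n$). $\widetilde U=U_{r,s}(\mathfrak{gl}_n)$ is the unital associative $\mathbb K$-algebra generated by $e_j,f_j$ ($1\le j<n$) and $a_i^{\pm1},b_i^{\pm1}$ ($1\le i\le n$) with relations: (R1) the $a_i^{\pm1},b_j^{\pm1}$ all commute and $a_ia_i^{-1}=b_jb_j^{-1}=1$; (R2) $a_ie_j=r^{\langle\epsilon_i,\alpha_j\rangle}e_ja_i$, $a_if_j=r^{-\langle\epsilon_i,\alpha_j\rangle}f_ja_i$; (R3) $b_ie_j=s^{\langle\epsilon_i,\alpha_j\rangle}e_jb_i$, $b_if_j=s^{-\langle\epsilon_i,\alpha_j\rangle}f_jb_i$; (R4)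 $[e_i,f_j]=\frac{\delta_{i,j}}{r-s}(a_ib_{i+1}-a_{i+1}b_i)$; (R5) $[e_i,e_j]=[f_i,f_j]=0$ if $|i-j|>1$; (R6) $e_i^2e_{i+1}-(r+s)e_ie_{i+1}e_i+rs\,e_{i+1}e_i^2=0$ and $e_ie_{i+1}^2-(r+s)e_{i+1}e_ie_{i+1}+rs\,e_{i+1}^2e_i=0$; (R7) $f_i^2f_{i+1}-(r^{-1}+s^{-1})f_if_{i+1}f_i+r^{-1}s^{-1}f_{i+1}f_i^2=0$ and $f_if_{i+1}^2-(r^{-1}+s^{-1})f_{i+1}f_if_{i+1}+r^{-1}s^{-1}f_{i+1}^2f_i=0$. Put $\omega_j=a_jb_{j+1}$, $\omega_j'=a_{j+1}b_j$ ($1\le j<n$). Hopf structure: $a_i^{\pm1},b_i^{\pm1}$ are group-like, $\Delta(e_i)=e_i\otimes1+\omega_i\otimes e_i$, $\Delta(f_i)=1\otimes f_i+f_i\otimes\omega_i'$, $\varepsilon(e_i)=\varepsilon(f_i)=0$, $S(e_i)=-\omega_i^{-1}e_i$, $S(f_i)=-f_i(\omega_i')^{-1}$; tensor powers of modules are formed via $\Delta$. The natural module $V$ has basis $v_1,\dots,v_n$; with $E_{i,j}$ the matrix units ($E_{i,j}v_l=\delta_{j,l}v_i$), $e_j=E_{j,j+1}$, $f_j=E_{j+1,j}$, $a_i=rE_{i,i}+\sum_{l\ne i}E_{l,l}$, $b_i=sE_{i,i}+\sum_{l\ne i}E_{l,l}$. $R:V\otimes V\to V\otimes V$ is the $\widetilde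 U$-module isomorphism (the $R$-matrix of $\widetilde U$ on $V\otimes V$) given by $$R=r\sum_{i<j}E_{j,i}\otimes E_{i,j}+s^{-1}\sum_{i<j}E_{i,j}\otimes E_{j,i}+(1-rs^{-1})\sum_{i<j}E_{j,j}\otimes E_{i,i}+\sum_iE_{i,i}\otimes E_{i,i},$$ and $R_i=\mathrm{Id}^{\otimes(i-1)}\otimes R\otimes\mathrm{Id}^{\otimes(k-i-1)}$ on $V^{\otimes k}$ for $1\le i<k$. $H_k(r,s)$ is the unital associative $\mathbb K$-algebra with generators $T_i$ ($1\le i<k$) and relations $T_iT_{i+1}T_i=T_{i+1}T_iT_{i+1}$ ($1\le i<k-1$), $T_iT_j=T_jT_i$ ($|i-j|\ge2$), $T_i^2=(s-r)T_i+rs\,1$. The assignment $T_i\mapsto sR_i$ extends to an algebra homomorphism $H_k(r,s)\to\operatorname{End}_{\widetilde U}(V^{\otimes k})$. *)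

theory Defs
  imports
    "HOL-Library.Poly_Mapping"
    "HOL-Computational_Algebra.Polynomial"
    "HOL-Algebra.QuotRing"
    "HOL-Algebra.Module"
begin

section \<open>Algebras over a field given by generators and relations\<close>

text \<open>
  An algebra over the field (type) \<open>'k\<close> is a record of type \<open>('k, 'a) module\<close>: the ring
  operations together with the scalar multiplication.
\<close>

definition alg_hom ::
    "('k, 'a, 'm) module_scheme \<Rightarrow> ('k, 'b, 'n) module_scheme \<Rightarrow> ('a \<Rightarrow> 'b) set" where
  "alg_hom A B = {h \<in> ring_hom A B. \<forall>c. \<forall>x\<in>carrier A. h (c \<odot>\<^bsub>A\<^esub> x) = c \<odot>\<^bsub>B\<^esub> h x}"

definition alg_iso ::
    "('k, 'a, 'm) module_scheme \<Rightarrow> ('k, 'b, 'n) module_scheme \<Rightarrow> ('a \<Rightarrow> 'b) set" where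
  "alg_iso A B = {h \<in> alg_hom A B. bij_betw h (carrier A) (carrier B)}"

text \<open>
  Lists under concatenation are the free monoid, so \<open>'g list \<Rightarrow>\<^sub>0 'k\<close> with the convolution
  product of the library is the free associative algebra on \<open>'g\<close>.
\<close>

instantiation list :: (type) monoid_add
begin
definition zero_list :: "'a list" where "zero_list = []"
definition plus_list :: "'a list \<Rightarrow> 'a list \<Rightarrow> 'a list" where "plus_list xs ys = xs @ ys"
instance by standard (simp_all add: zero_list_def plus_list_def)
end

definition gen :: "'g \<Rightarrow> 'g list \<Rightarrow>\<^sub>0 'k::field" where
  "gen g = Poly_Mapping.single [g] 1"

definition scal :: "'k \<Rightarrow> 'g list \<Rightarrow>\<^sub>0 'k::field" where
  "scal c = Poly_Mapping.single [] c"

definition free_alg :: "'g set \<Rightarrow> ('k::field, 'g list \<Rightarrow>\<^sub>0 'k) module" where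
  "free_alg G = \<lparr>carrier = {x. \<forall>w\<in>Poly_Mapping.keys x. set w \<subseteq> G},
     mult = (*), one = 1, zero = 0, add = (+), smult = (\<lambda>c x. scal c * x)\<rparr>"

text \<open>The quotient of the free algebra on \<open>G\<close> by the two-sided ideal generated by \<open>Rel\<close>.\<close>

definition rel_ideal :: "'g set \<Rightarrow> ('g list \<Rightarrow>\<^sub>0 'k::field) set \<Rightarrow> ('g list \<Rightarrow>\<^sub>0 'k) set" where
  "rel_ideal G Rel = Idl\<^bsub>free_alg G\<^esub> Rel"

definition presented_alg ::
    "'g set \<Rightarrow> ('g list \<Rightarrow>\<^sub>0 'k::field) set \<Rightarrow> ('k, ('g list \<Rightarrow>\<^sub>0 'k) set) module" where
  "presented_alg G Rel =
    (let Q = free_alg G Quot rel_ideal G Rel in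
     \<lparr>carrier = carrier Q, mult = mult Q, one = one Q, zero = zero Q, add = add Q,
      smult = (\<lambda>c X. \<Union>x\<in>X. rel_ideal G Rel +>\<^bsub>free_alg G\<^esub> (c \<odot>\<^bsub>free_alg G\<^esub> x))\<rparr>)"

definition presented_gen ::
    "'g set \<Rightarrow> ('g list \<Rightarrow>\<^sub>0 'k::field) set \<Rightarrow> 'g \<Rightarrow> ('g list \<Rightarrow>\<^sub>0 'k) set" where
  "presented_gen G Rel g = rel_ideal G Rel +>\<^bsub>free_alg G\<^esub> gen g"

text \<open>
  An assignment \<open>\<rho>\<close> of elements of an algebra \<open>M\<close> to the generators extends to the free algebra
  (\<open>free_eval\<close>).  If it respects the relations, all representatives of a coset have the same
  value, and \<open>presented_eval\<close> is the induced map on the presented algebra.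
\<close>

definition word_eval :: "('k, 'a, 'm) module_scheme \<Rightarrow> ('g \<Rightarrow> 'a) \<Rightarrow> 'g list \<Rightarrow> 'a" where
  "word_eval M \<rho> w = foldr (\<lambda>g x. \<rho> g \<otimes>\<^bsub>M\<^esub> x) w \<one>\<^bsub>M\<^esub>"

definition free_eval ::
    "('k::field, 'a, 'm) module_scheme \<Rightarrow> ('g \<Rightarrow> 'a) \<Rightarrow> ('g list \<Rightarrow>\<^sub>0 'k) \<Rightarrow> 'a" where
  "free_eval M \<rho> x =
     (\<Oplus>\<^bsub>M\<^esub>w\<in>Poly_Mapping.keys x. Poly_Mapping.lookup x w \<odot>\<^bsub>M\<^esub> word_eval M \<rho> w)"

definition presented_eval ::
    "('k::field, 'a, 'm) module_scheme \<Rightarrow> ('g \<Rightarrow> 'a) \<Rightarrow> ('g list \<Rightarrow>\<^sub>0 'k) set \<Rightarrow> 'a" where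
  "presented_eval M \<rho> X = the_elem (free_eval M \<rho> ` X)"


section \<open>Matrices and tensor powers\<close>

text \<open>Square matrices with rows and columns indexed by the finite set \<open>I\<close>, zero outside \<open>I\<close>.\<close>

definition mat_alg :: "'i set \<Rightarrow> ('k::field, 'i \<Rightarrow> 'i \<Rightarrow> 'k) module" where
  "mat_alg I = \<lparr>carrier = {A. \<forall>u v. A u v \<noteq> 0 \<longrightarrow> u \<in> I \<and> v \<in> I},
     mult = (\<lambda>A B u v. \<Sum>w\<in>I. A u w * B w v),
     one = (\<lambda>u v. if u = v \<and> u \<in> I then 1 else 0),
     zero = (\<lambda>u v. 0),
     add = (\<lambda>A B u v. A u v + B u v),
     smult = (\<lambda>c A u v. c * A u v)\<rparr>"

text \<open>
  The word \<open>[i\<^sub>1,\<dots>,i\<^sub>k]\<close> labels the basis vector \<open>v\<^bsub>i\<^sub>1\<^esub> \<otimes> \<dots> \<otimes> v\<^bsub>i\<^sub>k\<^esub>\<close> of the \<open>k\<close>-th tensor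
  power of \<open>V\<close>, and linear maps are identified with their matrices in this basis (column \<open>v\<close>
  holds the image of the basis vector \<open>v\<close>).
\<close>

type_synonym 'k tmat = "nat list \<Rightarrow> nat list \<Rightarrow> 'k"

definition words :: "nat \<Rightarrow> nat \<Rightarrow> nat list set" where
  "words n k = {w. length w = k \<and> set w \<subseteq> {1..n}}"

abbreviation End_tens :: "nat \<Rightarrow> nat \<Rightarrow> ('k::field, 'k tmat) module" where
  "End_tens n k \<equiv> mat_alg (words n k)"

text \<open>
  The tensor product of \<open>A\<close>, acting on the first \<open>p\<close> tensor factors, with \<open>B\<close>, acting on the
  remaining ones.
\<close>

definition tens :: "nat \<Rightarrow> 'k::field tmat \<Rightarrow> 'k tmat \<Rightarrow> 'k tmat" where
  "tens p A B = (\<lambda>u v. A (take p u) (take p v) * B (drop p u) (drop p v))"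

definition munit :: "nat \<Rightarrow> nat \<Rightarrow> 'k::field tmat" where
  "munit i j = (\<lambda>u v. if u = [i] \<and> v = [j] then 1 else 0)"


section \<open>The two-parameter quantum group of \<open>gl\<^sub>n\<close>\<close>

datatype gl_gen = GE nat | GF nat | GA nat | GA_inv nat | GB nat | GB_inv nat

definition gl_gens :: "nat \<Rightarrow> gl_gen set" where
  "gl_gens n = GE ` {1..<n} \<union> GF ` {1..<n} \<union>
     GA ` {1..n} \<union> GA_inv ` {1..n} \<union> GB ` {1..n} \<union> GB_inv ` {1..n}"

abbreviation "ee i \<equiv> gen (GE i)"
abbreviation "ff i \<equiv> gen (GF i)"
abbreviation "aa i \<equiv> gen (GA i)"
abbreviation "aa_inv i \<equiv> gen (GA_inv i)"
abbreviation "bb i \<equiv> gen (GB i)"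
abbreviation "bb_inv i \<equiv> gen (GB_inv i)"

text \<open>The inner product of \<open>\<epsilon>\<^sub>i\<close> with \<open>\<alpha>\<^sub>j = \<epsilon>\<^sub>j - \<epsilon>\<^bsub>j+1\<^esub>\<close>, for an orthonormal basis \<open>\<epsilon>\<close>.\<close>

definition eps_alpha :: "nat \<Rightarrow> nat \<Rightarrow> int" where
  "eps_alpha i j = of_bool (i = j) - of_bool (i = j + 1)"

definition gl_rel1 :: "nat \<Rightarrow> (gl_gen list \<Rightarrow>\<^sub>0 'k::field) set" where
  "gl_rel1 n =
     (let C = GA ` {1..n} \<union> GA_inv ` {1..n} \<union> GB ` {1..n} \<union> GB_inv ` {1..n} in
      {gen x * gen y - gen y * gen x | x y. x \<in> C \<and> y \<in> C}) \<union>
     {aa i * aa_inv i - 1 | i. i \<in> {1..n}} \<union>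
     {bb i * bb_inv i - 1 | i. i \<in> {1..n}}"

definition gl_rel2 :: "nat \<Rightarrow> 'k::field \<Rightarrow> (gl_gen list \<Rightarrow>\<^sub>0 'k) set" where
  "gl_rel2 n r =
     {aa i * ee j - scal (r powi eps_alpha i j) * (ee j * aa i) | i j. i \<in> {1..n} \<and> j \<in> {1..<n}} \<union>
     {aa i * ff j - scal (r powi (- eps_alpha i j)) * (ff j * aa i) | i j. i \<in> {1..n} \<and> j \<in> {1..<n}}"

definition gl_rel3 :: "nat \<Rightarrow> 'k::field \<Rightarrow> (gl_gen list \<Rightarrow>\<^sub>0 'k) set" where
  "gl_rel3 n s =
     {bb i * ee j - scal (s powi eps_alpha i j) * (ee j * bb i) | i j. i \<in> {1..n} \<and> j \<in> {1..<n}} \<union>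
     {bb i * ff j - scal (s powi (- eps_alpha i j)) * (ff j * bb i) | i j. i \<in> {1..n} \<and> j \<in> {1..<n}}"

definition gl_rel4 :: "nat \<Rightarrow> 'k::field \<Rightarrow> 'k \<Rightarrow> (gl_gen list \<Rightarrow>\<^sub>0 'k) set" where
  "gl_rel4 n r s =
     {ee i * ff j - ff j * ee i -
        scal (of_bool (i = j) / (r - s)) * (aa i * bb (i+1) - aa (i+1) * bb i)
      | i j. i \<in> {1..<n} \<and> j \<in> {1..<n}}"

definition gl_rel5 :: "nat \<Rightarrow> (gl_gen list \<Rightarrow>\<^sub>0 'k::field) set" where
  "gl_rel5 n =
     {ee i * ee j - ee j * ee i | i j.
        i \<in> {1..<n} \<and> j \<in> {1..<n} \<and> \<bar>int i - int j\<bar> > 1} \<union>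
     {ff i * ff j - ff j * ff i | i j.
        i \<in> {1..<n} \<and> j \<in> {1..<n} \<and> \<bar>int i - int j\<bar> > 1}"

definition gl_rel6 :: "nat \<Rightarrow> 'k::field \<Rightarrow> 'k \<Rightarrow> (gl_gen list \<Rightarrow>\<^sub>0 'k) set" where
  "gl_rel6 n r s =
     {ee i ^ 2 * ee (i+1) - scal (r + s) * (ee i * ee (i+1) * ee i) +
        scal (r * s) * (ee (i+1) * ee i ^ 2) | i. 1 \<le> i \<and> i + 1 < n} \<union>
     {ee i * ee (i+1) ^ 2 - scal (r + s) * (ee (i+1) * ee i * ee (i+1)) +
        scal (r * s) * (ee (i+1) ^ 2 * ee i) | i. 1 \<le> i \<and> i + 1 < n}"

definition gl_rel7 :: "nat \<Rightarrow> 'k::field \<Rightarrow> 'k \<Rightarrow> (gl_gen list \<Rightarrow>\<^sub>0 'k) set" where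
  "gl_rel7 n r s =
     {ff i ^ 2 * ff (i+1) - scal (inverse r + inverse s) * (ff i * ff (i+1) * ff i) +
        scal (inverse r * inverse s) * (ff (i+1) * ff i ^ 2) | i. 1 \<le> i \<and> i + 1 < n} \<union>
     {ff i * ff (i+1) ^ 2 - scal (inverse r + inverse s) * (ff (i+1) * ff i * ff (i+1)) +
        scal (inverse r * inverse s) * (ff (i+1) ^ 2 * ff i) | i. 1 \<le> i \<and> i + 1 < n}"

definition gl_rels :: "nat \<Rightarrow> 'k::field \<Rightarrow> 'k \<Rightarrow> (gl_gen list \<Rightarrow>\<^sub>0 'k) set" where
  "gl_rels n r s = gl_rel1 n \<union> gl_rel2 n r \<union> gl_rel3 n s \<union> gl_rel4 n r s \<union> gl_rel5 n \<union>
     gl_rel6 n r s \<union> gl_rel7 n r s"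

definition U_gl :: "nat \<Rightarrow> 'k::field \<Rightarrow> 'k \<Rightarrow> ('k, (gl_gen list \<Rightarrow>\<^sub>0 'k) set) module" where
  "U_gl n r s = presented_alg (gl_gens n) (gl_rels n r s)"

text \<open>
  The coalgebra structure on generators.  A list \<open>[(x\<^sub>1,y\<^sub>1),\<dots>]\<close> stands for the sum of the
  elementary tensors \<open>x\<^sub>i \<otimes> y\<^sub>i\<close>.
\<close>

definition omega :: "nat \<Rightarrow> gl_gen list \<Rightarrow>\<^sub>0 'k::field" where
  "omega j = aa j * bb (j+1)"

definition omega' :: "nat \<Rightarrow> gl_gen list \<Rightarrow>\<^sub>0 'k::field" where
  "omega' j = aa (j+1) * bb j"

fun gl_coprod :: "gl_gen \<Rightarrow> ((gl_gen list \<Rightarrow>\<^sub>0 'k::field) \<times> (gl_gen list \<Rightarrow>\<^sub>0 'k)) list" where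
  "gl_coprod (GE i) = [(ee i, 1), (omega i, ee i)]"
| "gl_coprod (GF i) = [(1, ff i), (ff i, omega' i)]"
| "gl_coprod g = [(gen g, gen g)]"

fun gl_counit :: "gl_gen \<Rightarrow> 'k::field" where
  "gl_counit (GE i) = 0"
| "gl_counit (GF i) = 0"
| "gl_counit g = 1"

definition diag_at :: "nat \<Rightarrow> 'k::field \<Rightarrow> nat \<Rightarrow> 'k tmat" where
  "diag_at n c i = (\<lambda>u v. c * munit i i u v + (\<Sum>l\<in>{1..n}-{i}. munit l l u v))"

fun natural_gen :: "nat \<Rightarrow> 'k::field \<Rightarrow> 'k \<Rightarrow> gl_gen \<Rightarrow> 'k tmat" where
  "natural_gen n r s (GE j) = munit j (j+1)"
| "natural_gen n r s (GF j) = munit (j+1) j"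
| "natural_gen n r s (GA i) = diag_at n r i"
| "natural_gen n r s (GA_inv i) = diag_at n (inverse r) i"
| "natural_gen n r s (GB i) = diag_at n s i"
| "natural_gen n r s (GB_inv i) = diag_at n (inverse s) i"

text \<open>
  The generators acting on the tensor powers of \<open>V\<close>: a generator acts on the tensor product of
  the \<open>k\<close>-th power with \<open>V\<close> through its coproduct.  The zeroth power is the trivial module,
  given by the counit.
\<close>

primrec tens_gen :: "nat \<Rightarrow> 'k::field \<Rightarrow> 'k \<Rightarrow> nat \<Rightarrow> gl_gen \<Rightarrow> 'k tmat" where
  "tens_gen n r s 0 = (\<lambda>g. gl_counit g \<odot>\<^bsub>End_tens n 0\<^esub> \<one>\<^bsub>End_tens n 0\<^esub>)"
| "tens_gen n r s (Suc k) = (\<lambda>g u v. \<Sum>(x, y)\<leftarrow>gl_coprod g.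
     tens k (free_eval (End_tens n k) (tens_gen n r s k) x)
            (free_eval (End_tens n 1) (natural_gen n r s) y) u v)"

definition U_act ::
    "nat \<Rightarrow> 'k::field \<Rightarrow> 'k \<Rightarrow> nat \<Rightarrow> (gl_gen list \<Rightarrow>\<^sub>0 'k) set \<Rightarrow> 'k tmat" where
  "U_act n r s k = presented_eval (End_tens n k) (tens_gen n r s k)"

definition End_U :: "nat \<Rightarrow> 'k::field \<Rightarrow> 'k \<Rightarrow> nat \<Rightarrow> ('k, 'k tmat) module" where
  "End_U n r s k = (End_tens n k)\<lparr>carrier :=
     {\<phi> \<in> carrier (End_tens n k). \<forall>u\<in>carrier (U_gl n r s).
        \<phi> \<otimes>\<^bsub>End_tens n k\<^esub> U_act n r s k u = U_act n r s k u \<otimes>\<^bsub>End_tens n k\<^esub> \<phi>}\<rparr>"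


section \<open>The \<open>R\<close>-matrix and the Hecke algebra\<close>

definition R_mat :: "nat \<Rightarrow> 'k::field \<Rightarrow> 'k \<Rightarrow> 'k tmat" where
  "R_mat n r s = (\<lambda>u v.
     let P = {(i, j). i \<in> {1..n} \<and> j \<in> {1..n} \<and> i < j} in
       r * (\<Sum>(i, j)\<in>P. tens 1 (munit j i) (munit i j) u v)
     + inverse s * (\<Sum>(i, j)\<in>P. tens 1 (munit i j) (munit j i) u v)
     + (1 - r * inverse s) * (\<Sum>(i, j)\<in>P. tens 1 (munit j j) (munit i i) u v)
     + (\<Sum>i\<in>{1..n}. tens 1 (munit i i) (munit i i) u v))"

definition R_at :: "nat \<Rightarrow> 'k::field \<Rightarrow> 'k \<Rightarrow> nat \<Rightarrow> nat \<Rightarrow> 'k tmat" where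
  "R_at n r s k i = tens (i - 1) \<one>\<^bsub>End_tens n (i - 1)\<^esub>
     (tens 2 (R_mat n r s) \<one>\<^bsub>End_tens n (k - i - 1)\<^esub>)"

text \<open>The generator \<open>T\<^sub>i\<close> is represented by the number \<open>i\<close>.\<close>

definition hecke_gens :: "nat \<Rightarrow> nat set" where
  "hecke_gens k = {1..<k}"

definition hecke_rels :: "nat \<Rightarrow> 'k::field \<Rightarrow> 'k \<Rightarrow> (nat list \<Rightarrow>\<^sub>0 'k) set" where
  "hecke_rels k r s =
     {gen i * gen (i+1) * gen i - gen (i+1) * gen i * gen (i+1) | i. 1 \<le> i \<and> i + 1 < k} \<union>
     {gen i * gen j - gen j * gen i | i j.
        i \<in> {1..<k} \<and> j \<in> {1..<k} \<and> \<bar>int i - int j\<bar> \<ge> 2} \<union>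
     {gen i ^ 2 - (scal (s - r) * gen i + scal (r * s)) | i. i \<in> {1..<k}}"

definition hecke :: "nat \<Rightarrow> 'k::field \<Rightarrow> 'k \<Rightarrow> ('k, (nat list \<Rightarrow>\<^sub>0 'k) set) module" where
  "hecke k r s = presented_alg (hecke_gens k) (hecke_rels k r s)"

definition hecke_T :: "nat \<Rightarrow> 'k::field \<Rightarrow> 'k \<Rightarrow> nat \<Rightarrow> (nat list \<Rightarrow>\<^sub>0 'k) set" where
  "hecke_T k r s i = presented_gen (hecke_gens k) (hecke_rels k r s) i"

text \<open>The map extending the assignment of \<open>s R\<^sub>i\<close> to \<open>T\<^sub>i\<close>.\<close>

definition hecke_map ::
    "nat \<Rightarrow> 'k::field \<Rightarrow> 'k \<Rightarrow> nat \<Rightarrow> (nat list \<Rightarrow>\<^sub>0 'k) set \<Rightarrow> 'k tmat" where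
  "hecke_map n r s k = presented_eval (End_tens n k) (\<lambda>i. s \<odot>\<^bsub>End_tens n k\<^esub> R_at n r s k i)"

end

theory Submission
  imports Defs "HOL-Library.Function_Algebras"
begin

text \<open>
  The weight space of the vector \<open>v\<^sub>1 \<otimes> \<dots> \<otimes> v\<^sub>k\<close> is a free module of rank one over the Hecke algebra
  \<open>H\<close>, which gives injectivity for \<open>n \<ge> k\<close>. For surjectivity let \<open>\<phi>\<close> commute with the quantum group,
  and work inside the tensor power for a space with basis \<open>v\<^sub>1, v\<^sub>2, v\<^sub>3, \<dots>\<close>. By triangular
  decomposition, \<open>\<phi>\<close> commutes with all products of generators \<open>e\<^sub>j\<close>, \<open>f\<^sub>j\<close> (with \<open>j\<close> arbitrary) that lead
  from a weight space with letters at most \<open>n\<close> to another one. The vectors \<open>\<Sum> b m\<close> with \<open>m\<close> in such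
  weight spaces and \<open>b\<close> a product of generators leading to the weight of \<open>v\<^sub>1 \<otimes> \<dots> \<otimes> v\<^sub>k\<close> form a
  two-sided ideal \<open>I\<close> of \<open>H\<close>. The canonical trace of \<open>H\<close> vanishes on nilpotent elements, being the
  leading coefficient of the quantum traces on the tensor powers of the \<open>N\<close>-dimensional spaces as
  polynomials in the quantum integer of \<open>N\<close>; so it is nondegenerate on \<open>I\<close>, and \<open>I\<close> has an identity
  element \<open>\<Sum> b m\<close>. The element \<open>\<Sum> b \<phi>(m)\<close> of \<open>H\<close> then induces \<open>\<phi>\<close>.
\<close>

section \<open>Evaluation in matrix algebras\<close>

text \<open>The obstacle is the case k > n. The word 1 2 ... k, on whose weight space H is faithful,
  then uses letters that the given tensor power lacks, and \<phi> is not defined there. Hence the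
  Hecke side is developed with unbounded letters, and \<phi> is transported only along sums of terms
  b m. Whether the sum of the b m determines the sum of the b \<phi>(m) is left open: one value,
  taken at the identity of I, already yields the required element of H. The canonical trace does not
  show by itself that it vanishes on nilpotents. A quantum trace does, being an honest matrix trace
  twisted by a diagonal matrix that commutes with H; the weights (r/s)^(i-1) in it are the ones for
  which closing the last strand turns its crossing into a scalar. The hypothesis on r/s enters three
  times: it makes the quantum integers distinct, makes the composites of e_j and f_j invertible
  where letters are moved, and lets the a_i and b_i separate weights.\<close>

lemma poly_mapping_sum_single: "(\<Sum>w\<in>Poly_Mapping.keys x. Poly_Mapping.single w (Poly_Mapping.lookup x w)) = x"
proof (rule poly_mapping_eqI)
  fix v
  show "Poly_Mapping.lookup (\<Sum>w\<in>Poly_Mapping.keys x. Poly_Mapping.single w (Poly_Mapping.lookup x w)) v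
      = Poly_Mapping.lookup x v"
    by (simp add: lookup_sum lookup_single when_def sum.delta in_keys_iff)
qed

text \<open>The linear functional with prescribed values \<open>h\<close> on words. Matrix entries
  of an evaluation and values of an operator at a point are all of this form, so sums and products
  are settled once, for functionals.\<close>

definition leval :: "('g list \<Rightarrow> 'k) \<Rightarrow> ('g list \<Rightarrow>\<^sub>0 'k::field) \<Rightarrow> 'k" where
  "leval h x = (\<Sum>w\<in>Poly_Mapping.keys x. Poly_Mapping.lookup x w * h w)"

lemma leval_superset:
  assumes "finite A" "Poly_Mapping.keys x \<subseteq> A"
  shows "leval h x = (\<Sum>w\<in>A. Poly_Mapping.lookup x w * h w)"
  unfolding leval_def
  by (rule sum.mono_neutral_left) (use assms in \<open>auto simp: in_keys_iff\<close>)

lemma leval_0 [simp]: "leval h 0 = 0"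
  by (simp add: leval_def)

lemma leval_add: "leval h (x + y) = leval h x + leval h y"
proof -
  let ?A = "Poly_Mapping.keys x \<union> Poly_Mapping.keys y"
  have "leval h (x + y) = (\<Sum>w\<in>?A. Poly_Mapping.lookup (x + y) w * h w)"
    by (rule leval_superset) (use Poly_Mapping.keys_add[of x y] in auto)
  also have "\<dots> = (\<Sum>w\<in>?A. Poly_Mapping.lookup x w * h w) + (\<Sum>w\<in>?A. Poly_Mapping.lookup y w * h w)"
    by (simp add: lookup_add distrib_right sum.distrib)
  also have "\<dots> = leval h x + leval h y"
    by (subst (1 2) leval_superset[of ?A]) auto
  finally show ?thesis .
qed

lemma leval_uminus: "leval h (- x) = - leval h x"
  using leval_add[of h x "- x"] by (simp add: eq_neg_iff_add_eq_0 add.commute)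

lemma leval_diff: "leval h (x - y) = leval h x - leval h y"
  using leval_add[of h x "- y"] by (simp add: leval_uminus)

lemma leval_single [simp]: "leval h (Poly_Mapping.single w c) = c * h w"
  by (cases "c = 0") (simp_all add: leval_def)

lemma leval_sum: "leval h (sum f A) = (\<Sum>a\<in>A. leval h (f a))"
  by (induction A rule: infinite_finite_induct) (simp_all add: leval_add)

lemma leval_1 [simp]: "leval h 1 = h []"
  by (subst single_one[symmetric], simp only: zero_list_def leval_single mult_1)

lemma leval_scal [simp]: "leval h (scal c) = c * h []"
  by (simp add: scal_def)

lemma leval_gen [simp]: "leval h (gen g) = h [g]"
  by (simp add: gen_def)

lemma leval_cong: "(\<And>w. w \<in> Poly_Mapping.keys x \<Longrightarrow> h w = h' w) \<Longrightarrow> leval h x = leval h' x"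
  by (simp add: leval_def)

lemma leval_linear:
  "leval (\<lambda>w. h w + h' w) x = leval h x + leval h' x"
  "leval (\<lambda>w. c * h w) x = c * leval h x"
  "leval (\<lambda>w. h w * c) x = leval h x * c"
  "leval (\<lambda>w. \<Sum>a\<in>A. H a w) x = (\<Sum>a\<in>A. leval (H a) x)"
     apply (simp_all add: leval_def distrib_left sum.distrib sum_distrib_left sum_distrib_right ac_simps)
  by (rule sum.swap)

lemma leval_mult: "leval h (x * y) = leval (\<lambda>v. leval (\<lambda>w. h (v @ w)) y) x"
proof -
  have *: "leval h (Poly_Mapping.single v c * y) = c * leval (\<lambda>w. h (v @ w)) y" for v c
  proof -
    have "leval h (Poly_Mapping.single v c * (\<Sum>w\<in>Poly_Mapping.keys y. Poly_Mapping.single w (Poly_Mapping.lookup y w)))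
       = c * leval (\<lambda>w. h (v @ w)) y"
      by (simp add: sum_distrib_left leval_sum mult_single plus_list_def leval_def[of _ y] ac_simps)
    then show ?thesis by (simp only: poly_mapping_sum_single)
  qed
  have "leval h ((\<Sum>v\<in>Poly_Mapping.keys x. Poly_Mapping.single v (Poly_Mapping.lookup x v)) * y)
       = leval (\<lambda>v. leval (\<lambda>w. h (v @ w)) y) x"
    by (simp add: sum_distrib_right leval_sum * leval_def[of _ x])
  then show ?thesis by (simp only: poly_mapping_sum_single)
qed

lemma leval_scal_mult [simp]: "leval h (scal c * x) = c * leval h x"
  by (simp add: leval_mult)

lemma scal_mult_single [simp]: "scal c * Poly_Mapping.single w d = Poly_Mapping.single w (c * d)"
  using mult_single[of "[]" c w d] by (simp add: scal_def plus_list_def)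

section \<open>Free algebras as rings\<close>

lemma free_alg_simps [simp]:
  "carrier (free_alg G) = {x. \<forall>w\<in>Poly_Mapping.keys x. set w \<subseteq> G}"
  "mult (free_alg G) = (*)" "one (free_alg G) = 1" "zero (free_alg G) = 0" "add (free_alg G) = (+)"
  "smult (free_alg G) = (\<lambda>c x. scal c * x)"
  by (simp_all add: free_alg_def)

definition Free :: "'g set \<Rightarrow> ('g list \<Rightarrow>\<^sub>0 'k::field) set" where
  "Free G = {x. \<forall>w\<in>Poly_Mapping.keys x. set w \<subseteq> G}"

lemma Free_add [intro]: "x \<in> Free G \<Longrightarrow> y \<in> Free G \<Longrightarrow> x + y \<in> Free G"
  unfolding Free_def using Poly_Mapping.keys_add[of x y] by blast

lemma Free_0 [intro, simp]: "0 \<in> Free G"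
  by (simp add: Free_def)

lemma Free_1 [intro, simp]: "1 \<in> Free G"
  by (simp add: Free_def zero_list_def)

lemma Free_uminus [intro]: "x \<in> Free G \<Longrightarrow> - x \<in> Free G"
  by (simp add: Free_def in_keys_iff)

lemma Free_diff [intro]: "x \<in> Free G \<Longrightarrow> y \<in> Free G \<Longrightarrow> x - y \<in> Free G"
  using Free_add[of x G "- y"] by auto

lemma Free_mult [intro]: "x \<in> Free G \<Longrightarrow> y \<in> Free G \<Longrightarrow> x * y \<in> Free G"
  unfolding Free_def using keys_mult[of x y] by (fastforce simp: plus_list_def)

lemma Free_single [intro]: "set w \<subseteq> G \<Longrightarrow> Poly_Mapping.single w c \<in> Free G"
  by (simp add: Free_def)

lemma Free_scal [intro, simp]: "scal c \<in> Free G"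
  by (simp add: scal_def Free_single)

lemma Free_gen [intro]: "g \<in> G \<Longrightarrow> gen g \<in> Free G"
  by (simp add: gen_def Free_single)

lemma Free_power [intro]: "x \<in> Free G \<Longrightarrow> x ^ m \<in> Free G"
  by (induction m) auto

lemma Free_sum: "(\<And>a. a \<in> A \<Longrightarrow> f a \<in> Free G) \<Longrightarrow> sum f A \<in> Free G"
  by (induction A rule: infinite_finite_induct) auto

lemma free_alg_carrier: "carrier (free_alg G) = Free G"
  by (simp add: Free_def)

lemma Free_induct [consumes 1, case_names zero single add]:
  assumes x: "x \<in> Free G" and z: "P 0" and s: "\<And>w c. set w \<subseteq> G \<Longrightarrow> P (Poly_Mapping.single w c)"
    and a: "\<And>x y. x \<in> Free G \<Longrightarrow> y \<in> Free G \<Longrightarrow> P x \<Longrightarrow> P y \<Longrightarrow> P (x + y)"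
  shows "P x"
proof -
  have "P (\<Sum>w\<in>A. Poly_Mapping.single w (Poly_Mapping.lookup x w)) \<and>
     (\<Sum>w\<in>A. Poly_Mapping.single w (Poly_Mapping.lookup x w)) \<in> Free G"
    if "finite A" "A \<subseteq> Poly_Mapping.keys x" for A
    using that
  proof (induction A rule: finite_induct)
    case (insert v A)
    have "set v \<subseteq> G" using insert.prems x by (auto simp: Free_def)
    then show ?case using insert by (auto intro!: a s Free_single Free_add)
  qed (simp add: z)
  from this[of "Poly_Mapping.keys x"] show ?thesis
    by (simp add: poly_mapping_sum_single)
qed

lemma free_alg_ring: "ring (free_alg G)"
proof (rule ringI)
  show "abelian_group (free_alg G)"
  proof (rule abelian_groupI, unfold free_alg_carrier)
    show "\<exists>y\<in>Free G. y \<oplus>\<^bsub>free_alg G\<^esub> x = \<zero>\<^bsub>free_alg G\<^esub>" if "x \<in> Free G" for x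
      using that by (intro bexI[of _ "- x"]) auto
  qed (auto simp: ac_simps)
  show "Group.monoid (free_alg G)"
    by (rule monoidI, unfold free_alg_carrier) (auto simp: ac_simps)
qed (auto simp: algebra_simps)

section \<open>Matrix algebras and their coordinate operators\<close>

lemma mat_alg_simps [simp]:
  "carrier (mat_alg I) = {A. \<forall>u v. A u v \<noteq> 0 \<longrightarrow> u \<in> I \<and> v \<in> I}"
  "mult (mat_alg I) = (\<lambda>A B u v. \<Sum>w\<in>I. A u w * B w v)"
  "one (mat_alg I) = (\<lambda>u v. if u = v \<and> u \<in> I then 1 else 0)"
  "zero (mat_alg I) = (\<lambda>u v. 0)"
  "add (mat_alg I) = (\<lambda>A B u v. A u v + B u v)"
  "smult (mat_alg I) = (\<lambda>c A u v. c * A u v)"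
  by (simp_all add: mat_alg_def)

lemma mat_alg_ring:
  assumes "finite I" shows "ring (mat_alg I :: ('k::field, 'i \<Rightarrow> 'i \<Rightarrow> 'k) module)"
proof (rule ringI)
  show "abelian_group (mat_alg I :: ('k, 'i \<Rightarrow> 'i \<Rightarrow> 'k) module)"
  proof (rule abelian_groupI)
    fix x y :: "'i \<Rightarrow> 'i \<Rightarrow> 'k" assume "x \<in> carrier (mat_alg I)" "y \<in> carrier (mat_alg I)"
    then show "x \<oplus>\<^bsub>mat_alg I\<^esub> y \<in> carrier (mat_alg I)"
      by simp (metis add_0)
  next
    fix x :: "'i \<Rightarrow> 'i \<Rightarrow> 'k" assume x: "x \<in> carrier (mat_alg I)"
    show "\<exists>y\<in>carrier (mat_alg I). y \<oplus>\<^bsub>mat_alg I\<^esub> x = \<zero>\<^bsub>mat_alg I\<^esub>"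
      by (rule bexI[of _ "\<lambda>u v. - x u v"]) (use x in auto)
  qed (auto simp: ac_simps)
  show "Group.monoid (mat_alg I :: ('k, 'i \<Rightarrow> 'i \<Rightarrow> 'k) module)"
  proof (rule monoidI)
    fix x y z :: "'i \<Rightarrow> 'i \<Rightarrow> 'k"
    show "x \<otimes>\<^bsub>mat_alg I\<^esub> y \<otimes>\<^bsub>mat_alg I\<^esub> z = x \<otimes>\<^bsub>mat_alg I\<^esub> (y \<otimes>\<^bsub>mat_alg I\<^esub> z)"
      by (auto simp: sum_distrib_left sum_distrib_right mult.assoc intro!: ext sum.swap)
    assume x: "x \<in> carrier (mat_alg I)"
    show "\<one>\<^bsub>mat_alg I\<^esub> \<otimes>\<^bsub>mat_alg I\<^esub> x = x"
    proof (intro ext)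
      fix u v
      show "(\<one>\<^bsub>mat_alg I\<^esub> \<otimes>\<^bsub>mat_alg I\<^esub> x) u v = x u v"
        using x assms by (cases "u \<in> I") (auto simp: if_distrib[of "\<lambda>z. z * _"] cong: if_cong)
    qed
    show "x \<otimes>\<^bsub>mat_alg I\<^esub> \<one>\<^bsub>mat_alg I\<^esub> = x"
    proof (intro ext)
      fix u v
      have "(if w = v \<and> w \<in> I then 1 else (0::'k)) = (if v = w then if v \<in> I then 1 else 0 else 0)" for w by auto
      then show "(x \<otimes>\<^bsub>mat_alg I\<^esub> \<one>\<^bsub>mat_alg I\<^esub>) u v = x u v"
        using x assms by (cases "v \<in> I") (auto simp: if_distrib[of "\<lambda>z. _ * z"] cong: if_cong)
    qed
    assume y: "y \<in> carrier (mat_alg I)"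
    show "x \<otimes>\<^bsub>mat_alg I\<^esub> y \<in> carrier (mat_alg I)"
    proof -
      { fix u v assume "(\<Sum>w\<in>I. x u w * y w v) \<noteq> 0"
        then obtain w where "x u w * y w v \<noteq> 0" by (rule sum.not_neutral_contains_not_neutral)
        then have "u \<in> I \<and> v \<in> I" using x y by auto }
      then show ?thesis unfolding mat_alg_simps mem_Collect_eq by blast
    qed
  qed (auto split: if_splits)
qed (auto simp: distrib_left distrib_right sum.distrib)

lemma mat_alg_finsum:
  fixes f :: "'a \<Rightarrow> 'i \<Rightarrow> 'i \<Rightarrow> 'k::field"
  assumes "finite I" "finite A" "\<And>a. a \<in> A \<Longrightarrow> f a \<in> carrier (mat_alg I)"
  shows "finsum (mat_alg I) f A = (\<lambda>u v. \<Sum>a\<in>A. f a u v)"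
proof -
  interpret ring "mat_alg I :: ('k, 'i \<Rightarrow> 'i \<Rightarrow> 'k) module" by (rule mat_alg_ring) fact
  show ?thesis using assms(2,3)
  proof (induction A rule: finite_induct)
    case empty then show ?case by simp
  next
    case (insert a A)
    then have "f \<in> A \<rightarrow> carrier (mat_alg I)" "f a \<in> carrier (mat_alg I)" by auto
    moreover have "finsum (mat_alg I) f A = (\<lambda>u v. \<Sum>a\<in>A. f a u v)"
      using insert.IH insert.prems by blast
    ultimately show ?case using insert.hyps by (subst finsum_insert) simp_all
  qed
qed

lemma word_eval_Nil [simp]: "word_eval M \<rho> [] = \<one>\<^bsub>M\<^esub>"
  and word_eval_Cons [simp]: "word_eval M \<rho> (g # w) = \<rho> g \<otimes>\<^bsub>M\<^esub> word_eval M \<rho> w"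
  by (simp_all add: word_eval_def)

text \<open>
  Linear maps are handled through their effect on coordinate functions; the operator need only agree
  with the matrix at the points of \<open>I\<close>, so one operator can serve all the algebras \<open>End_tens n k\<close>.
\<close>

definition rep :: "'i set \<Rightarrow> ('i \<Rightarrow> 'i \<Rightarrow> 'k::field) \<Rightarrow> (('i \<Rightarrow> 'k) \<Rightarrow> ('i \<Rightarrow> 'k)) \<Rightarrow> bool" where
  "rep I A P \<longleftrightarrow> A \<in> carrier (mat_alg I) \<and> (\<forall>f. \<forall>u\<in>I. P f u = (\<Sum>v\<in>I. A u v * f v))"

lemma rep_carrier: "rep I A P \<Longrightarrow> A \<in> carrier (mat_alg I)"
  by (simp add: rep_def)

lemma rep_apply: "rep I A P \<Longrightarrow> u \<in> I \<Longrightarrow> P f u = (\<Sum>v\<in>I. A u v * f v)"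
  by (simp add: rep_def)

lemma rep_entry:
  assumes "finite I" "rep I A P" "u \<in> I" "v \<in> I"
  shows "A u v = P (\<lambda>w. if w = v then 1 else 0) u"
  using assms by (simp add: rep_apply if_distrib[of "\<lambda>z. _ * z"] cong: if_cong)

lemma rep_unique:
  assumes "finite I" "rep I A P" "rep I B Q" "\<And>f u. u \<in> I \<Longrightarrow> P f u = Q f u"
  shows "A = B"
proof (intro ext)
  fix u v
  show "A u v = B u v"
  proof (cases "u \<in> I \<and> v \<in> I")
    case True with assms show ?thesis by (simp add: rep_entry[of I A P] rep_entry[of I B Q])
  next
    case False
    with assms(2,3) show ?thesis unfolding rep_def mat_alg_simps mem_Collect_eq by metis
  qed
qed

lemma rep_cong: "rep I A P \<Longrightarrow> (\<And>f u. u \<in> I \<Longrightarrow> P f u = Q f u) \<Longrightarrow> rep I A Q"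
  by (simp add: rep_def)

lemma rep_comp:
  assumes "finite I" "rep I A P" "rep I B Q"
  shows "rep I (A \<otimes>\<^bsub>mat_alg I\<^esub> B) (\<lambda>f. P (Q f))"
proof -
  interpret ring "mat_alg I :: ('b, 'a \<Rightarrow> 'a \<Rightarrow> 'b) module" by (rule mat_alg_ring) fact
  have "A \<otimes>\<^bsub>mat_alg I\<^esub> B \<in> carrier (mat_alg I)" using assms by (blast dest: rep_carrier)
  moreover have "P (Q f) u = (\<Sum>v\<in>I. (A \<otimes>\<^bsub>mat_alg I\<^esub> B) u v * f v)" if "u \<in> I" for f u
  proof -
    have "P (Q f) u = (\<Sum>w\<in>I. \<Sum>v\<in>I. A u w * (B w v * f v))"
      unfolding rep_apply[OF assms(2) that] sum_distrib_left[symmetric]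
      by (rule sum.cong) (simp_all add: rep_apply[OF assms(3)])
    also have "\<dots> = (\<Sum>v\<in>I. \<Sum>w\<in>I. A u w * (B w v * f v))" by (rule sum.swap)
    finally show ?thesis by (simp add: sum_distrib_right mult.assoc)
  qed
  ultimately show ?thesis unfolding rep_def by blast
qed

lemma rep_one: "finite I \<Longrightarrow> rep I \<one>\<^bsub>mat_alg I\<^esub> (\<lambda>f. f)"
  by (auto simp: rep_def if_distrib[of "\<lambda>z. z * _"] split: if_splits cong: if_cong)

lemma rep_smult: "rep I A P \<Longrightarrow> rep I (\<lambda>u v. c * A u v) (\<lambda>f u. c * P f u)"
  by (auto simp: rep_def sum_distrib_left mult.assoc)

lemma rep_add: "rep I A P \<Longrightarrow> rep I B Q \<Longrightarrow> rep I (\<lambda>u v. A u v + B u v) (\<lambda>f u. P f u + Q f u)"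
  unfolding rep_def mat_alg_simps by (simp add: sum.distrib distrib_right) (metis add_0)

lemma rep_zero: "rep I (\<lambda>u v. 0) (\<lambda>f u. 0)"
  by (simp add: rep_def)

definition word_op :: "('g \<Rightarrow> 'f \<Rightarrow> 'f) \<Rightarrow> 'g list \<Rightarrow> 'f \<Rightarrow> 'f" where
  "word_op P w = foldr P w"

lemma word_op_simps [simp]: "word_op P [] f = f" "word_op P (g # w) f = P g (word_op P w f)"
  "word_op P (w @ w') f = word_op P w (word_op P w' f)"
  by (simp_all add: word_op_def)

definition alg_op :: "('g \<Rightarrow> ('i \<Rightarrow> 'k) \<Rightarrow> ('i \<Rightarrow> 'k)) \<Rightarrow> ('g list \<Rightarrow>\<^sub>0 'k::field) \<Rightarrow> ('i \<Rightarrow> 'k) \<Rightarrow> ('i \<Rightarrow> 'k)" where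
  "alg_op P x f u = leval (\<lambda>w. word_op P w f u) x"

lemma rep_word:
  assumes "finite I" "\<And>g. g \<in> set w \<Longrightarrow> rep I (\<rho> g) (P g)"
  shows "rep I (word_eval (mat_alg I) \<rho> w) (word_op P w)"
  using assms(2)
proof (induction w)
  case Nil
  have "word_op P [] = (\<lambda>f. f)" by (auto simp: word_op_def)
  then show ?case using rep_one[OF assms(1)] by (simp only: word_eval_Nil)
next
  case (Cons g w)
  have "rep I (\<rho> g \<otimes>\<^bsub>mat_alg I\<^esub> word_eval (mat_alg I) \<rho> w) (\<lambda>f. P g (word_op P w f))"
    using Cons by (intro rep_comp assms(1)) auto
  moreover have "word_op P (g # w) = (\<lambda>f. P g (word_op P w f))" by (auto simp: word_op_def)
  ultimately show ?case by (simp only: word_eval_Cons)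
qed

locale rep_alg =
  fixes I :: "'i set" and G :: "'g set" and \<rho> :: "'g \<Rightarrow> 'i \<Rightarrow> 'i \<Rightarrow> 'k::field" and P
  assumes fin: "finite I" and rep_gen: "\<And>g. g \<in> G \<Longrightarrow> rep I (\<rho> g) (P g)"
begin

abbreviation "ev \<equiv> free_eval (mat_alg I) \<rho>"
abbreviation "wev \<equiv> word_eval (mat_alg I) \<rho>"

lemma word_rep: "w \<in> Poly_Mapping.keys x \<Longrightarrow> x \<in> Free G \<Longrightarrow> rep I (wev w) (word_op P w)"
  by (rule rep_word[OF fin], rule rep_gen) (auto simp: Free_def)

lemma free_eval_entry:
  assumes "x \<in> Free G"
  shows "ev x = (\<lambda>u v. leval (\<lambda>w. wev w u v) x)"
proof -
  have "wev w \<in> carrier (mat_alg I)" if "w \<in> Poly_Mapping.keys x" for w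
    using rep_carrier[OF word_rep[OF that assms]] .
  then show ?thesis
    unfolding free_eval_def
    by (subst mat_alg_finsum[OF fin]) (auto simp: leval_def)
qed

lemma rep_free_eval:
  assumes "x \<in> Free G"
  shows "rep I (ev x) (alg_op P x)"
proof -
  have 1: "rep I (wev w) (word_op P w)" if "w \<in> Poly_Mapping.keys x" for w
    using word_rep[OF that assms] .
  have "ev x \<in> carrier (mat_alg I)"
  proof -
    { fix u v assume "ev x u v \<noteq> 0"
      then obtain w where "w \<in> Poly_Mapping.keys x" "Poly_Mapping.lookup x w * wev w u v \<noteq> 0"
        unfolding free_eval_entry[OF assms] leval_def by (rule sum.not_neutral_contains_not_neutral)
      then have "u \<in> I \<and> v \<in> I" using rep_carrier[OF 1] by auto }
    then show ?thesis unfolding mat_alg_simps mem_Collect_eq by blast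
  qed
  moreover have "alg_op P x f u = (\<Sum>v\<in>I. ev x u v * f v)" if "u \<in> I" for f u
  proof -
    have "alg_op P x f u = leval (\<lambda>w. \<Sum>v\<in>I. wev w u v * f v) x"
      unfolding alg_op_def by (rule leval_cong) (simp add: rep_apply[OF 1 that])
    then show ?thesis by (simp add: leval_linear free_eval_entry[OF assms])
  qed
  ultimately show ?thesis unfolding rep_def by blast
qed

lemma free_eval_gen: "g \<in> G \<Longrightarrow> ev (gen g) = \<rho> g"
  by (rule rep_unique[OF fin rep_free_eval rep_gen]) (auto simp: alg_op_def)

lemma free_eval_hom:
  assumes "x \<in> Free G" "y \<in> Free G"
  shows "ev (x + y) = ev x \<oplus>\<^bsub>mat_alg I\<^esub> ev y"
    and "ev (x * y) = ev x \<otimes>\<^bsub>mat_alg I\<^esub> ev y"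
    and "ev (scal c * x) = c \<odot>\<^bsub>mat_alg I\<^esub> ev x"
proof -
  note r = rep_free_eval[OF assms(1)] rep_free_eval[OF assms(2)]
  show "ev (x + y) = ev x \<oplus>\<^bsub>mat_alg I\<^esub> ev y"
    using assms by (simp add: free_eval_entry[of x] free_eval_entry[of y] free_eval_entry[OF Free_add] leval_add)
  show "ev (scal c * x) = c \<odot>\<^bsub>mat_alg I\<^esub> ev x"
    using assms by (simp add: free_eval_entry[of x] free_eval_entry[OF Free_mult])
  show "ev (x * y) = ev x \<otimes>\<^bsub>mat_alg I\<^esub> ev y"
  proof (rule rep_unique[OF fin rep_free_eval[OF Free_mult[OF assms]] rep_comp[OF fin r]])
    fix f u assume u: "u \<in> I"
    have "word_op P w (alg_op P y f) u = leval (\<lambda>w'. word_op P w (word_op P w' f) u) y" if "w \<in> Poly_Mapping.keys x" for w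
    proof -
      have w: "rep I (wev w) (word_op P w)"
        using word_rep[OF that assms(1)] .
      show ?thesis
        by (simp add: rep_apply[OF w u] alg_op_def leval_linear)
    qed
    then show "alg_op P (x * y) f u = alg_op P x (alg_op P y f) u"
      by (auto simp: alg_op_def[of P "x * y"] alg_op_def[of P x] leval_mult intro: leval_cong)
  qed
qed

lemma free_eval_one: "ev 1 = \<one>\<^bsub>mat_alg I\<^esub>"
  by (simp add: free_eval_entry[OF Free_1])

text \<open>The relation ideal is the least ideal containing the relations; with the kernel known to
  be an ideal, it suffices that the relations themselves evaluate to zero.\<close>

lemma free_eval_ker_ideal: "ideal {x \<in> Free G. ev x = \<zero>\<^bsub>mat_alg I\<^esub>} (free_alg G)"
proof -
  have c: "ev x \<in> carrier (mat_alg I)" if "x \<in> Free G" for x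
    using rep_free_eval[OF that] by (rule rep_carrier)
  have "ring_hom_ring (free_alg G) (mat_alg I) (ev)"
    by (rule ring_hom_ringI[OF free_alg_ring mat_alg_ring[OF fin]])
      (unfold free_alg_carrier, use c free_eval_hom free_eval_one in auto)
  then interpret ring_hom_ring "free_alg G" "mat_alg I" "ev" .
  have "{x \<in> Free G. ev x = \<zero>\<^bsub>mat_alg I\<^esub>} = a_kernel (free_alg G) (mat_alg I) (ev)"
    unfolding a_kernel_def' free_alg_carrier ..
  then show ?thesis using kernel_is_ideal by simp
qed

end

section \<open>Evaluation on quotients by relations\<close>

lemma rel_ideal_ideal: "Rel \<subseteq> Free G \<Longrightarrow> ideal (rel_ideal G Rel) (free_alg G)"
  unfolding rel_ideal_def by (rule ring.genideal_ideal[OF free_alg_ring]) (simp add: Free_def)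

lemma rel_ideal_self: "Rel \<subseteq> Free G \<Longrightarrow> Rel \<subseteq> rel_ideal G Rel"
  unfolding rel_ideal_def by (rule ring.genideal_self[OF free_alg_ring]) (simp add: Free_def)

lemma rel_ideal_subset: "Rel \<subseteq> Free G \<Longrightarrow> rel_ideal G Rel \<subseteq> Free G"
  using ideal.Icarr[OF rel_ideal_ideal] free_alg_carrier by blast

lemma rel_ideal_closed:
  fixes G :: "'g set" and Rel :: "('g list \<Rightarrow>\<^sub>0 'k::field) set"
  assumes "Rel \<subseteq> Free G"
  shows "0 \<in> rel_ideal G Rel"
    and "x \<in> rel_ideal G Rel \<Longrightarrow> y \<in> rel_ideal G Rel \<Longrightarrow> x + y \<in> rel_ideal G Rel"
    and "x \<in> rel_ideal G Rel \<Longrightarrow> - x \<in> rel_ideal G Rel"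
    and "x \<in> rel_ideal G Rel \<Longrightarrow> y \<in> Free G \<Longrightarrow> y * x \<in> rel_ideal G Rel"
    and "x \<in> rel_ideal G Rel \<Longrightarrow> y \<in> Free G \<Longrightarrow> x * y \<in> rel_ideal G Rel"
proof -
  interpret ideal "rel_ideal G Rel" "free_alg G" by (rule rel_ideal_ideal) fact
  show "0 \<in> rel_ideal G Rel" using additive_subgroup.zero_closed[OF is_additive_subgroup] by simp
  show "x \<in> rel_ideal G Rel \<Longrightarrow> y \<in> rel_ideal G Rel \<Longrightarrow> x + y \<in> rel_ideal G Rel" using additive_subgroup.a_closed[OF is_additive_subgroup] by simp
  show l: "x \<in> rel_ideal G Rel \<Longrightarrow> y \<in> Free G \<Longrightarrow> y * x \<in> rel_ideal G Rel" for x y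
    using I_l_closed[of x y] by (simp add: Free_def)
  show "x \<in> rel_ideal G Rel \<Longrightarrow> y \<in> Free G \<Longrightarrow> x * y \<in> rel_ideal G Rel"
    using I_r_closed[of x y] by (simp add: Free_def)
  show "x \<in> rel_ideal G Rel \<Longrightarrow> - x \<in> rel_ideal G Rel" using l[of x "- 1"] by auto
qed

lemma presented_alg_simps [simp]:
  "carrier (presented_alg G Rel) = carrier (free_alg G Quot rel_ideal G Rel)"
  "mult (presented_alg G Rel) = mult (free_alg G Quot rel_ideal G Rel)"
  "one (presented_alg G Rel) = one (free_alg G Quot rel_ideal G Rel)"
  "add (presented_alg G Rel) = add (free_alg G Quot rel_ideal G Rel)"
  "smult (presented_alg G Rel) = (\<lambda>c X. \<Union>x\<in>X. rel_ideal G Rel +>\<^bsub>free_alg G\<^esub> (c \<odot>\<^bsub>free_alg G\<^esub> x))"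
  by (simp_all add: presented_alg_def Let_def)

lemma presented_carrier:
  "carrier (presented_alg G Rel) = (\<lambda>x. rel_ideal G Rel +>\<^bsub>free_alg G\<^esub> x) ` Free G"
  unfolding free_alg_carrier[symmetric]
  by (auto simp: FactRing_def A_RCOSETS_def RCOSETS_def a_r_coset_def simp del: free_alg_simps)

lemma coset_mem: "y \<in> J +>\<^bsub>free_alg G\<^esub> x \<longleftrightarrow> (\<exists>j\<in>J. y = j + x)"
  by (auto simp: a_r_coset_def')

lemma UN_const_eq: "(\<And>y. y \<in> X \<Longrightarrow> f y = f x) \<Longrightarrow> x \<in> X \<Longrightarrow> (\<Union>y\<in>X. f y) = f x"
  by blast

text \<open>Relations are checked on coordinate functions at points of \<open>I\<close>, where they
  are identities between operators. Both the quantum group and the Hecke algebra enter as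
  instances.\<close>

locale presented_rep = rep_alg I G \<rho> P
  for I :: "'i set" and G :: "'g set" and \<rho> :: "'g \<Rightarrow> 'i \<Rightarrow> 'i \<Rightarrow> 'k::field" and P +
  fixes Rel :: "('g list \<Rightarrow>\<^sub>0 'k) set"
  assumes Rel_Free: "Rel \<subseteq> Free G"
    and Rel_zero: "\<And>x f u. x \<in> Rel \<Longrightarrow> u \<in> I \<Longrightarrow> alg_op P x f u = 0"
begin

abbreviation "J \<equiv> rel_ideal G Rel"
abbreviation "cls x \<equiv> J +>\<^bsub>free_alg G\<^esub> x"
abbreviation "pev \<equiv> presented_eval (mat_alg I) \<rho>"

lemma ideal_zero:
  assumes "x \<in> J" shows "ev x = \<zero>\<^bsub>mat_alg I\<^esub>"
proof -
  have "Rel \<subseteq> {x \<in> Free G. ev x = \<zero>\<^bsub>mat_alg I\<^esub>}"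
  proof
    fix x assume x: "x \<in> Rel"
    then have "x \<in> Free G" using Rel_Free by blast
    moreover have "ev x = (\<lambda>u v. 0)"
      using rep_free_eval[OF \<open>x \<in> Free G\<close>] rep_zero by (rule rep_unique[OF fin]) (simp add: Rel_zero[OF x])
    ultimately show "x \<in> {x \<in> Free G. ev x = \<zero>\<^bsub>mat_alg I\<^esub>}" by simp
  qed
  then have "J \<subseteq> {x \<in> Free G. ev x = \<zero>\<^bsub>mat_alg I\<^esub>}"
    unfolding rel_ideal_def by (rule ring.genideal_minimal[OF free_alg_ring free_eval_ker_ideal])
  then show ?thesis using assms by blast
qed

text \<open>Representatives differ by elements of the ideal, which evaluate to zero, so the image of
  a coset is a singleton and \<open>the_elem\<close> is meaningful.\<close>

lemma presented_eval_coset: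
  assumes "x \<in> Free G"
  shows "pev (cls x) = ev x"
proof -
  have "ev y = ev x" if y: "y \<in> cls x" for y
  proof -
    obtain j where j: "j \<in> J" "y = j + x" using y by (auto simp: coset_mem)
    then have "j \<in> Free G" using rel_ideal_subset[OF Rel_Free] by blast
    then show ?thesis using free_eval_hom(1)[OF _ assms, of j] ideal_zero[OF j(1)] j(2) by simp
  qed
  moreover have "x \<in> cls x"
    using rel_ideal_closed(1)[OF Rel_Free] by (force simp: coset_mem)
  ultimately have "ev ` (cls x) = {ev x}" by blast
  then show ?thesis by (simp add: presented_eval_def)
qed

lemma presented_eval_gen: "g \<in> G \<Longrightarrow> pev (presented_gen G Rel g) = \<rho> g"
  by (simp add: presented_gen_def presented_eval_coset Free_gen free_eval_gen)

lemma presented_eval_image: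
  "pev ` carrier (presented_alg G Rel) = ev ` Free G"
  unfolding presented_carrier image_image by (rule image_cong) (auto simp: presented_eval_coset)

lemma coset_smult:
  assumes "x \<in> Free G"
  shows "c \<odot>\<^bsub>presented_alg G Rel\<^esub> (cls x) = cls (scal c * x)"
proof -
  interpret ideal J "free_alg G" by (rule rel_ideal_ideal[OF Rel_Free])
  have "cls (scal c * y) = cls (scal c * x)" if y: "y \<in> cls x" for y
  proof -
    obtain j where j: "j \<in> J" "y = j + x" using y by (auto simp: coset_mem)
    then have "scal c * j \<in> J" by (auto intro: rel_ideal_closed[OF Rel_Free])
    then have "scal c * y \<in> cls (scal c * x)"
      by (auto simp: coset_mem j algebra_simps)
    moreover have "scal c * x \<in> carrier (free_alg G)" unfolding free_alg_carrier using assms by auto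
    ultimately show ?thesis by (rule a_repr_independence'[symmetric])
  qed
  moreover have "x \<in> cls x"
    using rel_ideal_closed(1)[OF Rel_Free] by (force simp: coset_mem)
  ultimately show ?thesis unfolding presented_alg_simps free_alg_simps by (intro UN_const_eq)
qed

lemma presented_eval_hom: "pev \<in> alg_hom (presented_alg G Rel) (mat_alg I)"
proof -
  interpret ideal J "free_alg G" by (rule rel_ideal_ideal[OF Rel_Free])
  have m: "(cls x) \<otimes>\<^bsub>presented_alg G Rel\<^esub> (cls y) = cls (x * y)"
    and a: "(cls x) \<oplus>\<^bsub>presented_alg G Rel\<^esub> (cls y) = cls (x + y)"
    if "x \<in> Free G" "y \<in> Free G" for x y
    using that rcoset_mult_add[of x y] a_rcos_sum[of x y] by (auto simp: FactRing_def Free_def)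
  show ?thesis
    unfolding alg_hom_def
  proof (safe intro!: ring_hom_memI)
    fix X c assume "X \<in> carrier (presented_alg G Rel)"
    then obtain x where x: "x \<in> Free G" "X = cls x" by (auto simp only: presented_carrier)
    show "pev X \<in> carrier (mat_alg I)"
      using rep_carrier[OF rep_free_eval] x by (simp only: presented_eval_coset)
    show "pev (c \<odot>\<^bsub>presented_alg G Rel\<^esub> X) = c \<odot>\<^bsub>mat_alg I\<^esub> pev X"
      using x by (simp only: coset_smult presented_eval_coset Free_mult Free_scal free_eval_hom(3)[OF x(1) x(1)])
    fix Y assume "Y \<in> carrier (presented_alg G Rel)"
    then obtain y where y: "y \<in> Free G" "Y = cls y" by (auto simp only: presented_carrier)
    show "pev (X \<otimes>\<^bsub>presented_alg G Rel\<^esub> Y) = pev X \<otimes>\<^bsub>mat_alg I\<^esub> pev Y"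
      using x y by (simp only: m presented_eval_coset Free_mult free_eval_hom(2))
    show "pev (X \<oplus>\<^bsub>presented_alg G Rel\<^esub> Y) = pev X \<oplus>\<^bsub>mat_alg I\<^esub> pev Y"
      using x y by (simp only: a presented_eval_coset Free_add free_eval_hom(1))
  next
    have "\<one>\<^bsub>presented_alg G Rel\<^esub> = cls 1" by (simp add: FactRing_def)
    then show "pev \<one>\<^bsub>presented_alg G Rel\<^esub> = \<one>\<^bsub>mat_alg I\<^esub>"
      by (simp only: presented_eval_coset Free_1 free_eval_one)
  qed
qed

lemma presented_eval_inj:
  assumes "\<And>x. x \<in> Free G \<Longrightarrow> ev x = \<zero>\<^bsub>mat_alg I\<^esub> \<Longrightarrow> x \<in> J"
  shows "inj_on (pev) (carrier (presented_alg G Rel))"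
proof (rule inj_onI)
  interpret ideal J "free_alg G" by (rule rel_ideal_ideal[OF Rel_Free])
  fix X Y assume "X \<in> carrier (presented_alg G Rel)" "Y \<in> carrier (presented_alg G Rel)"
    and eq: "pev X = pev Y"
  then obtain x y where x: "x \<in> Free G" "X = cls x" and y: "y \<in> Free G" "Y = cls y"
    by (auto simp only: presented_carrier)
  have e: "ev x = ev y"
    using eq x y by (simp only: presented_eval_coset)
  have "ev (x - y) = \<zero>\<^bsub>mat_alg I\<^esub>"
    using e x(1) y(1) by (simp add: free_eval_entry Free_diff leval_diff fun_eq_iff)
  then have "x - y \<in> J" using assms x y by blast
  then have "x \<in> cls y" unfolding coset_mem by (intro bexI[of _ "x - y"]) auto
  moreover have "y \<in> carrier (free_alg G)" unfolding free_alg_carrier by (rule y(1))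
  ultimately show "X = Y" unfolding x y by (rule a_repr_independence'[symmetric])
qed

end

section \<open>The Hecke algebra acting on functions on words\<close>

definition lin :: "(('a \<Rightarrow> 'k::field) \<Rightarrow> ('b \<Rightarrow> 'k)) \<Rightarrow> bool" where
  "lin P \<longleftrightarrow> (\<forall>a b f g u. P (\<lambda>v. a * f v + b * g v) u = a * P f u + b * P g u)"

lemma lin_comb: "lin P \<Longrightarrow> P (\<lambda>v. a * f v + b * g v) = (\<lambda>u. a * P f u + b * P g u)"
  by (auto simp: lin_def)

lemma lin_add: "lin P \<Longrightarrow> P (\<lambda>v. f v + g v) = (\<lambda>u. P f u + P g u)"
  using lin_comb[of P 1 f 1 g] by simp

lemma lin_cmul: "lin P \<Longrightarrow> P (\<lambda>v. a * f v) = (\<lambda>u. a * P f u)"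
  using lin_comb[of P a f 0 f] by simp

lemma lin_zero: "lin P \<Longrightarrow> P (\<lambda>v. 0) = (\<lambda>u. 0)"
  using lin_cmul[of P 0 "\<lambda>v. 0"] by simp

lemma lin_sum: "lin P \<Longrightarrow> P (\<lambda>v. \<Sum>a\<in>A. f a v) = (\<lambda>u. \<Sum>a\<in>A. P (f a) u)"
proof (induction A rule: infinite_finite_induct)
  case (insert x F)
  then show ?case by (simp add: lin_add[OF insert.prems])
qed (auto simp: lin_zero)

lemma lin_word_op: "(\<And>g. g \<in> set w \<Longrightarrow> lin (P g)) \<Longrightarrow> lin (word_op P w)"
proof (induction w)
  case (Cons g w)
  then have g: "lin (P g)" and w: "lin (word_op P w)" by auto
  show ?case unfolding lin_def by (simp add: lin_comb[OF w] lin_comb[OF g])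
qed (simp add: lin_def)

lemma lin_alg_op: "(\<And>g. lin (P g)) \<Longrightarrow> lin (alg_op P x)"
  using lin_word_op[of _ P] unfolding lin_def alg_op_def by (simp add: leval_linear)

text \<open>The outer word operators are linear and pass through the finite sum over the inner
  words; on words the product is concatenation.\<close>

lemma alg_op_mult:
  assumes "\<And>g. lin (P g)"
  shows "alg_op P (x * y) f = alg_op P x (alg_op P y f)"
proof
  fix u
  have "word_op P w (alg_op P y f) u = leval (\<lambda>w'. word_op P (w @ w') f u) y" for w
  proof -
    have l: "lin (word_op P w)" using assms by (rule lin_word_op)
    show ?thesis unfolding alg_op_def leval_def by (simp add: lin_sum[OF l] lin_cmul[OF l])
  qed
  then show "alg_op P (x * y) f u = alg_op P x (alg_op P y f) u"
    by (simp add: alg_op_def[of P x] alg_op_def[of P "x * y"] leval_mult)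
qed

lemma alg_op_linear:
  "alg_op P (x + y) f u = alg_op P x f u + alg_op P y f u"
  "alg_op P (x - y) f u = alg_op P x f u - alg_op P y f u"
  "alg_op P 0 f u = 0" "alg_op P 1 f u = f u" "alg_op P (gen g) f u = P g f u" "alg_op P (scal c * x) f u = c * alg_op P x f u"
  by (simp_all add: alg_op_def leval_add leval_diff)

lemma length_ge2: "Suc 0 < length u \<Longrightarrow> \<exists>x y v. u = x # y # v"
  \<comment> \<open>The case rule of \<open>remdups_adj\<close> happens to split a list into empty,
    singleton and two leading letters.\<close>
  by (cases u rule: remdups_adj.cases) auto

lemma length_ge3: "Suc (Suc 0) < length u \<Longrightarrow> \<exists>x y z v. u = x # y # z # v"
  using length_ge2[of "tl u"] by (cases u) auto

abbreviation delta :: "'a \<Rightarrow> 'a \<Rightarrow> 'k::field" where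
  "delta v \<equiv> (\<lambda>u. if u = v then 1 else 0)"

abbreviation "Hfree k \<equiv> Free (hecke_gens k)"

section \<open>Hecke operators on words and their relations\<close>

locale two_params =
  fixes r s :: "'k::field"
  assumes r0: "r \<noteq> 0" and s0: "s \<noteq> 0" and rs_generic: "\<And>m. m \<ge> 1 \<Longrightarrow> (r * inverse s) ^ m \<noteq> 1"
begin

lemma rs: "r \<noteq> s"
  using rs_generic[of 1] s0 by auto

text \<open>
  \<open>T0 i\<close> is the coordinate form (rows of the matrix) of \<open>s R\<close> at the positions \<open>i\<close>, \<open>i + 1\<close> counted
  from 0, while the generators \<open>T\<^sub>i\<close> are counted from 1. The letters are unbounded.
\<close>

fun T0 :: "nat \<Rightarrow> (nat list \<Rightarrow> 'k) \<Rightarrow> nat list \<Rightarrow> 'k" where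
  "T0 0 f (x # y # u) = (if x = y then s * f (x # y # u) else if x < y then f (y # x # u)
      else r * s * f (y # x # u) + (s - r) * f (x # y # u))"
| "T0 (Suc i) f (x # u) = T0 i (\<lambda>v. f (x # v)) u"
| "T0 i f u = f u"

definition T :: "nat \<Rightarrow> (nat list \<Rightarrow> 'k) \<Rightarrow> nat list \<Rightarrow> 'k" where
  "T i = T0 (i - 1)"

abbreviation "wordT \<equiv> word_op T"
abbreviation "opT \<equiv> alg_op T"

lemma lin_T0: "lin (T0 i)"
proof -
  have "T0 i (\<lambda>v. a * f v + b * g v) u = a * T0 i f u + b * T0 i g u" for a b f g u
  proof (induction i arbitrary: f g u)
    case 0
    then show ?case by (cases u rule: remdups_adj.cases) (auto simp: algebra_simps)
  next
    case (Suc i)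
    then show ?case by (cases u) auto
  qed
  then show ?thesis by (simp add: lin_def)
qed

lemma lin_T: "lin (T i)"
  by (simp add: T_def lin_T0)

text \<open>Leading letters are stripped by induction, leaving two. Equal letters give
  \<open>s\<close>; two distinct letters and their swap give a 2 by 2 block with trace
  \<open>s - r\<close> and determinant \<open>- r * s\<close>, hence eigenvalues \<open>s\<close>
  and \<open>- r\<close>.\<close>

lemma T0_quadratic:
  "Suc i < length u \<Longrightarrow> T0 i (T0 i f) u = (s - r) * T0 i f u + r * s * f u"
proof (induction i arbitrary: f u)
  case 0
  then obtain x y u' where "u = x # y # u'" using length_ge2 by blast
  then show ?case by (auto simp: algebra_simps)
next
  case (Suc i)
  then obtain x u' where "u = x # u'" by (cases u) auto
  with Suc show ?case by simp
qed

lemma T0_braid: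
  "Suc (Suc i) < length u \<Longrightarrow> T0 i (T0 (Suc i) (T0 i f)) u = T0 (Suc i) (T0 i (T0 (Suc i) f)) u"
proof (induction i arbitrary: f u)
  case 0
  then obtain x y z u' where "u = x # y # z # u'" using length_ge3 by blast
  then show ?case
    by (cases x y rule: linorder_cases; cases y z rule: linorder_cases; cases x z rule: linorder_cases;
        simp; simp add: algebra_simps)
next
  case (Suc i)
  then obtain x u' where "u = x # u'" by (cases u) auto
  with Suc show ?case by simp
qed

text \<open>Once the lower position is at the front, the other operator acts behind the two affected
  letters and passes through by linearity. On words too short for its position \<open>T0\<close> is
  the identity, so lengths do not enter.\<close>

lemma T0_commute:
  "i + 2 \<le> j \<Longrightarrow> T0 i (T0 j f) u = T0 j (T0 i f) u"
proof (induction i arbitrary: f u j)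
  case 0
  then have "j = Suc (Suc (j - 2))" by simp
  then obtain j' where j: "j = Suc (Suc j')" ..
  show ?case
  proof (cases u rule: remdups_adj.cases)
    case (3 x y v)
    show ?thesis unfolding j 3
      by (cases x y rule: linorder_cases) (simp_all add: lin_comb[OF lin_T0] lin_cmul[OF lin_T0])
  qed (simp_all add: j)
next
  case (Suc i)
  then obtain j' where j: "j = Suc j'" "i + 2 \<le> j'" by (cases j) auto
  then show ?case using Suc.IH[of j'] by (cases u) auto
qed

text \<open>The operators only permute letters, so the value at \<open>u\<close> depends on
  \<open>f\<close> at rearrangements of \<open>u\<close> alone. Invariance of weight spaces is used
  throughout in this form.\<close>

lemma T0_cong: "(\<And>v. mset v = mset u \<Longrightarrow> f v = g v) \<Longrightarrow> T0 i f u = T0 i g u"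
proof (induction i f u arbitrary: g rule: T0.induct)
  case (1 f x y u)
  then have "f (x # y # u) = g (x # y # u)" "f (y # x # u) = g (y # x # u)" by auto
  then show ?case by (cases "x = y") auto
qed auto

lemma word_op_T_cong: "(\<And>v. mset v = mset u \<Longrightarrow> f v = g v) \<Longrightarrow> wordT w f u = wordT w g u"
  by (induction w arbitrary: u) (auto simp: T_def[of "_ :: nat"] intro!: T0_cong)

lemma T0_append: "Suc i < length u \<Longrightarrow> T0 i f (u @ c) = T0 i (\<lambda>v. f (v @ c)) u"
proof (induction i arbitrary: f u)
  case 0
  then obtain x y u' where "u = x # y # u'" using length_ge2 by blast
  then show ?case by auto
next
  case (Suc i)
  then show ?case by (cases u) auto
qed

lemma word_op_T_append:
  "set w \<subseteq> {1..<length u} \<Longrightarrow> wordT w f (u @ c) = wordT w (\<lambda>v. f (v @ c)) u"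
proof (induction w arbitrary: u)
  case (Cons i w)
  have "T0 (i - 1) (wordT w f) (u @ c) = T0 (i - 1) (\<lambda>v. wordT w f (v @ c)) u"
    using Cons.prems by (intro T0_append) auto
  also have "\<dots> = T0 (i - 1) (wordT w (\<lambda>v. f (v @ c))) u"
  proof (rule T0_cong)
    fix v assume "mset v = mset u"
    then have "length v = length u" by (rule mset_eq_length)
    then show "wordT w f (v @ c) = wordT w (\<lambda>v. f (v @ c)) v" using Cons by auto
  qed
  finally show ?case by (simp add: T_def[of i])
qed simp

lemma hecke_rels_Free: "hecke_rels k r s \<subseteq> Hfree k"
  unfolding hecke_rels_def hecke_gens_def
  by (auto intro!: Free_diff Free_mult Free_add Free_gen Free_scal Free_power)

abbreviation "JH k \<equiv> rel_ideal (hecke_gens k) (hecke_rels k r s)"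

lemmas JH_closed = rel_ideal_closed[OF hecke_rels_Free]

lemma alg_op_hecke_rels:
  assumes "x \<in> hecke_rels k r s" "length u = k"
  shows "opT x f u = 0"
proof -
  consider (b) i where "1 \<le> i" "i + 1 < k" "x = gen i * gen (i+1) * gen i - gen (i+1) * gen i * gen (i+1)"
    | (c) i j where "i \<in> {1..<k}" "j \<in> {1..<k}" "\<bar>int i - int j\<bar> \<ge> 2" "x = gen i * gen j - gen j * gen i"
    | (q) i where "i \<in> {1..<k}" "x = gen i ^ 2 - (scal (s - r) * gen i + scal (r * s))"
    using assms(1) unfolding hecke_rels_def by blast
  then show ?thesis
  proof cases
    case b
    then have "T0 (i-1) (T0 i (T0 (i-1) f)) u = T0 i (T0 (i-1) (T0 i f)) u"
      using T0_braid[of "i-1" u f] assms(2) by simp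
    with b show ?thesis by (simp add: alg_op_def leval_mult leval_diff T_def)
  next
    case c
    have "T0 (i-1) (T0 (j-1) f) u = T0 (j-1) (T0 (i-1) f) u"
    proof (cases "i < j")
      case True with c show ?thesis by (intro T0_commute) auto
    next
      case False with c show ?thesis by (intro T0_commute[symmetric]) auto
    qed
    with c show ?thesis by (simp add: alg_op_def leval_mult leval_diff T_def)
  next
    case q
    then have "T0 (i-1) (T0 (i-1) f) u = (s - r) * T0 (i-1) f u + r * s * f u"
      using T0_quadratic[of "i-1" u f] assms(2) by auto
    with q show ?thesis by (simp add: alg_op_def leval_mult leval_diff leval_add T_def power2_eq_square)
  qed
qed

text \<open>
  Normal forms: the generators are ordered by the cosets of \<open>H\<^bsub>m\<^esub>\<close> in \<open>H\<^bsub>m+1\<^esub>\<close>, with representatives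
  \<open>T\<^sub>m T\<^bsub>m-1\<^esub> \<dots> T\<^sub>j\<close> (empty for \<open>j = m + 1\<close>).
\<close>

primrec NF :: "nat \<Rightarrow> nat list set" where
  "NF 0 = {[]}"
| "NF (Suc m) = {w @ rev [j..<Suc m] | w j. w \<in> NF m \<and> 1 \<le> j \<and> j \<le> Suc m}"

lemma NF_letters: "w \<in> NF m \<Longrightarrow> set w \<subseteq> {1..<m}"
  by (induction m arbitrary: w) fastforce+

lemma finite_NF: "finite (NF m)"
proof (induction m)
  case (Suc m)
  have "NF (Suc m) = (\<lambda>(w, j). w @ rev [j..<Suc m]) ` (NF m \<times> {1..Suc m})"
    by (auto simp del: upt_Suc simp: image_iff) blast+
  then show ?case using Suc by simp
qed simp

lemma NF_Nil: "[] \<in> NF m"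
proof (induction m)
  case (Suc m)
  then show ?case by (simp only: NF.simps mem_Collect_eq) (intro exI[of _ "[]"] exI[of _ "Suc m"], simp)
qed simp

section \<open>Spanning by normal forms modulo the relations\<close>

abbreviation mon :: "nat list \<Rightarrow> nat list \<Rightarrow>\<^sub>0 'k" where
  "mon w \<equiv> Poly_Mapping.single w 1"

lemma mon_mult: "mon v * mon w = mon (v @ w)"
  by (simp add: mult_single plus_list_def)

lemma mon_Nil: "mon [] = 1"
  using single_one[where 'a = "nat list" and 'b = 'k] by (simp add: zero_list_def)

text \<open>Combinations of normal forms on \<open>m\<close> strands modulo the relations on
  \<open>k\<close> strands: \<open>m\<close> varies in the induction while the ideal stays that of
  the full algebra.\<close>

inductive_set NF_span :: "nat \<Rightarrow> nat \<Rightarrow> (nat list \<Rightarrow>\<^sub>0 'k) set" for k m where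
  NF_span_basis: "w \<in> NF m \<Longrightarrow> mon w \<in> NF_span k m"
| NF_span_zero: "0 \<in> NF_span k m"
| NF_span_add: "x \<in> NF_span k m \<Longrightarrow> y \<in> NF_span k m \<Longrightarrow> x + y \<in> NF_span k m"
| NF_span_scal: "x \<in> NF_span k m \<Longrightarrow> scal c * x \<in> NF_span k m"
| NF_span_mod: "x \<in> NF_span k m \<Longrightarrow> j \<in> JH k \<Longrightarrow> x + j \<in> NF_span k m"

definition hecke_eqv :: "nat \<Rightarrow> (nat list \<Rightarrow>\<^sub>0 'k) \<Rightarrow> (nat list \<Rightarrow>\<^sub>0 'k) \<Rightarrow> bool" where
  "hecke_eqv k x y \<longleftrightarrow> x - y \<in> JH k"

lemma NF_span_hecke_eqv: "x \<in> NF_span k m \<Longrightarrow> hecke_eqv k y x \<Longrightarrow> y \<in> NF_span k m"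
  using NF_span_mod[of x k m "y - x"] by (simp add: hecke_eqv_def)

lemma hecke_eqv_trans: "hecke_eqv k x y \<Longrightarrow> hecke_eqv k y z \<Longrightarrow> hecke_eqv k x z"
  unfolding hecke_eqv_def using JH_closed(2)[of "x - y" k "y - z"] by simp

lemma hecke_eqv_sym: "hecke_eqv k x y \<Longrightarrow> hecke_eqv k y x"
  unfolding hecke_eqv_def using JH_closed(3)[of "x - y" k] by simp

lemma hecke_eqv_refl: "hecke_eqv k x x"
  by (simp add: hecke_eqv_def JH_closed)

lemma mon_Free: "set w \<subseteq> {1..<k} \<Longrightarrow> mon w \<in> Hfree k"
  by (simp add: Free_single hecke_gens_def)

lemma hecke_eqv_mon:
  assumes "hecke_eqv k x y" "set v \<subseteq> {1..<k}" "set w \<subseteq> {1..<k}"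
  shows "hecke_eqv k (mon v * x * mon w) (mon v * y * mon w)"
proof -
  have "mon v * (x - y) * mon w \<in> JH k"
    using assms unfolding hecke_eqv_def by (intro JH_closed(5) JH_closed(4) mon_Free)
  then show ?thesis by (simp add: hecke_eqv_def algebra_simps)
qed

lemma hecke_eqv_commute_gen:
  assumes "i \<in> {1..<k}" "j \<in> {1..<k}" "i + 2 \<le> j \<or> j + 2 \<le> i"
  shows "hecke_eqv k (mon [i, j]) (mon [j, i])"
proof -
  have "gen i * gen j - gen j * gen i \<in> hecke_rels k r s"
  proof -
    have "\<bar>int i - int j\<bar> \<ge> 2" using assms(3) by linarith
    then show ?thesis unfolding hecke_rels_def using assms(1,2) by blast
  qed
  then show ?thesis using rel_ideal_self[OF hecke_rels_Free, of k]
    by (auto simp: hecke_eqv_def gen_def mon_mult)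
qed

lemma hecke_eqv_braid:
  assumes "1 \<le> i" "i + 1 < k"
  shows "hecke_eqv k (mon [i + 1, i, i + 1]) (mon [i, i + 1, i])"
proof -
  have "gen i * gen (i+1) * gen i - gen (i+1) * gen i * gen (i+1) \<in> hecke_rels k r s"
    unfolding hecke_rels_def using assms by blast
  then have "hecke_eqv k (mon [i, i + 1, i]) (mon [i + 1, i, i + 1])"
    using rel_ideal_self[OF hecke_rels_Free, of k]
    by (auto simp: hecke_eqv_def gen_def mon_mult)
  then show ?thesis by (rule hecke_eqv_sym)
qed

lemma hecke_eqv_quad:
  assumes "i \<in> {1..<k}"
  shows "hecke_eqv k (mon [i, i]) (scal (s - r) * mon [i] + scal (r * s) * mon [])"
proof -
  have "gen i ^ 2 - (scal (s - r) * gen i + scal (r * s)) \<in> hecke_rels k r s"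
    unfolding hecke_rels_def using assms by blast
  then show ?thesis using rel_ideal_self[OF hecke_rels_Free, of k]
    by (auto simp: hecke_eqv_def gen_def mon_mult mon_Nil power2_eq_square)
qed

lemma hecke_eqv_commute_word:
  assumes "i \<in> {1..<k}" "\<And>j. j \<in> set w \<Longrightarrow> j \<in> {1..<k} \<and> (i + 2 \<le> j \<or> j + 2 \<le> i)"
  shows "hecke_eqv k (mon (i # w)) (mon (w @ [i]))"
  using assms(2)
proof (induction w)
  case (Cons j w)
  have "hecke_eqv k (mon [] * mon [i, j] * mon w) (mon [] * mon [j, i] * mon w)"
    using Cons.prems assms(1) by (intro hecke_eqv_mon hecke_eqv_commute_gen) auto
  moreover have "hecke_eqv k (mon [j] * mon (i # w) * mon []) (mon [j] * mon (w @ [i]) * mon [])"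
    using Cons.prems assms(1) by (intro hecke_eqv_mon Cons.IH) auto
  ultimately show ?case by (auto simp: mon_mult intro: hecke_eqv_trans)
qed (simp add: hecke_eqv_refl)

lemma NF_span_mult_tail:
  assumes "x \<in> NF_span k m" "1 \<le> j" "j \<le> Suc m" "Suc m \<le> k"
  shows "x * mon (rev [j..<Suc m]) \<in> NF_span k (Suc m)"
  using assms(1)
proof (induction rule: NF_span.induct)
  case (NF_span_basis w)
  then have "w @ rev [j..<Suc m] \<in> NF (Suc m)" using assms by auto
  then show ?case unfolding mon_mult by (rule NF_span.NF_span_basis)
next
  case (NF_span_mod x i)
  have "i * mon (rev [j..<Suc m]) \<in> JH k"
    using NF_span_mod assms by (intro JH_closed mon_Free) auto
  then show ?case using NF_span_mod by (simp add: distrib_right NF_span.NF_span_mod)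
qed (auto simp: distrib_right mult.assoc intro: NF_span.NF_span_add NF_span.NF_span_zero NF_span.NF_span_scal)

text \<open>A normal form \<open>w\<close> T_m ... T_j is multiplied by T_i on the right. For i < j
  - 1 the new factor commutes into \<open>w\<close>; for i = j - 1 it lengthens the tail; for i = j
  the quadratic relation applies; for i > j a braid relation passes it to \<open>w\<close> with
  index i - 1.\<close>

lemma NF_span_mult_gen:
  assumes "m \<le> k" "i \<in> {1..<m}" "x \<in> NF_span k m"
  shows "x * mon [i] \<in> NF_span k m"
  using assms
proof (induction m arbitrary: x i)
  case (Suc m)
  note k = Suc.prems(1)
  from Suc.prems(3) show ?case
  proof (induction rule: NF_span.induct)
    case (NF_span_basis v)
    then obtain w j where v: "v = w @ rev [j..<Suc m]" and w: "w \<in> NF m" and j: "1 \<le> j" "j \<le> Suc m" by auto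
    have wk: "set w \<subseteq> {1..<k}" using NF_letters[OF w] k by auto
    have i: "i \<in> {1..<k}" "i \<le> m" "1 \<le> i" using Suc.prems(2) k by auto
    have *: "mon (w @ [l] @ rev [j'..<Suc m]) \<in> NF_span k (Suc m)" if "1 \<le> l" "l < m" "1 \<le> j'" "j' \<le> Suc m" for l j'
    proof -
      have "mon w * mon [l] \<in> NF_span k m" using that k w by (intro Suc.IH NF_span.NF_span_basis) auto
      then have "mon w * mon [l] * mon (rev [j'..<Suc m]) \<in> NF_span k (Suc m)"
        using that k by (intro NF_span_mult_tail) auto
      then show ?thesis by (simp add: mon_mult)
    qed
    consider (a) "i + 1 < j" | (b) "i + 1 = j" | (c) "i = j" | (d) "i > j" by linarith
    then show ?case
    proof cases
      case a
      have "hecke_eqv k (mon (i # rev [j..<Suc m])) (mon (rev [j..<Suc m] @ [i]))"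
        using a i j k by (intro hecke_eqv_commute_word) auto
      then have "hecke_eqv k (mon w * mon (rev [j..<Suc m] @ [i]) * mon []) (mon w * mon (i # rev [j..<Suc m]) * mon [])"
        using wk by (intro hecke_eqv_mon) (auto intro: hecke_eqv_sym)
      then have "hecke_eqv k (mon v * mon [i]) (mon (w @ [i] @ rev [j..<Suc m]))" by (simp add: mon_mult v)
      moreover have "mon (w @ [i] @ rev [j..<Suc m]) \<in> NF_span k (Suc m)" using a i j by (intro *) auto
      ultimately show ?thesis by (rule NF_span_hecke_eqv[rotated])
    next
      case b
      have "rev [i..<Suc m] = rev [j..<Suc m] @ [i]" using b i by (simp add: upt_conv_Cons)
      then have "mon v * mon [i] = mon (w @ rev [i..<Suc m])" by (simp add: mon_mult v)
      moreover have "w @ rev [i..<Suc m] \<in> NF (Suc m)" using w i unfolding NF.simps by (intro CollectI exI[of _ w] exI[of _ i]) auto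
      ultimately show ?thesis by (auto intro: NF_span.NF_span_basis simp del: NF.simps)
    next
      case c
      have e: "rev [j..<Suc m] = rev [Suc i..<Suc m] @ [i]" using c i by (simp add: upt_conv_Cons)
      have "hecke_eqv k (mon (w @ rev [Suc i..<Suc m]) * mon [i, i] * mon [])
         (mon (w @ rev [Suc i..<Suc m]) * (scal (s - r) * mon [i] + scal (r * s) * mon []) * mon [])"
        using wk i k by (intro hecke_eqv_mon hecke_eqv_quad) auto
      moreover have sc: "mon y * (scal c * z) = scal c * (mon y * z)" for y c z
      proof -
        have "mon y * scal c = scal c * mon y" by (simp add: scal_def mult_single plus_list_def)
        then show ?thesis by (metis mult.assoc)
      qed
      ultimately have "hecke_eqv k (mon v * mon [i])
         (scal (s - r) * mon (w @ rev [i..<Suc m]) + scal (r * s) * mon (w @ rev [Suc i..<Suc m]))"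
        unfolding v e distrib_left distrib_right sc mult.assoc mon_mult using c e by simp
      moreover have "w @ rev [i..<Suc m] \<in> NF (Suc m)" "w @ rev [Suc i..<Suc m] \<in> NF (Suc m)"
        using w i unfolding NF.simps by (intro CollectI exI[of _ w] exI[of _ i] exI[of _ "Suc i"]; auto)+
      ultimately show ?thesis by (blast intro: NF_span_hecke_eqv[OF NF_span_add[OF NF_span_scal[OF NF_span.NF_span_basis] NF_span_scal[OF NF_span.NF_span_basis]]])
    next
      case d
      \<comment> \<open>The new T_i commutes back to the factors T_i T_l of the tail; then T_i T_l
        T_i = T_l T_i T_l, and the left T_l commutes with all T of index above i.\<close>
      define l where "l = i - 1"
      have l: "i = Suc l" "j \<le> l" "1 \<le> l" "l < m" "l \<in> {1..<k}" "l + 1 < k" using d j i k by (auto simp: l_def)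
      have "[j..<Suc m] = [j..<l] @ [l..<Suc m]" using l upt_add_eq_append[of j l "Suc m - l"] by simp
      also have "[l..<Suc m] = l # Suc l # [Suc (Suc l)..<Suc m]" using l by (simp add: upt_conv_Cons)
      finally have e: "rev [j..<Suc m] = rev [Suc (Suc l)..<Suc m] @ [Suc l, l] @ rev [j..<l]" by simp
      let ?A = "rev [Suc (Suc l)..<Suc m]" and ?B = "rev [j..<l]"
      have A: "set (w @ ?A) \<subseteq> {1..<k}" "set ?A \<subseteq> {1..<k}" and B: "set ?B \<subseteq> {1..<k}" using wk k l j by auto
      have "hecke_eqv k (mon (w @ ?A @ [Suc l, l]) * mon (?B @ [i]) * mon []) (mon (w @ ?A @ [Suc l, l]) * mon (i # ?B) * mon [])"
        using A l j k i by (intro hecke_eqv_mon hecke_eqv_sym[OF hecke_eqv_commute_word]) auto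
      then have "hecke_eqv k (mon v * mon [i]) (mon (w @ ?A) * mon [Suc l, l, Suc l] * mon ?B)"
        unfolding v e by (simp add: mon_mult l)
      moreover have "hecke_eqv k (mon (w @ ?A) * mon [Suc l, l, Suc l] * mon ?B) (mon (w @ ?A) * mon [l, Suc l, l] * mon ?B)"
        using hecke_eqv_braid[of l k] l A B by (intro hecke_eqv_mon) auto
      moreover have "hecke_eqv k (mon w * mon (?A @ [l]) * mon ([Suc l, l] @ ?B)) (mon w * mon (l # ?A) * mon ([Suc l, l] @ ?B))"
        using wk B l k by (intro hecke_eqv_mon hecke_eqv_sym[OF hecke_eqv_commute_word]) auto
      then have "hecke_eqv k (mon (w @ ?A) * mon [l, Suc l, l] * mon ?B) (mon (w @ [l] @ rev [j..<Suc m]))"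
        unfolding e by (simp add: mon_mult)
      moreover have "mon (w @ [l] @ rev [j..<Suc m]) \<in> NF_span k (Suc m)" using l j by (intro *) auto
      ultimately show ?thesis by (blast intro: NF_span_hecke_eqv hecke_eqv_trans)
    qed
  next
    case (NF_span_mod x j)
    have "j * mon [i] \<in> JH k"
      using NF_span_mod Suc.prems by (intro JH_closed mon_Free) auto
    then show ?case using NF_span_mod by (simp add: distrib_right NF_span.NF_span_mod)
  qed (auto simp: distrib_right mult.assoc intro: NF_span.NF_span_add NF_span.NF_span_zero NF_span.NF_span_scal)
qed simp

lemma Free_NF_span: "x \<in> Hfree k \<Longrightarrow> x \<in> NF_span k k"
proof (induction rule: Free_induct)
  case (single w c)
  have "mon w \<in> NF_span k k" using single
  proof (induction w rule: rev_induct)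
    case Nil show ?case using NF_Nil by (rule NF_span_basis)
  next
    case (snoc i w)
    then have "mon w * mon [i] \<in> NF_span k k" by (intro NF_span_mult_gen) (auto simp: hecke_gens_def)
    then show ?case by (simp add: mon_mult)
  qed
  then have "scal c * mon w \<in> NF_span k k" by (rule NF_span_scal)
  then show ?case by simp
qed (auto intro: NF_span.NF_span_add NF_span.NF_span_zero NF_span.NF_span_scal)

lemma NF_span_expand:
  "x \<in> NF_span k m \<Longrightarrow> \<exists>c. x - (\<Sum>w\<in>NF m. Poly_Mapping.single w (c w)) \<in> JH k"
proof (induction rule: NF_span.induct)
  case (NF_span_basis v)
  have "(\<Sum>w\<in>NF m. Poly_Mapping.single w (if w = v then 1 else 0)) = mon v"
    using NF_span_basis finite_NF by (subst sum.remove[of _ v]) auto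
  then show ?case by (intro exI[of _ "\<lambda>w. if w = v then 1 else 0"]) (simp add: JH_closed)
next
  case NF_span_zero
  show ?case by (intro exI[of _ "\<lambda>w. 0"]) (simp add: JH_closed)
next
  case (NF_span_add x y)
  then obtain c d where "x - (\<Sum>w\<in>NF m. Poly_Mapping.single w (c w)) \<in> JH k"
    "y - (\<Sum>w\<in>NF m. Poly_Mapping.single w (d w)) \<in> JH k" by blast
  from JH_closed(2)[OF this] show ?case
    by (intro exI[of _ "\<lambda>w. c w + d w"]) (simp add: single_add sum.distrib algebra_simps)
next
  case (NF_span_scal x b)
  then obtain c where "x - (\<Sum>w\<in>NF m. Poly_Mapping.single w (c w)) \<in> JH k" by blast
  from JH_closed(4)[OF this, of "scal b"] show ?case
    by (intro exI[of _ "\<lambda>w. b * c w"]) (simp add: right_diff_distrib sum_distrib_left)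
next
  case (NF_span_mod x j)
  then obtain c where "x - (\<Sum>w\<in>NF m. Poly_Mapping.single w (c w)) \<in> JH k" by blast
  from JH_closed(2)[OF this NF_span_mod.hyps(2)] show ?case
    by (intro exI[of _ c]) (simp add: algebra_simps)
qed

lemma Free_expand:
  assumes "x \<in> Hfree k"
  obtains c where "x - (\<Sum>w\<in>NF k. Poly_Mapping.single w (c w)) \<in> JH k"
  using NF_span_expand[OF Free_NF_span[OF assms]] by blast

end

section \<open>A Markov trace\<close>

text \<open>Rank factorisation, valid in every characteristic: with \<open>B\<close> a basis of the
  column space, \<open>g = B C\<close>. As \<open>g\<close> kills its own columns and
  \<open>B\<close> is independent, \<open>C B = 0\<close>; and the traces of \<open>B C\<close> and
  \<open>C B\<close> agree.\<close>

lemma nilpotent_square_trace: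
  fixes g :: "'a \<Rightarrow> 'a \<Rightarrow> 'k::field"
  assumes S: "finite S" and sq: "\<And>u w. u \<in> S \<Longrightarrow> w \<in> S \<Longrightarrow> (\<Sum>v\<in>S. g u v * g v w) = 0"
  shows "(\<Sum>u\<in>S. g u u) = 0"
proof -
  interpret V: vector_space "\<lambda>(c::'k) (f::'a \<Rightarrow> 'k) x. c * f x"
    by standard (auto simp: algebra_simps)
  define col where "col v = (\<lambda>u. if u \<in> S then g u v else 0)" for v
  obtain B where B: "B \<subseteq> col ` S" "V.independent B" "col ` S \<subseteq> V.span B"
    using V.maximal_independent_subset by blast
  have fB: "finite B" using B(1) S finite_subset by blast
  define c where "c v b = V.representation B (col v) b" for v b
  have app: "(\<Sum>b\<in>B. (\<lambda>x. a b * b x)) t = (\<Sum>b\<in>B. a b * b t)" for a :: "('a \<Rightarrow> 'k) \<Rightarrow> 'k" and t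
    using fB by (induction B rule: finite_induct) auto
  have col: "col v t = (\<Sum>b\<in>B. c v b * b t)" if "v \<in> S" for v t
  proof -
    have "col v = (\<Sum>b\<in>B. (\<lambda>x. c v b * b x))"
      unfolding c_def using that B fB by (intro V.sum_representation_eq[symmetric]) auto
    then have "col v t = (\<Sum>b\<in>B. (\<lambda>x. c v b * b x)) t" by (rule fun_cong)
    then show ?thesis unfolding app .
  qed
  \<comment> \<open>An entry of \<open>C B\<close>: the column \<open>b\<close> is killed by
    \<open>g\<close>, and the result is expanded in the independent set \<open>B\<close>.\<close>
  have z: "(\<Sum>v\<in>S. c v b' * b v) = 0" if b: "b \<in> B" "b' \<in> B" for b b'
  proof -
    obtain w where w: "w \<in> S" "b = col w" using b(1) B(1) by blast
    have "(\<Sum>d\<in>B. (\<lambda>x. (\<Sum>v\<in>S. c v d * b v) * d x)) = 0"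
    proof
      fix t
      have "(\<Sum>d\<in>B. (\<Sum>v\<in>S. c v d * b v) * d t) = (\<Sum>v\<in>S. \<Sum>d\<in>B. c v d * b v * d t)"
        unfolding sum_distrib_right by (rule sum.swap)
      also have "\<dots> = (\<Sum>v\<in>S. col v t * b v)"
        by (rule sum.cong) (simp_all add: col sum_distrib_left sum_distrib_right ac_simps)
      also have "\<dots> = 0"
        using sq[of t w] w by (cases "t \<in> S") (auto simp: col_def)
      finally show "(\<Sum>d\<in>B. (\<lambda>x. (\<Sum>v\<in>S. c v d * b v) * d x)) t = 0 t" by (simp add: app)
    qed
    then show ?thesis by (rule V.independentD[OF B(2) fB order_refl _ b(2)])
  qed
  have "(\<Sum>u\<in>S. g u u) = (\<Sum>u\<in>S. \<Sum>b\<in>B. c u b * b u)"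
    by (rule sum.cong) (simp_all add: col[symmetric] col_def)
  also have "\<dots> = (\<Sum>b\<in>B. \<Sum>u\<in>S. c u b * b u)" by (rule sum.swap)
  also have "\<dots> = 0" by (simp add: z)
  finally show ?thesis .
qed

lemma finite_words: "finite (words n k)"
proof -
  have "words n k \<subseteq> {w. set w \<subseteq> {1..n} \<and> length w = k}" by (auto simp: words_def)
  then show ?thesis using finite_lists_length_eq[of "{1..n}" k] finite_subset by fastforce
qed

lemma words_mset: "mset v = mset w \<Longrightarrow> w \<in> words n k \<Longrightarrow> v \<in> words n k"
  by (auto simp: words_def dest: mset_eq_length mset_eq_setD)

lemma words_0: "words n 0 = {[]}"
  by (auto simp: words_def)

lemma sum_words_Suc: "(\<Sum>w\<in>words n (Suc k). h w) = (\<Sum>w\<in>words n k. \<Sum>i=1..n. h (w @ [i]))"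
proof -
  have "words n (Suc k) = (\<lambda>(w, i). w @ [i]) ` (words n k \<times> {1..n})"
  proof (rule Set.set_eqI)
    fix w show "w \<in> words n (Suc k) \<longleftrightarrow> w \<in> (\<lambda>(w, i). w @ [i]) ` (words n k \<times> {1..n})"
      by (cases w rule: rev_cases) (auto simp: words_def image_iff)
  qed
  then have "(\<Sum>w\<in>words n (Suc k). h w) = (\<Sum>(w, i)\<in>words n k \<times> {1..n}. h (w @ [i]))"
    by (simp add: sum.reindex inj_on_def split_def)
  then show ?thesis by (simp add: sum.cartesian_product)
qed

section \<open>Linear independence of the normal forms\<close>

lemma sorted_less_split:
  assumes "sorted_wrt (<) (u :: nat list)" "x \<in> set u"
  obtains a b where "u = a @ x # b" "sorted_wrt (<) (a @ b)" "\<And>y. y \<in> set b \<Longrightarrow> x < y"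
  using assms split_list[OF assms(2)] by (fastforce simp: sorted_wrt_append)

lemma list_split_at:
  assumes "1 \<le> j" "j \<le> length u"
  obtains a x b where "u = a @ x # b" "j = Suc (length a)"
  using id_take_nth_drop[of "j - 1" u] assms
  by (intro that[of "take (j - 1) u" "u ! (j - 1)" "drop j u"]) auto

context two_params begin

lemma lin_xT: "lin (opT x)"
  by (rule lin_alg_op) (rule lin_T)

lemma lin_wT: "lin (wordT w)"
  by (rule lin_word_op) (rule lin_T)

lemma xT_mult: "opT (x * y) f = opT x (opT y f)"
  by (rule alg_op_mult) (rule lin_T)

lemma alg_op_T_cong:
  assumes "\<And>v. mset v = mset u \<Longrightarrow> f v = g v" shows "opT x f u = opT x g u"
  unfolding alg_op_def using word_op_T_cong[of u f g] assms by simp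

lemma alg_op_T_zero: "(\<And>v. mset v = mset u \<Longrightarrow> f v = 0) \<Longrightarrow> opT x f u = 0"
  using alg_op_T_cong[of u f "\<lambda>v. 0" x] lin_zero[OF lin_xT, of x] by simp

lemma alg_op_T_append:
  assumes "x \<in> Free (hecke_gens m)" "length u = m"
  shows "opT x f (u @ c) = opT x (\<lambda>v. f (v @ c)) u"
  unfolding alg_op_def using assms by (intro leval_cong word_op_T_append) (auto simp: Free_def hecke_gens_def)

text \<open>With unbounded letters the index set of words is infinite, out of reach of the finite
  matrix algebras. Instead the elements that act by zero on words of length \<open>k\<close> are
  seen directly to form an ideal.\<close>

lemma JH_alg_op:
  assumes "x \<in> JH k" "length u = k" shows "opT x f u = 0"
proof -
  let ?K = "{x \<in> Hfree k. \<forall>f u. length u = k \<longrightarrow> opT x f u = 0}"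
  interpret F: ring "free_alg (hecke_gens k) :: ('k, nat list \<Rightarrow>\<^sub>0 'k) module" by (rule free_alg_ring)
  have "ideal ?K (free_alg (hecke_gens k))"
  proof (rule idealI[OF free_alg_ring])
    show "subgroup ?K (add_monoid (free_alg (hecke_gens k)))"
    proof (rule group.subgroupI[OF F.a_group])
      show "?K \<subseteq> carrier (add_monoid (free_alg (hecke_gens k)))" by (auto simp: Free_def)
      show "?K \<noteq> {}" using alg_op_linear(3) by (auto intro!: exI[of _ 0])
      fix a assume a: "a \<in> ?K"
      have "inv\<^bsub>add_monoid (free_alg (hecke_gens k))\<^esub> a = - a"
        using a by (intro group.inv_equality[OF F.a_group]) (auto simp: Free_def in_keys_iff)
      moreover have "- a = 0 - a" by simp
      ultimately show "inv\<^bsub>add_monoid (free_alg (hecke_gens k))\<^esub> a \<in> ?K"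
        using a by (auto simp: alg_op_linear simp del: diff_0)
      fix b assume "b \<in> ?K"
      then show "a \<otimes>\<^bsub>add_monoid (free_alg (hecke_gens k))\<^esub> b \<in> ?K"
        using a by (auto simp: alg_op_linear)
    qed
    fix a x :: "nat list \<Rightarrow>\<^sub>0 'k" assume a: "a \<in> ?K" and "x \<in> carrier (free_alg (hecke_gens k))"
    then have x: "x \<in> Hfree k" by (simp add: Free_def)
    have "opT x (opT a f) u = 0" if "length u = k" for f u
      by (rule alg_op_T_zero) (use that a in \<open>auto dest: mset_eq_length\<close>)
    then show "x \<otimes>\<^bsub>free_alg (hecke_gens k)\<^esub> a \<in> ?K" using a x by (auto simp: xT_mult)
    show "a \<otimes>\<^bsub>free_alg (hecke_gens k)\<^esub> x \<in> ?K" using a x by (auto simp: xT_mult)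
  qed
  moreover have "hecke_rels k r s \<subseteq> ?K" using hecke_rels_Free alg_op_hecke_rels by blast
  ultimately have "JH k \<subseteq> ?K" unfolding rel_ideal_def by (intro F.genideal_minimal)
  then show ?thesis using assms by blast
qed

text \<open>The basis word is read only in the row of the swapped, descending pair; the diagonal
  term \<open>s - r\<close> of that row meets a coordinate where the delta function vanishes.
  Turning an ascent into a descent thus costs just the scalar \<open>r * s\<close>.\<close>

lemma T0_delta: "x < y \<Longrightarrow> T0 (length a) (delta (a @ x # y # b)) z = r * s * delta (a @ y # x # b) z"
proof (induction a arbitrary: z)
  case Nil
  then show ?case by (cases z rule: remdups_adj.cases) auto
next
  case (Cons c a)
  show ?case
  proof (cases z)
    case (Cons d z')
    show ?thesis
    proof (cases "d = c")
      case True
      then show ?thesis using Cons.IH[OF Cons.prems] \<open>z = d # z'\<close> by simp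
    next
      case False
      then show ?thesis using lin_zero[OF lin_T0[of "length a"]] \<open>z = d # z'\<close> by simp
    qed
  qed simp
qed

text \<open>The coset representative moves \<open>x\<close> to the right past larger letters; each
  single move creates a descent, so no correction terms arise.\<close>

lemma shift_delta:
  assumes "\<And>y. y \<in> set b \<Longrightarrow> x < y"
  shows "wordT (rev [Suc (length a)..<Suc (length a + length b)]) (delta (a @ x # b @ c)) =
      (\<lambda>z. (r * s) ^ length b * delta (a @ b @ x # c) z)"
  using assms
proof (induction b arbitrary: c rule: rev_induct)
  case (snoc y b)
  have "rev [Suc (length a)..<Suc (length a + length (b @ [y]))]
     = Suc (length a + length b) # rev [Suc (length a)..<Suc (length a + length b)]" by simp
  moreover have "wordT (rev [Suc (length a)..<Suc (length a + length b)]) (delta (a @ x # b @ y # c)) =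
      (\<lambda>z. (r * s) ^ length b * delta (a @ b @ x # y # c) z)"
    using snoc by auto
  moreover have "T (Suc (length a + length b)) (\<lambda>z. (r * s) ^ length b * delta (a @ b @ x # y # c) z)
     = (\<lambda>z. (r * s) ^ length b * (r * s * delta (a @ b @ y # x # c) z))"
    using T0_delta[of x y "a @ b" c] snoc.prems
    by (subst lin_cmul[OF lin_T]) (simp add: fun_eq_iff T_def[of "Suc _"])
  ultimately show ?case by (simp del: upt_Suc add: ac_simps)
qed simp

text \<open>The scalar records that each letter of a normal form turns an ascent of the word reached
  so far into a descent, at the price \<open>r * s\<close>.\<close>

definition sends_delta :: "nat list \<Rightarrow> nat list \<Rightarrow> nat list \<Rightarrow> bool" where
  "sends_delta w u v \<longleftrightarrow> mset v = mset u \<and>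
     (\<forall>z. length z = length u \<longrightarrow> wordT w (delta u) z = (r * s) ^ length w * delta v z)"

lemma sends_delta_step:
  assumes "sends_delta w (a @ b) v" "set w \<subseteq> {1..<length (a @ b)}" "\<And>y. y \<in> set b \<Longrightarrow> x < y"
  shows "sends_delta (w @ rev [Suc (length a)..<Suc (length (a @ b))]) (a @ x # b) (v @ [x])"
proof -
  have lv: "length v = length (a @ b)" using assms(1) unfolding sends_delta_def by (blast dest: mset_eq_length)
  have "wordT (w @ rev [Suc (length a)..<Suc (length (a @ b))]) (delta (a @ x # b)) z
     = (r * s) ^ length (w @ rev [Suc (length a)..<Suc (length (a @ b))]) * delta (v @ [x]) z"
    if z: "length z = length (a @ x # b)" for z
  proof -
    obtain z' p where z': "z = z' @ [p]" "length z' = length (a @ b)" using z by (cases z rule: rev_cases) auto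
    have w: "set w \<subseteq> {1..<length z'}" using assms(2) z' by simp
    have "wordT (w @ rev [Suc (length a)..<Suc (length (a @ b))]) (delta (a @ x # b)) z
       = wordT w (\<lambda>z. (r * s) ^ length b * delta (a @ b @ [x]) z) z"
      using shift_delta[OF assms(3), of b a "[]"] by (simp del: upt_Suc)
    also have "\<dots> = (r * s) ^ length b * wordT w (delta (a @ b @ [x])) z"
      by (simp only: lin_cmul[OF lin_wT])
    also have "wordT w (delta (a @ b @ [x])) z = wordT w (\<lambda>v. delta (a @ b @ [x]) (v @ [p])) z'"
      unfolding z' by (rule word_op_T_append) (use w in auto)
    finally have "wordT (w @ rev [Suc (length a)..<Suc (length (a @ b))]) (delta (a @ x # b)) z
       = (r * s) ^ length b * wordT w (\<lambda>v. delta (a @ b @ [x]) (v @ [p])) z'" .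
    moreover have "wordT w (\<lambda>v. delta (a @ b @ [x]) (v @ [p])) z' = (if p = x then (r * s) ^ length w * delta v z' else 0)"
    proof (cases "p = x")
      case True
      then have "(\<lambda>v. delta (a @ b @ [x]) (v @ [p])) = delta (a @ b)" by (auto simp: fun_eq_iff)
      then show ?thesis using assms(1) z' True unfolding sends_delta_def by simp
    next
      case False
      then have "(\<lambda>v. delta (a @ b @ [x]) (v @ [p])) = (\<lambda>v. 0)" by (auto simp: fun_eq_iff simp flip: append_assoc)
      then show ?thesis using lin_zero[OF lin_wT] False by simp
    qed
    moreover have "length (w @ rev [Suc (length a)..<Suc (length (a @ b))]) = length w + length b" by (simp del: upt_Suc)
    ultimately show ?thesis using z' by (auto simp: power_add simp del: upt_Suc)
  qed
  then show ?thesis using assms(1) unfolding sends_delta_def by simp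
qed

lemma sends_delta_unique:
  assumes "sends_delta w u v" "sends_delta w u v'" shows "v = v'"
proof -
  have l: "length v = length u" using assms(1) unfolding sends_delta_def by (blast dest: mset_eq_length)
  have "wordT w (delta u) v = (r * s) ^ length w * delta v v" using assms(1) l unfolding sends_delta_def by blast
  moreover have "wordT w (delta u) v = (r * s) ^ length w * delta v' v" using assms(2) l unfolding sends_delta_def by blast
  ultimately have "(r * s) ^ length w * delta v v = (r * s) ^ length w * (delta v' v :: 'k)" by (rule trans[OF sym])
  then show ?thesis using r0 s0 by (auto split: if_splits)
qed

lemma sends_delta_ex: "sorted_wrt (<) u \<Longrightarrow> w \<in> NF (length u) \<Longrightarrow> \<exists>v. sends_delta w u v"
proof (induction "length u" arbitrary: u w)
  case 0
  then show ?case by (intro exI[of _ "[]"]) (auto simp: sends_delta_def)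
next
  case (Suc m)
  then have "w \<in> NF (Suc m)" by simp
  then obtain w' j where w: "w = w' @ rev [j..<Suc m]" "w' \<in> NF m" "1 \<le> j" "j \<le> Suc m" unfolding NF.simps by blast
  obtain a x b where u: "u = a @ x # b" and j: "j = Suc (length a)"
    using list_split_at[of j u] w Suc.hyps(2) by auto
  have s: "sorted_wrt (<) (a @ b)" "\<And>y. y \<in> set b \<Longrightarrow> x < y" using Suc.prems(1) unfolding u by (auto simp: sorted_wrt_append)
  have m: "m = length (a @ b)" using Suc.hyps(2) u by simp
  then obtain v where "sends_delta w' (a @ b) v" using Suc.hyps(1)[OF m s(1)] w by auto
  from sends_delta_step[OF this _ s(2)] NF_letters[OF w(2)] show ?case unfolding u w j m by blast
qed

lemma sends_delta_surj: "sorted_wrt (<) u \<Longrightarrow> mset v = mset u \<Longrightarrow> \<exists>w\<in>NF (length u). sends_delta w u v"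
proof (induction v arbitrary: u rule: rev_induct)
  case Nil
  then show ?case by (auto simp: sends_delta_def)
next
  case (snoc x v)
  then have "x \<in> set u" by (metis in_set_conv_decomp mset_eq_setD)
  then obtain a b where u: "u = a @ x # b" "sorted_wrt (<) (a @ b)" "\<And>y. y \<in> set b \<Longrightarrow> x < y"
    using sorted_less_split snoc.prems(1) by blast
  then obtain w where w: "w \<in> NF (length (a @ b))" "sends_delta w (a @ b) v"
    using snoc.IH[of "a @ b"] snoc.prems by auto
  have "sends_delta (w @ rev [Suc (length a)..<Suc (length (a @ b))]) u (v @ [x])"
    unfolding u(1) using sends_delta_step[OF w(2) _ u(3)] NF_letters[OF w(1)] by blast
  moreover have "w @ rev [Suc (length a)..<Suc (length (a @ b))] \<in> NF (length u)"
  proof -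
    have l: "length u = Suc (length (a @ b))" using u by simp
    show ?thesis unfolding l NF.simps(2) mem_Collect_eq using w(1) by (intro exI[of _ w] exI[of _ "Suc (length a)"]) auto
  qed
  ultimately show ?case by blast
qed

text \<open>The letters of \<open>u\<close> are distinct, so the last letter of \<open>v\<close>
  tells which letter was moved to the end, hence the tail of the normal form; the rest is compared
  by induction.\<close>

lemma sends_delta_inj:
  "sorted_wrt (<) u \<Longrightarrow> w \<in> NF (length u) \<Longrightarrow> w' \<in> NF (length u) \<Longrightarrow> sends_delta w u v \<Longrightarrow> sends_delta w' u v \<Longrightarrow> w = w'"
proof (induction "length u" arbitrary: u w w' v)
  case 0
  then show ?case by auto
next
  case (Suc m)
  have *: "\<exists>a x b y v'. z = y @ rev [Suc (length a)..<Suc m] \<and> y \<in> NF m \<and> u = a @ x # b \<and> sorted_wrt (<) (a @ b)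
      \<and> sends_delta y (a @ b) v' \<and> v = v' @ [x]" if z: "z \<in> NF (length u)" "sends_delta z u v" for z
  proof -
    obtain y j where y: "z = y @ rev [j..<Suc m]" "y \<in> NF m" "1 \<le> j" "j \<le> Suc m"
      using z(1) unfolding Suc.hyps(2)[symmetric] NF.simps by blast
    obtain a x b where u: "u = a @ x # b" and j: "j = Suc (length a)"
      using list_split_at[of j u] y Suc.hyps(2) by auto
    have s: "sorted_wrt (<) (a @ b)" "\<And>y. y \<in> set b \<Longrightarrow> x < y" using Suc.prems(1) unfolding u by (auto simp: sorted_wrt_append)
    have m: "m = length (a @ b)" using Suc.hyps(2) u by simp
    then obtain v' where v': "sends_delta y (a @ b) v'" using sends_delta_ex[OF s(1)] y by auto
    have "sends_delta z u (v' @ [x])" using sends_delta_step[OF v' _ s(2)] NF_letters[OF y(2)] unfolding u y j m by blast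
    then have "v = v' @ [x]" using sends_delta_unique z(2) by blast
    then show ?thesis using y u s v' j by blast
  qed
  obtain a x b y v' where 1: "w = y @ rev [Suc (length a)..<Suc m]" "y \<in> NF m" "u = a @ x # b" "sorted_wrt (<) (a @ b)" "sends_delta y (a @ b) v'" "v = v' @ [x]"
    using *[OF Suc.prems(2,4)] by blast
  obtain a' x' b' y' v'' where 2: "w' = y' @ rev [Suc (length a')..<Suc m]" "y' \<in> NF m" "u = a' @ x' # b'" "sorted_wrt (<) (a' @ b')" "sends_delta y' (a' @ b') v''" "v = v'' @ [x']"
    using *[OF Suc.prems(3,5)] by blast
  have x: "x = x'" "v' = v''" using 1(6) 2(6) by auto
  have "distinct u" using Suc.prems(1) by (auto simp: strict_sorted_iff)
  then have a: "a = a'" "b = b'" using 1(3) 2(3) x append_Cons_eq_iff[of x a b a' b'] by auto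
  have "m = length (a @ b)" using Suc.hyps(2) 1(3) by simp
  then have "y = y'" using Suc.hyps(1)[of "a @ b" y y' v'] 1 2 a x by auto
  then show ?case using 1 2 a by simp
qed

lemma NF_independent:
  assumes u: "sorted_wrt (<) u" "length u = k"
    and z: "\<And>z. mset z = mset u \<Longrightarrow> opT (\<Sum>w\<in>NF k. Poly_Mapping.single w (c w)) (delta u) z = 0"
    and w: "w \<in> NF k"
  shows "c w = 0"
proof -
  obtain v where v: "sends_delta w u v" using sends_delta_ex[of u w] u w by auto
  then have mv: "mset v = mset u" "length v = length u" by (auto simp: sends_delta_def dest: mset_eq_length)
  have "0 = opT (\<Sum>w\<in>NF k. Poly_Mapping.single w (c w)) (delta u) v" using z mv by simp
  also have "\<dots> = (\<Sum>x\<in>NF k. c x * wordT x (delta u) v)" by (simp add: alg_op_def leval_sum)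
  also have "\<dots> = (\<Sum>x\<in>NF k. if x = w then c w * (r * s) ^ length w else 0)"
  proof (rule sum.cong)
    fix x assume x: "x \<in> NF k"
    obtain v' where v': "sends_delta x u v'" using sends_delta_ex[of u x] u x by auto
    have "wordT x (delta u) v = (r * s) ^ length x * delta v' v" using v' mv unfolding sends_delta_def by blast
    moreover have "v = v' \<longleftrightarrow> x = w" using sends_delta_inj[of u x w v] v v' sends_delta_unique u w x by metis
    ultimately show "c x * wordT x (delta u) v = (if x = w then c w * (r * s) ^ length w else 0)" by auto
  qed simp
  also have "\<dots> = c w * (r * s) ^ length w" using w finite_NF by simp
  finally show ?thesis using r0 s0 by simp
qed

text \<open>Spanning and independence meet on one vector: \<open>x\<close> is congruent to a
  combination of normal forms, and all its coefficients vanish.\<close>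

lemma Free_faithful:
  assumes "sorted_wrt (<) u" "length u = k" "x \<in> Hfree k"
    and z: "\<And>z. mset z = mset u \<Longrightarrow> opT x (delta u) z = 0"
  shows "x \<in> JH k"
proof -
  obtain c where c: "x - (\<Sum>w\<in>NF k. Poly_Mapping.single w (c w)) \<in> JH k" using Free_expand[OF assms(3)] .
  have "opT (\<Sum>w\<in>NF k. Poly_Mapping.single w (c w)) (delta u) z = 0" if "mset z = mset u" for z
    using JH_alg_op[OF c, of z "delta u"] z[OF that] assms(2) mset_eq_length[OF that] by (simp add: alg_op_linear)
  then have "c w = 0" if "w \<in> NF k" for w using NF_independent assms that by blast
  then show ?thesis using c by simp
qed

text \<open>Rows of ascending pairs are pure swaps without scalar. Reading rows rather than columns
  moves a coordinate of an arbitrary \<open>f\<close>, not only of a basis vector.\<close>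

lemma shift_row:
  assumes "\<And>y. y \<in> set b \<Longrightarrow> x < y"
  shows "wordT [Suc (length a)..<Suc (length a + length b)] f (a @ x # b @ c) = f (a @ b @ x # c)"
  using assms
proof (induction b arbitrary: a)
  case (Cons y b)
  have e: "T0 (length a) f (a @ x # y # v) = f (a @ y # x # v)" for f and v
    using Cons.prems by (induction a arbitrary: f) auto
  have "[Suc (length a)..<Suc (length a + length (y # b))] = Suc (length a) # [Suc (length (a @ [y]))..<Suc (length (a @ [y]) + length b)]"
    by (simp add: upt_conv_Cons del: upt_Suc)
  then have "wordT [Suc (length a)..<Suc (length a + length (y # b))] f (a @ x # (y # b) @ c)
    = wordT [Suc (length (a @ [y]))..<Suc (length (a @ [y]) + length b)] f ((a @ [y]) @ x # b @ c)"
    by (simp del: upt_Suc add: T_def[of "Suc _"] e)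
  also have "\<dots> = f ((a @ [y]) @ b @ x # c)" by (rule Cons.IH) (use Cons.prems in auto)
  finally show ?case by simp
qed simp

text \<open>Every coordinate of \<open>f\<close> in the weight of \<open>u\<close> becomes the
  coordinate at \<open>u\<close> itself after a suitable Hecke word; this makes the form given by
  \<open>tau\<close> nondegenerate.\<close>

lemma row_ex:
  "sorted_wrt (<) u \<Longrightarrow> mset v = mset u \<Longrightarrow> \<exists>w. set w \<subseteq> {1..<length u} \<and> (\<forall>f. wordT w f u = f v)"
proof (induction v arbitrary: u rule: rev_induct)
  case Nil
  then show ?case by (intro exI[of _ "[]"]) auto
next
  case (snoc x v)
  then have "x \<in> set u" by (metis in_set_conv_decomp mset_eq_setD)
  then obtain a b where u: "u = a @ x # b" "sorted_wrt (<) (a @ b)" "\<And>y. y \<in> set b \<Longrightarrow> x < y"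
    using sorted_less_split snoc.prems(1) by blast
  then obtain w where w: "set w \<subseteq> {1..<length (a @ b)}" "\<And>f. wordT w f (a @ b) = f v"
    using snoc.IH[of "a @ b"] snoc.prems by auto
  have "wordT ([Suc (length a)..<Suc (length a + length b)] @ w) f u = f (v @ [x])" for f
  proof -
    have "wordT ([Suc (length a)..<Suc (length a + length b)] @ w) f u = wordT w f (a @ b @ [x])"
      using shift_row[OF u(3), where c = "[]" and a = a and f = "wordT w f"] u(1) by (simp del: upt_Suc)
    also have "\<dots> = f (v @ [x])" using word_op_T_append[of w "a @ b" f "[x]"] w by auto
    finally show ?thesis .
  qed
  moreover have "set ([Suc (length a)..<Suc (length a + length b)] @ w) \<subseteq> {1..<length u}"
    using w u(1) by auto
  ultimately show ?case by blast
qed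

text \<open>
  \<open>qtrace N k\<close> is the quantum trace on the \<open>k\<close>-th tensor power of the \<open>N\<close>-dimensional space. The weights
  are chosen such that the partial trace of \<open>T\<^sub>k\<close> over the last factor is the scalar \<open>s\<close>; hence
  \<open>qtrace N k x\<close> is a polynomial in the quantum integer \<open>qint N\<close>, whose coefficient of degree \<open>k\<close> is the
  canonical trace \<open>tau\<close>.
\<close>

definition ratio :: 'k where "ratio = r * inverse s"

definition qweight :: "nat list \<Rightarrow> 'k" where "qweight w = prod_list (map (\<lambda>i. ratio ^ (i - 1)) w)"

definition qtrace :: "nat \<Rightarrow> nat \<Rightarrow> (nat list \<Rightarrow>\<^sub>0 'k) \<Rightarrow> 'k" where
  "qtrace N k x = (\<Sum>w\<in>words N k. qweight w * opT x (delta w) w)"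

definition qint :: "nat \<Rightarrow> 'k" where "qint N = (\<Sum>i=1..N. ratio ^ (i - 1))"

definition om :: "nat \<Rightarrow> nat list" where "om k = [1..<Suc k]"

definition tau :: "nat \<Rightarrow> (nat list \<Rightarrow>\<^sub>0 'k) \<Rightarrow> 'k" where
  "tau k x = opT x (delta (om k)) (om k)"

lemma om_sorted: "sorted_wrt (<) (om k)" "length (om k) = k"
  by (simp_all add: om_def del: upt_Suc)

lemma om_Suc: "om (Suc k) = om k @ [Suc k]"
  by (simp add: om_def)

lemma qweight_mset: "mset v = mset w \<Longrightarrow> qweight v = qweight w"
  unfolding qweight_def by (metis mset_map prod_mset_prod_list)

lemma alg_op_T_expand:
  assumes "u \<in> words N k"
  shows "opT x f u = (\<Sum>v\<in>words N k. opT x (delta v) u * f v)"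
proof -
  have "opT x f u = opT x (\<lambda>w. \<Sum>v\<in>words N k. f v * delta v w) u"
  proof (rule alg_op_T_cong)
    fix w assume "mset w = mset u"
    then have "w \<in> words N k" using assms words_mset by blast
    then have "(\<Sum>v\<in>words N k. f v * delta v w) = f w"
      using finite_words by (simp add: if_distrib[of "\<lambda>z. _ * z"] cong: if_cong)
    then show "f w = (\<Sum>v\<in>words N k. f v * delta v w)" by simp
  qed
  also have "\<dots> = (\<Sum>v\<in>words N k. f v * opT x (delta v) u)"
    by (simp only: lin_sum[OF lin_xT] lin_cmul[OF lin_xT])
  finally show ?thesis by (simp add: mult.commute)
qed

text \<open>Entries between words of different weight vanish, and \<open>qweight\<close> depends on
  the weight only: the diagonal matrix of weights commutes with the Hecke operators. Symmetry of
  \<open>qtrace\<close> and its vanishing on nilpotents both rest on this.\<close>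

lemma qweight_entry: "qweight u * opT x (delta v) u = qweight v * opT x (delta v) u"
proof (cases "mset u = mset v")
  case True
  then show ?thesis using qweight_mset[of u v] by simp
next
  case False
  then have "opT x (delta v) u = 0" by (intro alg_op_T_zero) auto
  then show ?thesis by simp
qed

lemma qtrace_comm: "qtrace N k (x * y) = qtrace N k (y * x)"
proof -
  have e: "qtrace N k (x * y) = (\<Sum>u\<in>words N k. \<Sum>v\<in>words N k. qweight u * (opT x (delta v) u * opT y (delta u) v))" for x y
    unfolding qtrace_def xT_mult by (simp add: alg_op_T_expand[of _ N k x "opT y _"] sum_distrib_left)
  have "qweight u * (opT x (delta v) u * opT y (delta u) v) = qweight v * (opT y (delta u) v * opT x (delta v) u)" for u v
    unfolding mult.assoc[symmetric] qweight_entry[of u x v] by (simp add: ac_simps)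
  then show ?thesis unfolding e by (subst sum.swap) (intro sum.cong refl)
qed

lemma qtrace_nil:
  assumes "\<And>f u. length u = k \<Longrightarrow> opT x (opT x f) u = 0"
  shows "qtrace N k x = 0"
  unfolding qtrace_def
proof (rule nilpotent_square_trace[OF finite_words, where g = "\<lambda>u v. qweight u * opT x (delta v) u"])
  fix u w assume u: "u \<in> words N k"
  have "(\<Sum>v\<in>words N k. qweight u * opT x (delta v) u * (qweight v * opT x (delta w) v))
     = (\<Sum>v\<in>words N k. qweight u * qweight u * (opT x (delta v) u * opT x (delta w) v))"
  proof (intro sum.cong refl)
    fix v
    have "qweight u * opT x (delta v) u * (qweight v * opT x (delta w) v) = qweight u * (qweight v * opT x (delta v) u) * opT x (delta w) v"
      by (simp only: ac_simps)
    also have "\<dots> = qweight u * (qweight u * opT x (delta v) u) * opT x (delta w) v" by (simp only: qweight_entry[of u x v])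
    finally show "qweight u * opT x (delta v) u * (qweight v * opT x (delta w) v) = qweight u * qweight u * (opT x (delta v) u * opT x (delta w) v)"
      by (simp only: ac_simps)
  qed
  also have "\<dots> = qweight u * qweight u * opT x (opT x (delta w)) u"
    by (simp add: alg_op_T_expand[OF u, of x "opT x _"] sum_distrib_left)
  also have "\<dots> = 0" using assms u by (simp add: words_def)
  finally show "(\<Sum>v\<in>words N k. qweight u * opT x (delta v) u * (qweight v * opT x (delta w) v)) = 0" .
qed

lemma qtrace_linear: "qtrace N k (x - y) = qtrace N k x - qtrace N k y"
  "qtrace N k (\<Sum>a\<in>A. Poly_Mapping.single (g a) (c a)) = (\<Sum>a\<in>A. c a * qtrace N k (mon (g a)))"
proof -
  show "qtrace N k (x - y) = qtrace N k x - qtrace N k y" by (simp add: qtrace_def alg_op_linear right_diff_distrib sum_subtractf)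
  have "qtrace N k (\<Sum>a\<in>A. Poly_Mapping.single (g a) (c a)) = (\<Sum>w\<in>words N k. \<Sum>a\<in>A. c a * (qweight w * wordT (g a) (delta w) w))"
    unfolding qtrace_def alg_op_def leval_sum by (simp add: sum_distrib_left ac_simps)
  also have "\<dots> = (\<Sum>a\<in>A. \<Sum>w\<in>words N k. c a * (qweight w * wordT (g a) (delta w) w))" by (rule sum.swap)
  also have "\<dots> = (\<Sum>a\<in>A. c a * qtrace N k (mon (g a)))" by (simp add: qtrace_def alg_op_def sum_distrib_left)
  finally show "qtrace N k (\<Sum>a\<in>A. Poly_Mapping.single (g a) (c a)) = (\<Sum>a\<in>A. c a * qtrace N k (mon (g a)))" .
qed

lemma qtrace_JH: "x \<in> JH k \<Longrightarrow> qtrace N k x = 0"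
  unfolding qtrace_def by (intro sum.neutral ballI) (simp add: JH_alg_op words_def)

lemma tau_JH: "x \<in> JH k \<Longrightarrow> tau k x = 0"
  by (simp add: tau_def JH_alg_op om_sorted)

lemma tau_linear: "tau k (x - y) = tau k x - tau k y"
  "tau k (\<Sum>a\<in>A. Poly_Mapping.single (g a) (c a)) = (\<Sum>a\<in>A. c a * tau k (mon (g a)))"
  by (simp_all add: tau_def alg_op_def leval_diff leval_sum)

lemma qweight_snoc: "qweight (w @ [i]) = qweight w * ratio ^ (i - 1)"
  by (simp add: qweight_def)

lemma qtrace_stab:
  assumes "x \<in> Hfree k" shows "qtrace N (Suc k) x = qint N * qtrace N k x"
proof -
  have "opT x (delta (w @ [i])) (w @ [i]) = opT x (delta w) w" if "w \<in> words N k" for w i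
    using that assms by (subst alg_op_T_append[of x k]) (auto simp: words_def)
  then show ?thesis
    unfolding qtrace_def sum_words_Suc qint_def
    by (simp add: qweight_snoc sum_distrib_left sum_distrib_right ac_simps)
qed

text \<open>Since \<open>s - r = s * (1 - ratio)\<close>, the terms with i < l telescope to
  \<open>s * (1 - ratio ^ (l - 1))\<close>, which the term i = l completes to \<open>s\<close>.
  Independence of l dictates the choice of the weights. The three cases are diagonal entries of a
  Hecke generator.\<close>

lemma markov_sum:
  assumes "1 \<le> l" "l \<le> N"
  shows "(\<Sum>i=1..N. ratio ^ (i - 1) * (if l = i then s else if l < i then 0 else s - r)) = s"
proof -
  have sp: "s - r = s * (1 - ratio)" using s0 by (simp add: ratio_def right_diff_distrib)
  have g: "(\<Sum>i=1..<l. ratio ^ (i - 1)) * (1 - ratio) = 1 - ratio ^ (l - 1)" for l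
  proof (induction l)
    case (Suc l)
    show ?case
    proof (cases l)
      case (Suc n)
      have "(\<Sum>i=1..<Suc (Suc n). ratio ^ (i - 1)) = (\<Sum>i=1..<Suc n. ratio ^ (i - 1)) + ratio ^ n" by simp
      then show ?thesis using Suc.IH unfolding Suc by (simp only: distrib_right) (simp add: algebra_simps)
    qed simp
  qed simp
  let ?h = "\<lambda>i. ratio ^ (i - 1) * (if l = i then s else if l < i then 0 else s - r)"
  have e: "{1..N} = insert l ({1..<l} \<union> {l<..N})" using assms by auto
  have "sum ?h {1..N} = ?h l + (sum ?h {1..<l} + sum ?h {l<..N})"
    unfolding e by (subst sum.insert, simp, simp, subst sum.union_disjoint) auto
  also have "sum ?h {1..<l} = (\<Sum>i=1..<l. ratio ^ (i - 1) * (s - r))" by (rule sum.cong) auto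
  also have "sum ?h {l<..N} = 0" by (rule sum.neutral) auto
  also have "(\<Sum>i=1..<l. ratio ^ (i - 1) * (s - r)) = s * ((\<Sum>i=1..<l. ratio ^ (i - 1)) * (1 - ratio))"
    unfolding sp by (simp add: sum_distrib_left sum_distrib_right ac_simps)
  finally show ?thesis unfolding g by (simp add: algebra_simps)
qed

lemma T0_last: "T0 (length v) f (v @ [x, y]) = (if x = y then s * f (v @ [x, y]) else if x < y then f (v @ [y, x])
      else r * s * f (v @ [y, x]) + (s - r) * f (v @ [x, y]))"
  by (induction v arbitrary: f) auto

lemma qtrace_markov:
  assumes "x \<in> Hfree k" "k \<ge> 1" shows "qtrace N (Suc k) (x * mon [k]) = s * qtrace N k x"
proof -
  have *: "opT (x * mon [k]) (delta (w @ [i])) (w @ [i]) =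
      (if last w = i then s else if last w < i then 0 else s - r) * opT x (delta w) w" (is "_ = ?c * _")
    if w: "w \<in> words N k" for w i
  proof -
    have lw: "length w = k" using w by (simp add: words_def)
    obtain w' l where w': "w = w' @ [l]" using lw assms(2) by (cases w rule: rev_cases) auto
    have "opT (x * mon [k]) (delta (w @ [i])) (w @ [i]) = opT x (\<lambda>v. T k (delta (w @ [i])) (v @ [i])) w"
      unfolding xT_mult alg_op_T_append[OF assms(1) lw] by (simp add: alg_op_def)
    \<comment> \<open>\<open>x\<close> does not touch the last letter, so only the part of
      \<open>T k\<close> that keeps the last letter \<open>i\<close> survives, which is its
      diagonal.\<close>
    also have "\<dots> = opT x (\<lambda>v. ?c * delta w v) w"
    proof (rule alg_op_T_cong)
      fix v assume "mset v = mset w"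
      then have lv: "length v = k" using lw by (metis mset_eq_length)
      then obtain v' j where v': "v = v' @ [j]" using assms(2) by (cases v rule: rev_cases) auto
      then have k: "k = Suc (length v')" using lv by simp
      show "T k (delta (w @ [i])) (v @ [i]) = ?c * delta w v"
        unfolding k T_def v' w' using T0_last[of v' "delta ((w' @ [l]) @ [i])" j i] by auto
    qed
    finally show ?thesis by (simp add: lin_cmul[OF lin_xT])
  qed
  have "qtrace N (Suc k) (x * mon [k]) = (\<Sum>w\<in>words N k. qweight w * opT x (delta w) w *
      (\<Sum>i=1..N. ratio ^ (i - 1) * (if last w = i then s else if last w < i then 0 else s - r)))"
    unfolding qtrace_def sum_words_Suc sum_distrib_left
    by (intro sum.cong refl) (simp only: * qweight_snoc mult.assoc mult.commute mult.left_commute)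
  also have "\<dots> = (\<Sum>w\<in>words N k. qweight w * opT x (delta w) w * s)"
  proof (rule sum.cong)
    fix w assume "w \<in> words N k"
    then have "w \<noteq> []" "set w \<subseteq> {1..N}" using assms(2) by (auto simp: words_def)
    then have "1 \<le> last w" "last w \<le> N" using last_in_set[of w] by (auto simp del: last_in_set)
    then show "qweight w * opT x (delta w) w * (\<Sum>i=1..N. ratio ^ (i - 1) * (if last w = i then s else if last w < i then 0 else s - r))
      = qweight w * opT x (delta w) w * s" by (simp only: markov_sum)
  qed simp
  finally show ?thesis by (simp add: qtrace_def sum_distrib_left mult.commute)
qed

text \<open>Induction over normal forms. With an empty tail the last strand is untouched and the
  trace gains a factor \<open>qint N\<close>, which raises the degree and keeps the leading
  coefficient. A nonempty tail contains \<open>T k\<close> once; the Markov property removes a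
  strand without such a factor, so the top coefficient is 0, and so is \<open>tau\<close>.\<close>

lemma qtrace_poly:
  "x \<in> Hfree k \<Longrightarrow> \<exists>P. degree P \<le> k \<and> (\<forall>N. qtrace N k x = poly P (qint N)) \<and> coeff P k = tau k x"
proof (induction k arbitrary: x)
  case 0
  show ?case by (intro exI[of _ "[:tau 0 x:]"]) (simp add: qtrace_def words_0 qweight_def tau_def om_def)
next
  case (Suc k)
  have NFcase: "\<exists>P. degree P \<le> Suc k \<and> (\<forall>N. qtrace N (Suc k) (mon v) = poly P (qint N)) \<and> coeff P (Suc k) = tau (Suc k) (mon v)"
    if vNF: "v \<in> NF (Suc k)" for v
  proof -
    obtain w j where v: "v = w @ rev [j..<Suc k]" and w: "w \<in> NF k" and j: "1 \<le> j" "j \<le> Suc k"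
      using vNF unfolding NF.simps by blast
    have wF: "mon w \<in> Hfree k" using NF_letters[OF w] by (intro mon_Free) auto
    show ?thesis
    proof (cases "j = Suc k")
      case True
      obtain P where P: "degree P \<le> k" "\<And>N. qtrace N k (mon w) = poly P (qint N)" "coeff P k = tau k (mon w)"
        using Suc.IH[OF wF] by blast
      have "tau (Suc k) (mon w) = tau k (mon w)"
        unfolding tau_def om_Suc by (subst alg_op_T_append[OF wF]) (auto simp: om_sorted)
      \<comment> \<open>\<open>pCons 0 P\<close> is \<open>P\<close> times the variable, which
        stands for \<open>qint N\<close>.\<close>
      then show ?thesis using True v P
        by (intro exI[of _ "pCons 0 P"]) (auto simp: qtrace_stab[OF wF] intro: order_trans[OF degree_pCons_le])
    next
      case False
      let ?y = "rev [j..<k]"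
      have v': "v = w @ k # ?y" using v False j by simp
      have yF: "mon ?y \<in> Hfree k" using j by (intro mon_Free) auto
      have k: "k \<ge> 1" using j False by simp
      have ywF: "mon ?y * mon w \<in> Hfree k" using yF wF by blast
      obtain P where P: "degree P \<le> k" "\<And>N. qtrace N k (mon ?y * mon w) = poly P (qint N)"
        using Suc.IH[OF ywF] by blast
      have Xv: "qtrace N (Suc k) (mon v) = s * qtrace N k (mon ?y * mon w)" for N
      proof -
        have "mon v = (mon w * mon [k]) * mon ?y" by (simp add: mon_mult v')
        then have "qtrace N (Suc k) (mon v) = qtrace N (Suc k) (mon ?y * mon w * mon [k])"
          by (metis qtrace_comm mult.assoc)
        then show ?thesis by (simp only: qtrace_markov[OF ywF k])
      qed
      \<comment> \<open>The tail carries the letter \<open>j\<close> to the last place and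
        \<open>w\<close> leaves it there, whereas the last letter of \<open>om (Suc k)\<close> is
        \<open>Suc k\<close>, different from \<open>j\<close>.\<close>
      have "tau (Suc k) (mon v) = 0"
      proof -
        let ?a = "[1..<j]" and ?b = "[Suc j..<Suc (Suc k)]"
        have "om (Suc k) = ?a @ [j..<Suc (Suc k)]"
          unfolding om_def using upt_add_eq_append[of 1 j "Suc (Suc k) - j"] j by (simp del: upt_Suc)
        then have o: "om (Suc k) = ?a @ j # ?b" using upt_conv_Cons[of j "Suc (Suc k)"] j by (simp del: upt_Suc)
        have s: "sorted_wrt (<) (?a @ ?b)" by (auto simp: sorted_wrt_append simp del: upt_Suc)
        have l: "length (?a @ ?b) = k" using j by (simp del: upt_Suc)
        obtain v2 where v2: "sends_delta w (?a @ ?b) v2" using sends_delta_ex[OF s] w l by auto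
        have "sends_delta (w @ rev [Suc (length ?a)..<Suc (length (?a @ ?b))]) (?a @ j # ?b) (v2 @ [j])"
          using NF_letters[OF w] l by (intro sends_delta_step[OF v2]) (auto simp del: upt_Suc)
        then have "sends_delta v (om (Suc k)) (v2 @ [j])" unfolding o l v using j by (simp del: upt_Suc)
        then have "tau (Suc k) (mon v) = (r * s) ^ length v * delta (v2 @ [j]) (om (Suc k))"
          unfolding tau_def sends_delta_def alg_op_def by simp
        then show ?thesis using False by (simp add: om_Suc)
      qed
      then show ?thesis using P by (intro exI[of _ "Polynomial.smult s P"])
         (auto simp: Xv coeff_eq_0 intro: order_trans[OF degree_smult_le])
    qed
  qed
  obtain c where c: "x - (\<Sum>w\<in>NF (Suc k). Poly_Mapping.single w (c w)) \<in> JH (Suc k)" using Free_expand[OF Suc.prems] .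
  have "\<forall>v\<in>NF (Suc k). \<exists>P. degree P \<le> Suc k \<and> (\<forall>N. qtrace N (Suc k) (mon v) = poly P (qint N)) \<and> coeff P (Suc k) = tau (Suc k) (mon v)"
    using NFcase by blast
  then obtain P where P: "\<And>v. v \<in> NF (Suc k) \<Longrightarrow> degree (P v) \<le> Suc k"
      "\<And>v N. v \<in> NF (Suc k) \<Longrightarrow> qtrace N (Suc k) (mon v) = poly (P v) (qint N)"
      "\<And>v. v \<in> NF (Suc k) \<Longrightarrow> coeff (P v) (Suc k) = tau (Suc k) (mon v)" by metis
  let ?P = "\<Sum>v\<in>NF (Suc k). Polynomial.smult (c v) (P v)"
  have "degree ?P \<le> Suc k" using P(1) by (intro degree_sum_le finite_NF) (auto intro: order_trans[OF degree_smult_le])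
  moreover have "qtrace N (Suc k) x = poly ?P (qint N)" for N
    using qtrace_JH[OF c, of N] unfolding qtrace_linear(1) qtrace_linear(2)[where g = "\<lambda>x. x"]
    by (simp add: poly_sum P(2) del: NF.simps)
  moreover have "coeff ?P (Suc k) = tau (Suc k) x"
    using tau_JH[OF c] unfolding tau_linear(1) tau_linear(2)[where g = "\<lambda>x. x"]
    by (simp add: coeff_sum P(3) del: NF.simps)
  ultimately show ?case by blast
qed

lemma ratio_inj: "ratio ^ i = ratio ^ j \<Longrightarrow> i = j"
proof (rule ccontr)
  have aux: False if "ratio ^ i = ratio ^ j" "i < j" for i j
  proof -
    have "ratio ^ j = ratio ^ (i + (j - i))" using that(2) by simp
    then have "ratio ^ j = ratio ^ i * ratio ^ (j - i)" unfolding power_add .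
    then have "ratio ^ (j - i) = 1" using that r0 s0 by (simp add: ratio_def)
    then show False using rs_generic[of "j - i"] that by (simp add: ratio_def)
  qed
  assume "ratio ^ i = ratio ^ j" "i \<noteq> j"
  then show False using aux[of i j] aux[of j i] by (cases "i < j") auto
qed

lemma inj_qint: "inj qint"
proof (rule injI)
  have t: "(1 - ratio) * qint N = 1 - ratio ^ N" for N
  proof (induction N)
    case (Suc N)
    have "qint (Suc N) = qint N + ratio ^ N" by (simp add: qint_def)
    then show ?case using Suc by (simp only: distrib_left) (simp add: algebra_simps)
  qed (simp add: qint_def)
  fix i j assume "qint i = qint j"
  then have "1 - ratio ^ i = 1 - ratio ^ j" using t by metis
  then show "i = j" using ratio_inj by simp
qed

text \<open>
  The quantum integers are pairwise distinct since \<open>r / s\<close> is not a root of unity; so \<open>tau\<close> inherits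
  from the quantum traces that it is symmetric and vanishes on nilpotent elements.
\<close>

lemma tau_eqI:
  assumes "x \<in> Hfree k" "\<And>N. qtrace N k x = 0" shows "tau k x = 0"
proof -
  obtain P where P: "\<And>N. qtrace N k x = poly P (qint N)" "coeff P k = tau k x" using qtrace_poly[OF assms(1)] by blast
  have "range qint \<subseteq> {a. poly P a = 0}" using P(1) assms(2) by auto
  moreover have "infinite (range qint)" using inj_qint range_inj_infinite by blast
  ultimately have "P = 0" using poly_roots_finite finite_subset by blast
  then show ?thesis using P by simp
qed

lemma tau_comm:
  assumes "x \<in> Hfree k" "y \<in> Hfree k" shows "tau k (x * y) = tau k (y * x)"
proof -
  have "tau k (x * y - y * x) = 0"
    using assms by (intro tau_eqI) (auto simp: qtrace_linear qtrace_comm[of _ k x y])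
  then show ?thesis by (simp add: tau_linear)
qed

lemma tau_nil:
  assumes "x \<in> Hfree k" "\<And>f u. length u = k \<Longrightarrow> opT x (opT x f) u = 0"
  shows "tau k x = 0"
  using assms by (intro tau_eqI qtrace_nil)

text \<open>A coordinate of \<open>opT y (delta (om k))\<close> at a rearrangement of
  \<open>om k\<close> is itself a value \<open>tau k (mon w * y)\<close>, with \<open>w\<close> from
  \<open>row_ex\<close>; the other coordinates vanish by weight.\<close>

lemma tau_nondegenerate:
  assumes "\<And>x. x \<in> Hfree k \<Longrightarrow> tau k (x * y) = 0" and "length z = k"
  shows "opT y (delta (om k)) z = 0"
proof (cases "mset z = mset (om k)")
  case True
  obtain w where w: "set w \<subseteq> {1..<k}" "\<And>f. wordT w f (om k) = f z"
    using row_ex[OF om_sorted(1)[of k] True] om_sorted(2) by auto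
  have "tau k (mon w * y) = 0" using w(1) by (intro assms mon_Free)
  then show ?thesis unfolding tau_def xT_mult by (simp add: alg_op_def[of _ "mon w"] w(2))
next
  case False
  then show ?thesis by (intro alg_op_T_zero) auto
qed

end

section \<open>The action of the quantum group\<close>

context two_params begin

definition letter_wt :: "nat \<Rightarrow> nat \<Rightarrow> nat \<Rightarrow> 'k" where
  "letter_wt a b x = (if x = a then r else if x = b then s else 1)"

text \<open>
  In coordinates \<open>repl a b\<close> sends a basis word to the sum of the words with one letter \<open>b\<close> turned into
  \<open>a\<close>, weighted by the letters in front of it; \<open>repl'\<close> weights by the letters behind it. Then \<open>e\<^sub>j\<close> is
  \<open>repl j (j + 1)\<close> and \<open>f\<^sub>j\<close> is \<open>repl' (j + 1) j\<close>, with the same letter weights for \<open>\<omega>\<^sub>j\<close> and \<open>\<omega>'\<^sub>j\<close>.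
\<close>

primrec repl_at :: "nat \<Rightarrow> nat \<Rightarrow> nat list \<Rightarrow> (nat list \<Rightarrow> 'k) \<Rightarrow> 'k" where
  "repl_at a b [] f = 0"
| "repl_at a b (x # u) f = (if x = a then f (b # u) else 0) + letter_wt a b x * repl_at a b u (\<lambda>v. f (x # v))"

definition repl :: "nat \<Rightarrow> nat \<Rightarrow> (nat list \<Rightarrow> 'k) \<Rightarrow> nat list \<Rightarrow> 'k" where
  "repl a b f u = repl_at a b u f"

lemma repl_simps [simp]: "repl a b f [] = 0"
  "repl a b f (x # u) = (if x = a then f (b # u) else 0) + letter_wt a b x * repl a b (\<lambda>v. f (x # v)) u"
  by (simp_all add: repl_def)

definition repl' :: "nat \<Rightarrow> nat \<Rightarrow> (nat list \<Rightarrow> 'k) \<Rightarrow> nat list \<Rightarrow> 'k" where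
  "repl' a b f u = repl a b (\<lambda>v. f (rev v)) (rev u)"

definition word_wt :: "nat \<Rightarrow> nat \<Rightarrow> nat list \<Rightarrow> 'k" where
  "word_wt a b u = prod_list (map (letter_wt a b) u)"

lemma word_wt_simps [simp]: "word_wt a b [] = 1" "word_wt a b (x # u) = letter_wt a b x * word_wt a b u" "word_wt a b (u @ v) = word_wt a b u * word_wt a b v"
  by (simp_all add: word_wt_def)

lemma word_wt_mset: "mset u = mset v \<Longrightarrow> word_wt a b u = word_wt a b v"
  unfolding word_wt_def by (metis mset_map prod_mset_prod_list)

lemma lin_repl: "lin (repl a b)"
proof -
  have "repl a b (\<lambda>v. c * f v + d * g v) u = c * repl a b f u + d * repl a b g u" for c d f g u
    by (induction u arbitrary: f g) (auto simp: algebra_simps)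
  then show ?thesis by (simp add: lin_def)
qed

lemma lin_repl': "lin (repl' a b)"
  unfolding lin_def repl'_def by (simp add: lin_comb[OF lin_repl])

lemmas repl_lin = lin_comb[OF lin_repl] lin_add[OF lin_repl] lin_cmul[OF lin_repl] lin_zero[OF lin_repl]
lemmas repl'_lin = lin_comb[OF lin_repl'] lin_add[OF lin_repl'] lin_cmul[OF lin_repl'] lin_zero[OF lin_repl']

text \<open>\<open>repl\<close> is defined by splitting off the first tensor factor, the tensor
  powers by splitting off the last; the agreement is coassociativity in coordinates.\<close>

lemma repl_snoc: "repl a b f (u @ [x]) = repl a b (\<lambda>v. f (v @ [x])) u + (if x = a then word_wt a b u * f (u @ [b]) else 0)"
  by (induction u arbitrary: f) (auto simp: algebra_simps)

lemma repl'_Nil [simp]: "repl' a b f [] = 0"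
  by (simp add: repl'_def)

lemma repl'_Cons [simp]: "repl' a b f (x # u) = repl' a b (\<lambda>v. f (x # v)) u + (if x = a then word_wt a b u * f (b # u) else 0)"
  unfolding repl'_def by (simp add: repl_snoc word_wt_mset[of "rev u" u])

lemma repl'_snoc: "repl' a b f (u @ [x]) = (if x = a then f (u @ [b]) else 0) + letter_wt a b x * repl' a b (\<lambda>v. f (v @ [x])) u"
  unfolding repl'_def by simp

text \<open>The condition says that \<open>v\<close> arises from \<open>u\<close> by changing one
  letter \<open>a\<close> into \<open>b\<close>, in a form without truncated subtraction of
  multisets.\<close>

lemma repl_cong:
  "(\<And>v. add_mset a (mset v) = add_mset b (mset u) \<Longrightarrow> f v = g v) \<Longrightarrow> repl a b f u = repl a b g u"
proof (induction u arbitrary: f g)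
  case (Cons x u)
  have "repl a b (\<lambda>v. f (x # v)) u = repl a b (\<lambda>v. g (x # v)) u"
    by (rule Cons.IH, rule Cons.prems) simp
  moreover have "x = a \<Longrightarrow> f (b # u) = g (b # u)"
    by (rule Cons.prems) simp
  ultimately show ?case by simp
qed simp

lemma repl'_cong:
  "(\<And>v. add_mset a (mset v) = add_mset b (mset u) \<Longrightarrow> f v = g v) \<Longrightarrow> repl' a b f u = repl' a b g u"
  unfolding repl'_def by (rule repl_cong) simp

lemma repl_scale:
  assumes "\<And>v. add_mset a (mset v) = add_mset b (mset u) \<Longrightarrow> W v = c"
  shows "repl a b (\<lambda>v. W v * f v) u = c * repl a b f u" and "repl' a b (\<lambda>v. W v * f v) u = c * repl' a b f u"
  using repl_cong[of a b u "\<lambda>v. W v * f v" "\<lambda>v. c * f v"] repl'_cong[of a b u "\<lambda>v. W v * f v" "\<lambda>v. c * f v"] assms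
  by (simp_all add: repl_lin repl'_lin)

text \<open>The Serre element is skew-primitive: when the first letter is split off, the terms
  acting on it cancel, and the expression for the remaining letters is multiplied by the weight of
  that letter under the matching product of \<omega>'s. The scalars in the cases are these
  weights.\<close>

lemma serre1:
  assumes "a \<noteq> b" "b \<noteq> c" "a \<noteq> c"
  shows "repl a b (repl a b (repl b c f)) u - (r + s) * repl a b (repl b c (repl a b f)) u + r * s * repl b c (repl a b (repl a b f)) u = 0"
proof (induction u arbitrary: f)
  case (Cons x u)
  define h where "h v = f (x # v)" for v
  define R where "R = repl a b (repl a b (repl b c h)) u - (r + s) * repl a b (repl b c (repl a b h)) u + r * s * repl b c (repl a b (repl a b h)) u"
  have R: "R = 0" unfolding R_def by (rule Cons.IH)
  consider "x = a" | "x = b" | "x = c" | "x \<noteq> a" "x \<noteq> b" "x \<noteq> c" by blast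
  then show ?case
  proof cases
    case 1
    have "repl a b (repl a b (repl b c f)) (x # u) - (r + s) * repl a b (repl b c (repl a b f)) (x # u) + r * s * repl b c (repl a b (repl a b f)) (x # u) = r * r * R"
      using assms 1 unfolding R_def by (simp add: letter_wt_def repl_lin h_def[abs_def]) (simp add: algebra_simps)
    then show ?thesis using R by simp
  next
    case 2
    have "repl a b (repl a b (repl b c f)) (x # u) - (r + s) * repl a b (repl b c (repl a b f)) (x # u) + r * s * repl b c (repl a b (repl a b f)) (x # u) = s * s * r * R"
      using assms 2 unfolding R_def by (simp add: letter_wt_def repl_lin h_def[abs_def]) (simp add: algebra_simps)
    then show ?thesis using R by simp
  next
    case 3
    have "repl a b (repl a b (repl b c f)) (x # u) - (r + s) * repl a b (repl b c (repl a b f)) (x # u) + r * s * repl b c (repl a b (repl a b f)) (x # u) = s * R"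
      using assms 3 unfolding R_def by (simp add: letter_wt_def repl_lin h_def[abs_def]) (simp add: algebra_simps)
    then show ?thesis using R by simp
  next
    case 4
    then show ?thesis using assms R unfolding R_def by (simp add: letter_wt_def repl_lin h_def[abs_def])
  qed
qed simp

lemma serre2:
  assumes "a \<noteq> b" "b \<noteq> c" "a \<noteq> c"
  shows "repl a b (repl b c (repl b c f)) u - (r + s) * repl b c (repl a b (repl b c f)) u + r * s * repl b c (repl b c (repl a b f)) u = 0"
proof (induction u arbitrary: f)
  case (Cons x u)
  define h where "h v = f (x # v)" for v
  define R where "R = repl a b (repl b c (repl b c h)) u - (r + s) * repl b c (repl a b (repl b c h)) u + r * s * repl b c (repl b c (repl a b h)) u"
  have R: "R = 0" unfolding R_def by (rule Cons.IH)
  consider "x = a" | "x = b" | "x = c" | "x \<noteq> a" "x \<noteq> b" "x \<noteq> c" by blast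
  then show ?case
  proof cases
    case 1
    have "repl a b (repl b c (repl b c f)) (x # u) - (r + s) * repl b c (repl a b (repl b c f)) (x # u) + r * s * repl b c (repl b c (repl a b f)) (x # u) = r * R"
      using assms 1 unfolding R_def by (simp add: letter_wt_def repl_lin h_def[abs_def]) (simp add: algebra_simps)
    then show ?thesis using R by simp
  next
    case 2
    have "repl a b (repl b c (repl b c f)) (x # u) - (r + s) * repl b c (repl a b (repl b c f)) (x # u) + r * s * repl b c (repl b c (repl a b f)) (x # u) = s * r * r * R"
      using assms 2 unfolding R_def by (simp add: letter_wt_def repl_lin h_def[abs_def]) (simp add: algebra_simps)
    then show ?thesis using R by simp
  next
    case 3
    have "repl a b (repl b c (repl b c f)) (x # u) - (r + s) * repl b c (repl a b (repl b c f)) (x # u) + r * s * repl b c (repl b c (repl a b f)) (x # u) = s * s * R"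
      using assms 3 unfolding R_def by (simp add: letter_wt_def repl_lin h_def[abs_def]) (simp add: algebra_simps)
    then show ?thesis using R by simp
  next
    case 4
    then show ?thesis using assms R unfolding R_def by (simp add: letter_wt_def repl_lin h_def[abs_def])
  qed
qed simp

lemma serre1':
  assumes "a \<noteq> b" "b \<noteq> c" "a \<noteq> c"
  shows "repl' a b (repl' a b (repl' b c f)) u - (r + s) * repl' a b (repl' b c (repl' a b f)) u + r * s * repl' b c (repl' a b (repl' a b f)) u = 0"
  using serre1[OF assms, of "\<lambda>v. f (rev v)" "rev u"] by (simp add: repl'_def[abs_def])

lemma serre2':
  assumes "a \<noteq> b" "b \<noteq> c" "a \<noteq> c"
  shows "repl' a b (repl' b c (repl' b c f)) u - (r + s) * repl' b c (repl' a b (repl' b c f)) u + r * s * repl' b c (repl' b c (repl' a b f)) u = 0"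
  using serre2[OF assms, of "\<lambda>v. f (rev v)" "rev u"] by (simp add: repl'_def[abs_def])

lemma repl_far:
  assumes "a \<noteq> c" "a \<noteq> d" "b \<noteq> c" "b \<noteq> d"
  shows "repl a b (repl c d f) u = repl c d (repl a b f) u"
proof (induction u arbitrary: f)
  case (Cons x u)
  show ?case using assms Cons.IH[of "\<lambda>v. f (x # v)"]
    by (cases "x = a"; cases "x = b"; cases "x = c"; cases "x = d") (simp_all add: letter_wt_def repl_lin)
qed simp

lemma repl'_far:
  assumes "a \<noteq> c" "a \<noteq> d" "b \<noteq> c" "b \<noteq> d"
  shows "repl' a b (repl' c d f) u = repl' c d (repl' a b f) u"
  using repl_far[OF assms, of "\<lambda>v. f (rev v)" "rev u"] by (simp add: repl'_def[abs_def])

section \<open>The commutator of raising and lowering operators\<close>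

definition E :: "nat \<Rightarrow> (nat list \<Rightarrow> 'k) \<Rightarrow> nat list \<Rightarrow> 'k" where "E j = repl j (Suc j)"
definition F :: "nat \<Rightarrow> (nat list \<Rightarrow> 'k) \<Rightarrow> nat list \<Rightarrow> 'k" where "F j = repl' (Suc j) j"

lemma lin_E: "lin (E j)" and lin_F: "lin (F j)"
  by (simp_all add: E_def F_def lin_repl lin_repl')

text \<open>The eigenvalue of \<open>(omega j - omega' j) / (r - s)\<close> on the basis vector
  \<open>u\<close>.\<close>

definition EF_coeff :: "nat \<Rightarrow> nat list \<Rightarrow> 'k" where
  "EF_coeff j u = (r ^ count (mset u) j * s ^ count (mset u) (Suc j)
     - r ^ count (mset u) (Suc j) * s ^ count (mset u) j) / (r - s)"

lemma word_wt_pow: "a \<noteq> b \<Longrightarrow> word_wt a b u = r ^ count (mset u) a * s ^ count (mset u) b"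
  by (induction u) (auto simp: letter_wt_def)

lemma word_wt_move:
  assumes "add_mset a (mset v) = add_mset b (mset u)"
  shows "letter_wt c d a * word_wt c d v = letter_wt c d b * word_wt c d u"
  using word_wt_mset[of "a # v" "b # u" c d] assms by simp

lemma EF_coeff_Cons: "x = j \<Longrightarrow> EF_coeff j (x # u) = r * EF_coeff j u + word_wt (Suc j) j u"
  "x = Suc j \<Longrightarrow> EF_coeff j (x # u) = s * EF_coeff j u - word_wt (Suc j) j u"
  "x \<noteq> j \<Longrightarrow> x \<noteq> Suc j \<Longrightarrow> EF_coeff j (x # u) = EF_coeff j u"
  using rs by (simp_all add: EF_coeff_def word_wt_pow field_simps)

lemma EF_comm_eq: "E j (F j f) u - F j (E j f) u = EF_coeff j u * f u"
proof (induction u arbitrary: f)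
  case Nil
  show ?case by (simp add: E_def F_def EF_coeff_def)
next
  case (Cons x u)
  note IH = Cons.IH[of "\<lambda>v. f (x # v)", unfolded E_def F_def]
  \<comment> \<open>In the words read here one letter \<open>j\<close>, of weight \<open>s\<close>,
    has become \<open>Suc j\<close>, of weight \<open>r\<close>; hence the factor
    \<open>r / s\<close>.\<close>
  have CG: "repl j (Suc j) (\<lambda>v. word_wt (Suc j) j v * g v) u = (r * inverse s * word_wt (Suc j) j u) * repl j (Suc j) g u" for g
  proof (rule repl_scale(1))
    fix v assume "add_mset j (mset v) = add_mset (Suc j) (mset u)"
    from word_wt_move[OF this, of "Suc j" j] show "word_wt (Suc j) j v = r * inverse s * word_wt (Suc j) j u"
      using s0 by (simp add: letter_wt_def field_simps)
  qed
  consider "x = j" | "x = Suc j" | "x \<noteq> j" "x \<noteq> Suc j" by blast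
  then show ?case
  proof cases
    case 1
    then have "E j (F j f) (x # u) - F j (E j f) (x # u) =
       word_wt (Suc j) j u * f (x # u) + r * (repl j (Suc j) (repl' (Suc j) j (\<lambda>v. f (x # v))) u - repl' (Suc j) j (repl j (Suc j) (\<lambda>v. f (x # v))) u)"
      by (simp add: E_def F_def letter_wt_def repl_lin repl'_lin) (simp add: algebra_simps)
    then show ?thesis unfolding IH EF_coeff_Cons(1)[OF 1] by (simp add: algebra_simps)
  next
    case 2
    then have "E j (F j f) (x # u) - F j (E j f) (x # u) =
       - word_wt (Suc j) j u * f (x # u) + s * (repl j (Suc j) (repl' (Suc j) j (\<lambda>v. f (x # v))) u - repl' (Suc j) j (repl j (Suc j) (\<lambda>v. f (x # v))) u)"
      using s0 by (simp add: E_def F_def letter_wt_def repl_lin repl'_lin CG) (simp add: algebra_simps)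
    then show ?thesis unfolding IH EF_coeff_Cons(2)[OF 2] by (simp add: algebra_simps)
  next
    case 3
    then show ?thesis using IH by (simp add: E_def F_def letter_wt_def repl_lin repl'_lin EF_coeff_Cons(3)[OF 3])
  qed
qed

lemma EF_comm_ne:
  assumes "i \<noteq> j" shows "E i (F j f) u = F j (E i f) u"
proof (induction u arbitrary: f)
  case Nil
  show ?case by (simp add: E_def F_def)
next
  case (Cons x u)
  note IH = Cons.IH[of "\<lambda>v. f (x # v)", unfolded E_def F_def]
  have CG: "repl i (Suc i) (\<lambda>v. word_wt (Suc j) j v * g v) u = (letter_wt (Suc j) j (Suc i) / letter_wt (Suc j) j i * word_wt (Suc j) j u) * repl i (Suc i) g u" for g
  proof (rule repl_scale(1))
    fix v assume "add_mset i (mset v) = add_mset (Suc i) (mset u)"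
    from word_wt_move[OF this, of "Suc j" j] show "word_wt (Suc j) j v = letter_wt (Suc j) j (Suc i) / letter_wt (Suc j) j i * word_wt (Suc j) j u"
      using s0 r0 by (simp add: letter_wt_def field_simps split: if_splits)
  qed
  \<comment> \<open>Moving \<open>E i\<close> past the weights of \<open>F j\<close> produces
    exactly the factor by which \<open>E i\<close> weighs the first letter differently before and
    after it changes between \<open>Suc j\<close> and \<open>j\<close>.\<close>
  have letter_wt: "letter_wt i (Suc i) (Suc j) * (letter_wt (Suc j) j (Suc i) / letter_wt (Suc j) j i) = letter_wt i (Suc i) j"
    using assms s0 r0 by (auto simp: letter_wt_def)
  show ?case
  proof (cases "x = Suc j")
    case True
    then have "E i (F j f) (x # u) = (if x = i then repl' (Suc j) j (\<lambda>v. f (Suc i # v)) u else 0)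
       + letter_wt i (Suc i) x * repl i (Suc i) (repl' (Suc j) j (\<lambda>v. f (x # v))) u
       + (letter_wt i (Suc i) (Suc j) * (letter_wt (Suc j) j (Suc i) / letter_wt (Suc j) j i)) * (word_wt (Suc j) j u * repl i (Suc i) (\<lambda>v. f (j # v)) u)"
      using assms by (simp add: E_def F_def repl_lin CG) (simp add: algebra_simps)
    also have "\<dots> = F j (E i f) (x # u)" unfolding letter_wt IH
      using True assms by (simp add: E_def F_def repl'_lin algebra_simps)
    finally show ?thesis .
  next
    case False
    then show ?thesis using assms IH by (cases "x = i") (simp_all add: E_def F_def repl_lin repl'_lin)
  qed
qed

section \<open>Commutation with the Hecke operators\<close>

lemma T0_scale: "(\<And>v. mset v = mset u \<Longrightarrow> W v = c) \<Longrightarrow> T0 l (\<lambda>v. W v * f v) u = c * T0 l f u"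
  using T0_cong[of u "\<lambda>v. W v * f v" "\<lambda>v. c * f v" l] by (simp add: lin_cmul[OF lin_T0])

lemmas T0_lin = lin_comb[OF lin_T0] lin_add[OF lin_T0] lin_cmul[OF lin_T0] lin_zero[OF lin_T0]

text \<open>Letters behind the two affected ones enter only through \<open>repl\<close> of the tail,
  by linearity. What remains is compatibility of the R-matrix with the coproduct on two factors,
  decided by comparing both letters with each other and with \<open>j\<close>,
  \<open>Suc j\<close>.\<close>

lemma T0_E: "T0 l (E j f) u = E j (T0 l f) u"
proof (induction l arbitrary: f u)
  case 0
  show ?case
  proof (cases u rule: remdups_adj.cases)
    case (3 x y v)
    show ?thesis unfolding 3 E_def
      by (cases x y rule: linorder_cases; cases "x = j"; cases "y = j"; cases "x = Suc j"; cases "y = Suc j";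
        simp add: letter_wt_def repl_lin; (simp add: algebra_simps; fail)?)
  qed (simp_all add: E_def)
next
  case (Suc l)
  then show ?case by (cases u; cases "hd u = j") (simp_all add: E_def T0_lin)
qed

lemma T0_F: "T0 l (F j f) u = F j (T0 l f) u"
proof (induction l arbitrary: f u)
  case 0
  show ?case
  proof (cases u rule: remdups_adj.cases)
    case (3 x y v)
    show ?thesis unfolding 3 F_def
      by (cases x y rule: linorder_cases; cases "x = j"; cases "y = j"; cases "x = Suc j"; cases "y = Suc j";
        simp add: letter_wt_def repl'_lin; (simp add: algebra_simps; fail)?)
  qed (simp_all add: F_def)
next
  case (Suc l)
  show ?case
  proof (cases u)
    case (Cons x u')
    \<comment> \<open>\<open>F j\<close> acting on the first letter carries the weight of all
      letters behind it; \<open>T0 l\<close> permutes these without changing their weight.\<close>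
    have "T0 l (\<lambda>v. word_wt (Suc j) j v * f (j # v)) u' = word_wt (Suc j) j u' * T0 l (\<lambda>v. f (j # v)) u'"
      by (rule T0_scale) (rule word_wt_mset)
    with Suc.IH[where u = u'] show ?thesis unfolding Cons by (cases "x = Suc j") (simp_all add: F_def T0_lin)
  qed (simp add: F_def)
qed

section \<open>The defining relations of the quantum group\<close>

definition cnt :: "nat \<Rightarrow> nat list \<Rightarrow> nat" where "cnt i u = count (mset u) i"

text \<open>Letters and indices are unbounded: \<open>n\<close> enters only through the generators
  and words considered, so one operator serves all ranks and all tensor powers.\<close>

fun Uop :: "gl_gen \<Rightarrow> (nat list \<Rightarrow> 'k) \<Rightarrow> nat list \<Rightarrow> 'k" where
  "Uop (GE j) = E j"
| "Uop (GF j) = F j"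
| "Uop (GA i) = (\<lambda>f u. r ^ cnt i u * f u)"
| "Uop (GA_inv i) = (\<lambda>f u. inverse r ^ cnt i u * f u)"
| "Uop (GB i) = (\<lambda>f u. s ^ cnt i u * f u)"
| "Uop (GB_inv i) = (\<lambda>f u. inverse s ^ cnt i u * f u)"

abbreviation "wordU \<equiv> word_op Uop"
abbreviation "opU \<equiv> alg_op Uop"

lemma lin_diag: "lin (\<lambda>f u. W u * f u)"
  by (simp add: lin_def algebra_simps)

lemma lin_Uop: "lin (Uop g)"
  by (cases g) (simp_all add: lin_E lin_F lin_diag)

lemma E_weight:
  assumes "c \<noteq> (0 :: 'k)"
  shows "c ^ cnt i u * E j f u = c powi eps_alpha i j * E j (\<lambda>v. c ^ cnt i v * f v) u"
proof -
  have "E j (\<lambda>v. c ^ cnt i v * f v) u = (c powi (- eps_alpha i j) * c ^ cnt i u) * E j f u"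
    unfolding E_def
  proof (rule repl_scale(1))
    fix v assume "add_mset j (mset v) = add_mset (Suc j) (mset u)"
    then have "count (add_mset j (mset v)) i = count (add_mset (Suc j) (mset u)) i" by simp
    then show "c ^ cnt i v = c powi (- eps_alpha i j) * c ^ cnt i u"
      using assms by (auto simp: cnt_def eps_alpha_def field_simps power_int_minus split: if_splits) (metis power_Suc)
  qed
  then show ?thesis using assms by (simp add: power_int_minus)
qed

lemma F_weight:
  assumes "c \<noteq> (0 :: 'k)"
  shows "c ^ cnt i u * F j f u = c powi (- eps_alpha i j) * F j (\<lambda>v. c ^ cnt i v * f v) u"
proof -
  have "F j (\<lambda>v. c ^ cnt i v * f v) u = (c powi (eps_alpha i j) * c ^ cnt i u) * F j f u"
    unfolding F_def
  proof (rule repl_scale(2))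
    fix v assume "add_mset (Suc j) (mset v) = add_mset j (mset u)"
    then have "count (add_mset (Suc j) (mset v)) i = count (add_mset j (mset u)) i" by simp
    then show "c ^ cnt i v = c powi (eps_alpha i j) * c ^ cnt i u"
      using assms by (auto simp: cnt_def eps_alpha_def field_simps power_int_minus split: if_splits) (metis power_Suc)
  qed
  then show ?thesis using assms by (simp add: power_int_minus)
qed

lemma gl_rels_Free: "gl_rels n r s \<subseteq> Free (gl_gens n)"
  unfolding gl_rels_def gl_rel1_def gl_rel2_def gl_rel3_def gl_rel4_def gl_rel5_def gl_rel6_def gl_rel7_def Let_def
  by (auto intro!: Free_diff Free_mult Free_add Free_gen Free_scal Free_power simp: gl_gens_def image_iff)

lemma alg_op_U [simp]: "opU (x * y) f = opU x (opU y f)"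
  by (simp add: alg_op_mult lin_Uop)

lemma alg_op_gen_eq: "opU (gen g) = Uop g"
  by (auto simp: alg_op_linear fun_eq_iff)

lemma alg_op_scal_eq [simp]: "opU (scal c) f u = c * f u"
  by (simp add: alg_op_def)

lemma alg_op_gl_rel1: "x \<in> gl_rel1 n \<Longrightarrow> opU x f u = 0"
  unfolding gl_rel1_def Let_def using r0 s0
  by (auto simp: alg_op_linear alg_op_gen_eq simp flip: power_mult_distrib)

lemma alg_op_gl_rel2: "x \<in> gl_rel2 n r \<Longrightarrow> opU x f u = 0"
  unfolding gl_rel2_def
  by (auto simp: alg_op_linear alg_op_gen_eq E_weight[OF r0] F_weight[OF r0])

lemma alg_op_gl_rel3: "x \<in> gl_rel3 n s \<Longrightarrow> opU x f u = 0"
  unfolding gl_rel3_def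
  by (auto simp: alg_op_linear alg_op_gen_eq E_weight[OF s0] F_weight[OF s0])

lemma alg_op_gl_rel4: "x \<in> gl_rel4 n r s \<Longrightarrow> opU x f u = 0"
proof -
  assume "x \<in> gl_rel4 n r s"
  then obtain i j where x: "x = ee i * ff j - ff j * ee i -
        scal (of_bool (i = j) / (r - s)) * (aa i * bb (i+1) - aa (i+1) * bb i)"
    unfolding gl_rel4_def by blast
  have "opU x f u = (E i (F j f) u - F j (E i f) u) - of_bool (i = j) * EF_coeff i u * f u"
    unfolding x by (cases "i = j") (simp_all add: alg_op_linear alg_op_gen_eq EF_coeff_def cnt_def algebra_simps diff_divide_distrib)
  also have "\<dots> = 0" using EF_comm_eq[of j f u] EF_comm_ne[of i j f u] by (cases "i = j") auto
  finally show ?thesis .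
qed

lemma alg_op_gl_rel5: "x \<in> gl_rel5 n \<Longrightarrow> opU x f u = 0"
  unfolding gl_rel5_def
  by (auto simp: alg_op_linear alg_op_gen_eq E_def F_def intro!: repl_far repl'_far)

lemma alg_op_gl_rel6: "x \<in> gl_rel6 n r s \<Longrightarrow> opU x f u = 0"
  unfolding gl_rel6_def
  using serre1[of _ "Suc _" "Suc (Suc _)" f u] serre2[of _ "Suc _" "Suc (Suc _)" f u]
  by (auto simp: alg_op_linear alg_op_gen_eq E_def power2_eq_square)

lemma alg_op_gl_rel7: "x \<in> gl_rel7 n r s \<Longrightarrow> opU x f u = 0"
proof -
  assume "x \<in> gl_rel7 n r s"
  then consider i where "x = ff i ^ 2 * ff (i+1) - scal (inverse r + inverse s) * (ff i * ff (i+1) * ff i) +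
        scal (inverse r * inverse s) * (ff (i+1) * ff i ^ 2)"
   | i where "x = ff i * ff (i+1) ^ 2 - scal (inverse r + inverse s) * (ff (i+1) * ff i * ff (i+1)) +
        scal (inverse r * inverse s) * (ff (i+1) ^ 2 * ff i)" unfolding gl_rel7_def by blast
  then show ?thesis
  proof cases
    case (1 i)
    \<comment> \<open>Multiplication by \<open>r * s\<close> turns
      \<open>inverse r + inverse s\<close> into \<open>r + s\<close>. \<open>F\<close> raises
      letters, so the chain of letters runs i + 2, i + 1, i, and the first relation for f becomes
      the second Serre identity.\<close>
    have "r * s * opU x f u = r * s * F i (F i (F (Suc i) f)) u - (r + s) * F i (F (Suc i) (F i f)) u + F (Suc i) (F i (F i f)) u"
      unfolding 1 using r0 s0 by (simp add: alg_op_linear alg_op_gen_eq power2_eq_square field_simps)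
    also have "\<dots> = 0" using serre2'[of "Suc (Suc i)" "Suc i" i f u] by (simp add: F_def algebra_simps)
    finally show ?thesis using r0 s0 by simp
  next
    case (2 i)
    have "r * s * opU x f u = r * s * F i (F (Suc i) (F (Suc i) f)) u - (r + s) * F (Suc i) (F i (F (Suc i) f)) u + F (Suc i) (F (Suc i) (F i f)) u"
      unfolding 2 using r0 s0 by (simp add: alg_op_linear alg_op_gen_eq power2_eq_square field_simps)
    also have "\<dots> = 0" using serre1'[of "Suc (Suc i)" "Suc i" i f u] by (simp add: F_def algebra_simps)
    finally show ?thesis using r0 s0 by simp
  qed
qed

lemma alg_op_gl_rels: "x \<in> gl_rels n r s \<Longrightarrow> opU x f u = 0"
  unfolding gl_rels_def
  by (elim UnE) (erule alg_op_gl_rel1 alg_op_gl_rel2 alg_op_gl_rel3 alg_op_gl_rel4 alg_op_gl_rel5 alg_op_gl_rel6 alg_op_gl_rel7)+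

end

section \<open>Weight spaces\<close>

lemma lin_leval: "lin P \<Longrightarrow> P (\<lambda>v. leval (\<lambda>w. h w v) x) = (\<lambda>u. leval (\<lambda>w. P (h w) u) x)"
  unfolding leval_def by (simp add: lin_sum[of P] lin_cmul[of P])

lemma lin_commute_alg_op:
  assumes "lin P" "\<And>w f. P (word_op Q w f) = word_op Q w (P f)"
  shows "P (alg_op Q y f) = alg_op Q y (P f)"
proof -
  have "P (alg_op Q y f) = (\<lambda>u. leval (\<lambda>w. P (word_op Q w f) u) y)"
    unfolding alg_op_def[abs_def] by (rule lin_leval[OF assms(1)])
  then show ?thesis by (simp add: assms(2) alg_op_def[abs_def])
qed

context two_params begin

lemma T_Uop: "T i (Uop g f) = Uop g (T i f)"
proof -
  have d: "T0 l (\<lambda>u. c ^ cnt a u * f u) u = c ^ cnt a u * T0 l f u" for l c a u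
    by (rule T0_scale) (simp add: cnt_def)
  show ?thesis by (cases g) (auto simp: T_def fun_eq_iff T0_E T0_F d)
qed

lemma wT_Uop: "wordT w (Uop g f) = Uop g (wordT w f)"
  by (induction w) (simp_all add: T_Uop)

lemma xT_Uop: "Uop g (opT x f) = opT x (Uop g f)"
  by (rule lin_commute_alg_op[OF lin_Uop]) (simp add: wT_Uop)

lemma lin_xU: "lin (opU y)"
  by (rule lin_alg_op) (rule lin_Uop)

lemma lin_wU: "lin (wordU w)"
  by (rule lin_word_op) (rule lin_Uop)

lemma xT_xU: "opT x (opU y f) = opU y (opT x f)"
proof (rule lin_commute_alg_op[OF lin_xT])
  show "opT x (wordU w f) = wordU w (opT x f)" for w f
    by (induction w) (simp_all add: xT_Uop[symmetric])
qed

definition supp :: "nat multiset \<Rightarrow> (nat list \<Rightarrow> 'k) \<Rightarrow> bool" where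
  "supp \<mu> f \<longleftrightarrow> (\<forall>u. mset u \<noteq> \<mu> \<longrightarrow> f u = 0)"

lemma supp_add: "supp \<mu> f \<Longrightarrow> supp \<mu> g \<Longrightarrow> supp \<mu> (\<lambda>u. f u + g u)"
  by (simp add: supp_def)

lemma supp_zero: "supp \<mu> (\<lambda>u. 0)"
  by (simp add: supp_def)

lemma supp_xT: "supp \<mu> f \<Longrightarrow> supp \<mu> (opT x f)"
  unfolding supp_def by (auto intro!: alg_op_T_zero)

lemma supp_delta: "supp (mset v) (delta v)"
  by (auto simp: supp_def)

lemma E_outside:
  assumes "supp \<mu> f" "add_mset j \<mu> \<noteq> add_mset (Suc j) (mset u)" shows "E j f u = 0"
proof -
  have "repl j (Suc j) f u = repl j (Suc j) (\<lambda>v. 0) u"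
    by (rule repl_cong) (use assms in \<open>auto simp: supp_def\<close>)
  then show ?thesis by (simp add: E_def repl_lin)
qed

lemma F_outside:
  assumes "supp \<mu> f" "add_mset (Suc j) \<mu> \<noteq> add_mset j (mset u)" shows "F j f u = 0"
proof -
  have "repl' (Suc j) j f u = repl' (Suc j) j (\<lambda>v. 0) u"
    by (rule repl'_cong) (use assms in \<open>auto simp: supp_def\<close>)
  then show ?thesis by (simp add: F_def repl'_lin)
qed

lemma E_zero:
  assumes "supp \<mu> f" "Suc j \<notin># \<mu>" shows "E j f = (\<lambda>u. 0)"
proof (rule ext, rule E_outside[OF assms(1)])
  fix u show "add_mset j \<mu> \<noteq> add_mset (Suc j) (mset u)"
  proof
    assume eq: "add_mset j \<mu> = add_mset (Suc j) (mset u)"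
    have "Suc j \<in># add_mset j \<mu>" unfolding eq by simp
    then show False using assms(2) by simp
  qed
qed

lemma F_zero:
  assumes "supp \<mu> f" "j \<notin># \<mu>" shows "F j f = (\<lambda>u. 0)"
proof (rule ext, rule F_outside[OF assms(1)])
  fix u show "add_mset (Suc j) \<mu> \<noteq> add_mset j (mset u)"
  proof
    assume eq: "add_mset (Suc j) \<mu> = add_mset j (mset u)"
    have "j \<in># add_mset (Suc j) \<mu>" unfolding eq by simp
    then show False using assms(2) by simp
  qed
qed

text \<open>The generators a and b act on a weight space by scalars and are left out; the index
  \<open>j\<close> has no upper bound.\<close>

definition EF_gens :: "gl_gen set" where "EF_gens = {g. \<exists>j\<ge>1. g = GE j \<or> g = GF j}"

text \<open>An arrow between two weight spaces; the behaviour of \<open>y\<close> on other weights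
  is left free.\<close>

definition maps :: "(gl_gen list \<Rightarrow>\<^sub>0 'k) \<Rightarrow> nat multiset \<Rightarrow> nat multiset \<Rightarrow> bool" where
  "maps y \<mu> \<nu> \<longleftrightarrow> y \<in> Free EF_gens \<and> (\<forall>f. supp \<mu> f \<longrightarrow> supp \<nu> (opU y f))"

lemma mapsD: "maps y \<mu> \<nu> \<Longrightarrow> supp \<mu> f \<Longrightarrow> supp \<nu> (opU y f)" "maps y \<mu> \<nu> \<Longrightarrow> y \<in> Free EF_gens"
  by (auto simp: maps_def)

lemma maps_mult: "maps y \<mu> \<nu> \<Longrightarrow> maps x \<nu> \<kappa> \<Longrightarrow> maps (x * y) \<mu> \<kappa>"
  by (auto simp: maps_def)

lemma xU_one: "opU 1 f = f"
  by (simp add: alg_op_def fun_eq_iff)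

lemma maps_one: "maps 1 \<mu> \<mu>"
  by (simp add: maps_def xU_one)

lemma maps_diff: "maps x \<mu> \<nu> \<Longrightarrow> maps y \<mu> \<nu> \<Longrightarrow> maps (x - y) \<mu> \<nu>"
  unfolding maps_def supp_def by (auto simp: alg_op_linear)

lemma maps_add: "maps x \<mu> \<nu> \<Longrightarrow> maps y \<mu> \<nu> \<Longrightarrow> maps (x + y) \<mu> \<nu>"
  unfolding maps_def supp_def by (auto simp: alg_op_linear)

lemma maps_scal: "maps (scal c) \<mu> \<mu>"
  unfolding maps_def supp_def by auto

lemma maps_E: "j \<ge> 1 \<Longrightarrow> add_mset j \<mu> = add_mset (Suc j) \<nu> \<Longrightarrow> maps (ee j) \<mu> \<nu>"
  unfolding maps_def supp_def[of \<nu>] by (auto simp: alg_op_gen_eq EF_gens_def intro!: Free_gen E_outside[of \<mu>])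

lemma maps_F: "j \<ge> 1 \<Longrightarrow> add_mset (Suc j) \<mu> = add_mset j \<nu> \<Longrightarrow> maps (ff j) \<mu> \<nu>"
  unfolding maps_def supp_def[of \<nu>] by (auto simp: alg_op_gen_eq EF_gens_def intro!: Free_gen F_outside[of \<mu>])

definition EF_coeff_mset :: "nat \<Rightarrow> nat multiset \<Rightarrow> 'k" where
  "EF_coeff_mset j \<mu> = (r ^ count \<mu> j * s ^ count \<mu> (Suc j) - r ^ count \<mu> (Suc j) * s ^ count \<mu> j) / (r - s)"

lemma EF_supp: "supp \<mu> f \<Longrightarrow> E j (F j f) = (\<lambda>u. F j (E j f) u + EF_coeff_mset j \<mu> * f u)"
proof
  fix u assume "supp \<mu> f"
  then have "EF_coeff j u * f u = EF_coeff_mset j \<mu> * f u"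
    by (cases "mset u = \<mu>") (auto simp: EF_coeff_def EF_coeff_mset_def supp_def)
  then show "E j (F j f) u = F j (E j f) u + EF_coeff_mset j \<mu> * f u"
    using EF_comm_eq[of j f u] by (simp add: algebra_simps)
qed

lemma pow_ne: "a \<ge> 1 \<Longrightarrow> r ^ a \<noteq> s ^ a"
  using rs_generic[of a] s0 by (auto simp: power_mult_distrib field_simps)

text \<open>
  Letters are moved one at a time between a block and an empty neighbour, where \<open>e\<^sub>j f\<^sub>j\<close> or \<open>f\<^sub>j e\<^sub>j\<close> is a
  nonzero quantum integer. In this way every weight space is a retract of the one of the word
  \<open>1 2 \<dots> k\<close>.
\<close>

definition retract :: "nat \<Rightarrow> nat multiset \<Rightarrow> bool" where
  "retract k \<mu> \<longleftrightarrow> (\<exists>b c \<kappa>. maps b \<mu> (mset (om k)) \<and> maps c (mset (om k)) \<mu> \<and> \<kappa> \<noteq> 0 \<and>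
     (\<forall>f. supp \<mu> f \<longrightarrow> opU c (opU b f) = (\<lambda>u. \<kappa> * f u)))"

lemma retract_om: "retract k (mset (om k))"
  unfolding retract_def by (intro exI[of _ 1] conjI maps_one) (auto simp: xU_one)

lemma retract_step_F:
  assumes "j \<ge> 1" "j \<in># \<mu>" "Suc j \<notin># \<mu>" "retract k (add_mset (Suc j) (\<mu> - {#j#}))"
  shows "retract k \<mu>"
proof -
  let ?\<nu> = "add_mset (Suc j) (\<mu> - {#j#})"
  have e: "add_mset j ?\<nu> = add_mset (Suc j) \<mu>" using assms(2) by (simp add: add_mset_commute[of j])
  obtain b c \<kappa> where bc: "maps b ?\<nu> (mset (om k))" "maps c (mset (om k)) ?\<nu>" "\<kappa> \<noteq> 0"
    "\<And>f. supp ?\<nu> f \<Longrightarrow> opU c (opU b f) = (\<lambda>u. \<kappa> * f u)" using assms(4) unfolding retract_def by blast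
  have F: "maps (ff j) \<mu> ?\<nu>" using e assms(1) by (intro maps_F) auto
  have E: "maps (ee j) ?\<nu> \<mu>" using e assms(1) by (intro maps_E) auto
  have "count \<mu> j \<ge> 1" using assms(2) by (simp add: Suc_leI)
  \<comment> \<open>Without letters \<open>Suc j\<close> the coefficient is the quantum integer
    \<open>(r ^ m - s ^ m) / (r - s)\<close>, m being the multiplicity of \<open>j\<close>.\<close>
  then have h: "EF_coeff_mset j \<mu> \<noteq> 0" using assms(3) pow_ne rs by (simp add: EF_coeff_mset_def not_in_iff)
  have "opU (ee j * c) (opU (b * ff j) f) = (\<lambda>u. \<kappa> * EF_coeff_mset j \<mu> * f u)" if f: "supp \<mu> f" for f
  proof -
    have "opU (ee j * c) (opU (b * ff j) f) = E j (opU c (opU b (F j f)))"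
      by (simp add: alg_op_gen_eq)
    also have "\<dots> = E j (\<lambda>u. \<kappa> * F j f u)" using bc(4) mapsD(1)[OF F f] by (simp add: alg_op_gen_eq)
    also have "\<dots> = (\<lambda>u. \<kappa> * EF_coeff_mset j \<mu> * f u)"
      unfolding lin_cmul[OF lin_E] EF_supp[OF f] E_zero[OF f assms(3)] lin_zero[OF lin_F] by (simp add: mult.assoc)
    finally show ?thesis .
  qed
  then show ?thesis unfolding retract_def using maps_mult[OF F bc(1)] maps_mult[OF bc(2) E] h bc(3)
    by (intro exI[of _ "b * ff j"] exI[of _ "ee j * c"] exI[of _ "\<kappa> * EF_coeff_mset j \<mu>"]) auto
qed

lemma retract_step_E:
  assumes "j \<ge> 1" "Suc j \<in># \<mu>" "j \<notin># \<mu>" "retract k (add_mset j (\<mu> - {#Suc j#}))"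
  shows "retract k \<mu>"
proof -
  let ?\<nu> = "add_mset j (\<mu> - {#Suc j#})"
  have e: "add_mset (Suc j) ?\<nu> = add_mset j \<mu>" using assms(2) by (simp add: add_mset_commute[of "Suc j"])
  obtain b c \<kappa> where bc: "maps b ?\<nu> (mset (om k))" "maps c (mset (om k)) ?\<nu>" "\<kappa> \<noteq> 0"
    "\<And>f. supp ?\<nu> f \<Longrightarrow> opU c (opU b f) = (\<lambda>u. \<kappa> * f u)" using assms(4) unfolding retract_def by blast
  have F: "maps (ff j) ?\<nu> \<mu>" using e assms(1) by (intro maps_F) auto
  have E: "maps (ee j) \<mu> ?\<nu>" using e assms(1) by (intro maps_E) auto
  have "count \<mu> (Suc j) \<ge> 1" using assms(2) by (simp add: Suc_leI)
  then have h: "EF_coeff_mset j \<mu> \<noteq> 0" using assms(3) pow_ne[of "count \<mu> (Suc j)"] rs by (simp add: EF_coeff_mset_def not_in_iff)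
  have "opU (ff j * c) (opU (b * ee j) f) = (\<lambda>u. \<kappa> * (- EF_coeff_mset j \<mu>) * f u)" if f: "supp \<mu> f" for f
  proof -
    have "opU (ff j * c) (opU (b * ee j) f) = F j (opU c (opU b (E j f)))"
      by (simp add: alg_op_gen_eq)
    also have "\<dots> = F j (\<lambda>u. \<kappa> * E j f u)" using bc(4) mapsD(1)[OF E f] by (simp add: alg_op_gen_eq)
    also have "\<dots> = (\<lambda>u. \<kappa> * F j (E j f) u)" by (rule lin_cmul[OF lin_F])
    also have "F j (E j f) = (\<lambda>u. - EF_coeff_mset j \<mu> * f u)"
      using EF_supp[OF f, of j] unfolding F_zero[OF f assms(3)] lin_zero[OF lin_E]
      by (simp add: fun_eq_iff eq_neg_iff_add_eq_0)
    finally show ?thesis by (simp add: mult.assoc)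
  qed
  then show ?thesis unfolding retract_def using maps_mult[OF E bc(1)] maps_mult[OF bc(2) F] h bc(3)
    by (intro exI[of _ "b * ee j"] exI[of _ "ff j * c"] exI[of _ "\<kappa> * (- EF_coeff_mset j \<mu>)"]) auto
qed

section \<open>Moving letters to the word 1 2 ... k\<close>

lemma initial_segment:
  assumes "finite S" "0 \<notin> S" "\<And>l. 1 \<le> l \<Longrightarrow> Suc l \<in> S \<Longrightarrow> l \<in> S"
  shows "S = {1..<Suc (card S)}"
proof -
  have "\<exists>m. S = {1..<Suc m}"
  proof (cases "S = {}")
    case False
    have "y \<in> S" if "1 \<le> y" "y \<le> Max S" for y
      using that(2)
    proof (induction rule: inc_induct)
      case base show ?case using assms(1) False by simp
    next
      case (step l) then show ?case using assms(3)[of l] that(1) by simp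
    qed
    moreover have "1 \<le> y \<and> y \<le> Max S" if "y \<in> S" for y using that assms by (cases y) auto
    ultimately have "S = {1..<Suc (Max S)}" by (auto simp: less_Suc_eq_le)
    then show ?thesis by blast
  qed (auto intro: exI[of _ 0])
  then obtain m where "S = {1..<Suc m}" by blast
  then show ?thesis by simp
qed

text \<open>Induction on the sum of the letters: as long as some letter has a gap just below it, it
  steps down. Without gaps the letters are 1, ..., k.\<close>

lemma retract_distinct:
  "0 \<notin># \<mu> \<Longrightarrow> size \<mu> = k \<Longrightarrow> (\<And>x. count \<mu> x \<le> 1) \<Longrightarrow> retract k \<mu>"
proof (induction "sum_mset \<mu>" arbitrary: \<mu> rule: less_induct)
  case less
  show ?case
  proof (cases "\<exists>l\<ge>1. Suc l \<in># \<mu> \<and> l \<notin># \<mu>")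
    case True
    then obtain l where l: "l \<ge> 1" "Suc l \<in># \<mu>" "l \<notin># \<mu>" by blast
    let ?\<nu> = "add_mset l (\<mu> - {#Suc l#})"
    have \<mu>: "\<mu> = add_mset (Suc l) (\<mu> - {#Suc l#})" using l by simp
    have "sum_mset ?\<nu> < sum_mset \<mu>" by (subst (2) \<mu>) simp
    moreover have "0 \<notin># ?\<nu>" using less.prems(1) l by (auto dest: in_diffD)
    moreover have "size ?\<nu> = k" using less.prems(2) l by (metis \<mu> size_add_mset)
    moreover have "count ?\<nu> x \<le> 1" for x using less.prems(3)[of x] l by (auto simp: not_in_iff)
    ultimately have "retract k ?\<nu>" by (rule less.hyps)
    then show ?thesis by (rule retract_step_E[OF l])
  next
    case False
    then have S: "set_mset \<mu> = {1..<Suc (card (set_mset \<mu>))}"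
      using less.prems(1) by (intro initial_segment) auto
    have \<mu>: "\<mu> = mset_set (set_mset \<mu>)"
    proof (rule multiset_eqI)
      fix x show "count \<mu> x = count (mset_set (set_mset \<mu>)) x"
      proof (cases "x \<in># \<mu>")
        case True
        then have "count \<mu> x = 1" using less.prems(3)[of x] count_greater_zero_iff[of \<mu> x] by linarith
        then show ?thesis using True by simp
      next
        case False
        then show ?thesis by (simp add: count_eq_zero_iff)
      qed
    qed
    then have "card (set_mset \<mu>) = k" using less.prems(2) by (metis size_mset_set)
    then have "\<mu> = mset (om k)" using S \<mu> by (simp only: om_def mset_upt)
    then show ?thesis using retract_om by simp
  qed
qed

text \<open>Induction on the number of coincidences among letters. A letter may step only to an
  empty neighbour, so the first gap z above a repeated letter j is brought down next to j by
  shifting the letters between them upwards, the topmost first. As soon as a copy of a repeated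
  letter moves, the support grows.\<close>

lemma retract_all: "0 \<notin># \<mu> \<Longrightarrow> size \<mu> = k \<Longrightarrow> retract k \<mu>"
proof (induction "size \<mu> - card (set_mset \<mu>)" arbitrary: \<mu> rule: less_induct)
  case less
  have le: "card (set_mset \<nu>) \<le> size \<nu>" for \<nu> :: "nat multiset"
    using size_mset_mono[OF mset_set_set_mset_msubset[of \<nu>]] by simp
  have more: "retract k \<nu>" if "0 \<notin># \<nu>" "size \<nu> = k" "card (set_mset \<nu>) = Suc (card (set_mset \<mu>))" for \<nu>
    using that less.prems(2) le[of \<nu>] by (intro less.hyps) auto
  have inner: "retract k \<nu>"
    if "card (set_mset \<nu>) = card (set_mset \<mu>)" "0 \<notin># \<nu>" "size \<nu> = k" "2 \<le> count \<nu> j"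
       "\<And>l. j < l \<Longrightarrow> l < z \<Longrightarrow> l \<in># \<nu>" "z \<notin># \<nu>" "z = Suc (j + d)" for \<nu> j z d
    using that
  proof (induction d arbitrary: \<nu> z)
    case 0
    let ?\<kappa> = "add_mset (Suc j) (\<nu> - {#j#})"
    have "0 < count \<nu> j" using 0(4) by linarith
    then have jn: "j \<in># \<nu>" by simp
    moreover have "j \<ge> 1" using jn 0(2) by (cases j) simp_all
    ultimately have j: "j \<in># \<nu>" "j \<ge> 1" by simp_all
    have "set_mset (\<nu> - {#j#}) = set_mset \<nu>" using 0(4) by (auto dest: in_diffD simp: in_diff_count)
    then have "card (set_mset ?\<kappa>) = Suc (card (set_mset \<mu>))" using 0 by simp
    moreover have "0 \<notin># ?\<kappa>" using 0(2) by (auto dest: in_diffD)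
    moreover have "size ?\<kappa> = k" using 0(3) j by (metis insert_DiffM size_add_mset)
    ultimately have "retract k ?\<kappa>" by (intro more)
    moreover have "Suc j \<notin># \<nu>" using 0(6,7) by simp
    ultimately show ?case using retract_step_F[OF j(2,1)] by blast
  next
    case (Suc d)
    define l where "l = Suc (j + d)"
    have l: "l \<in># \<nu>" "z = Suc l" "l \<ge> 1" "j < l" using Suc.prems by (auto simp: l_def)
    let ?\<kappa> = "add_mset z (\<nu> - {#l#})"
    have z: "0 \<notin># ?\<kappa>" using Suc.prems(2) l by (auto dest: in_diffD)
    have sz: "size ?\<kappa> = k" using Suc.prems(3) l by (metis insert_DiffM size_add_mset)
    have "retract k ?\<kappa>"
    proof (cases "count \<nu> l \<ge> 2")
      case True
      have "set_mset (\<nu> - {#l#}) = set_mset \<nu>" using True by (auto dest: in_diffD simp: in_diff_count)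
      then have "card (set_mset ?\<kappa>) = Suc (card (set_mset \<mu>))" using Suc.prems by simp
      then show ?thesis using z sz by (intro more)
    next
      case False
      \<comment> \<open>The only copy of \<open>l\<close> moves to \<open>z\<close>: the support
        keeps its size, and the gap is now at \<open>l\<close>, one place nearer to
        \<open>j\<close>.\<close>
      then have c1: "count \<nu> l = 1" using count_greater_zero_iff[of \<nu> l] l(1) by linarith
      then have st: "set_mset (\<nu> - {#l#}) = set_mset \<nu> - {l}"
      proof (intro Set.set_eqI)
        fix x show "x \<in># \<nu> - {#l#} \<longleftrightarrow> x \<in> set_mset \<nu> - {l}"
          using c1 by (cases "x = l") (simp_all add: count_greater_zero_iff[symmetric] del: count_greater_zero_iff)
      qed
      have "card (set_mset ?\<kappa>) = Suc (card (set_mset \<nu> - {l}))"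
        using Suc.prems(6) by (simp add: st)
      also have "\<dots> = card (set_mset \<nu>)" by (rule card_Suc_Diff1) (use l in simp_all)
      finally have "card (set_mset ?\<kappa>) = card (set_mset \<mu>)" using Suc.prems(1) by simp
      moreover have "2 \<le> count ?\<kappa> j" using Suc.prems(4) l by simp
      moreover have "l' \<in># ?\<kappa>" if "j < l'" "l' < l" for l'
      proof -
        have "l' \<in># \<nu>" using Suc.prems(5)[of l'] that l by simp
        then show ?thesis using that by (simp add: in_diff_count)
      qed
      moreover have "l \<notin># ?\<kappa>" using c1 l by (simp add: not_in_iff)
      ultimately show ?thesis using z sz by (intro Suc.IH[of ?\<kappa> l]) (auto simp: l_def)
    qed
    then show ?case using retract_step_F[OF l(3,1)] Suc.prems(6) unfolding l(2) by blast
  qed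
  show ?case
  proof (cases "\<exists>j. 2 \<le> count \<mu> j")
    case True
    then obtain j where j: "2 \<le> count \<mu> j" by blast
    define z where "z = (LEAST z. j < z \<and> z \<notin># \<mu>)"
    have "\<exists>z. j < z \<and> z \<notin># \<mu>"
    proof (rule ccontr)
      assume "\<not> ?thesis"
      then have "{j<..} \<subseteq> set_mset \<mu>" by auto
      then show False using infinite_Ioi[of j] finite_subset by blast
    qed
    then have z: "j < z" "z \<notin># \<mu>" unfolding z_def by (metis (mono_tags, lifting) LeastI)+
    have b: "l \<in># \<mu>" if "j < l" "l < z" for l using that not_less_Least[of l] unfolding z_def by blast
    show ?thesis using less.prems j z b by (intro inner[of \<mu> j z "z - Suc j"]; (rule b; assumption | simp))
  next
    case False
    then have "count \<mu> x \<le> 1" for x by (metis not_less_eq_eq numeral_2_eq_2 One_nat_def)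
    then show ?thesis using less.prems by (intro retract_distinct)
  qed
qed

section \<open>Right multiplication on the weight space of 1 2 ... k\<close>

lemma repl_delta_free: "a \<noteq> b \<Longrightarrow> b \<notin> set q \<Longrightarrow> repl a b (delta q) u = 0"
proof -
  assume ab: "a \<noteq> b" "b \<notin> set q"
  have "repl a b (delta q) u = repl a b (\<lambda>v. 0) u"
  proof (rule repl_cong)
    fix v assume "add_mset a (mset v) = add_mset b (mset u)"
    then have "b \<in># add_mset a (mset v)" by simp
    then show "delta q v = 0" using ab by auto
  qed
  then show ?thesis by (simp add: repl_lin)
qed

lemma repl'_delta_free: "a \<noteq> b \<Longrightarrow> b \<notin> set q \<Longrightarrow> repl' a b (delta q) u = 0"
proof -
  assume ab: "a \<noteq> b" "b \<notin> set q"
  have "repl' a b (delta q) u = repl' a b (\<lambda>v. 0) u"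
  proof (rule repl'_cong)
    fix v assume "add_mset a (mset v) = add_mset b (mset u)"
    then have "b \<in># add_mset a (mset v)" by simp
    then show "delta q v = 0" using ab by auto
  qed
  then show ?thesis by (simp add: repl'_lin)
qed

lemma repl_delta:
  assumes "a \<noteq> b" "b \<notin> set p" "b \<notin> set q"
  shows "repl a b (delta (p @ b # q)) u = word_wt a b p * delta (p @ a # q) u"
  using assms(2)
proof (induction p arbitrary: u)
  case Nil
  show ?case using assms by (cases u; cases "hd u = b") (auto simp: repl_delta_free repl_lin)
next
  case (Cons c p)
  then show ?case by (cases u; cases "hd u = c") (auto simp: repl_lin)
qed

lemma word_wt_free: "a \<notin> set q \<Longrightarrow> b \<notin> set q \<Longrightarrow> word_wt a b q = 1"
  by (induction q) (auto simp: letter_wt_def)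

lemma repl'_delta1:
  assumes "a \<noteq> b" "a \<notin> set q" "b \<notin> set q"
  shows "repl' a b (delta (b # q)) u = delta (a # q) u"
  using assms by (cases u; cases "hd u = b") (auto simp: repl'_delta_free repl'_lin word_wt_free)

text \<open>The letters behind decide the weight: changing the second \<open>b\<close> costs
  nothing, while the first one has another \<open>b\<close>, of weight \<open>s\<close>, behind
  it.\<close>

lemma repl'_delta2:
  assumes "a \<noteq> b" "a \<notin> set q" "b \<notin> set q" "a \<notin> set p" "b \<notin> set p"
  shows "repl' a b (delta (p @ b # b # q)) u = delta (p @ b # a # q) u + s * delta (p @ a # b # q) u"
  using assms(4,5)
proof (induction p arbitrary: u)
  case Nil
  show ?case using assms by (cases u; cases "hd u = b") (auto simp: repl'_delta1 repl'_lin word_wt_free letter_wt_def)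
next
  case (Cons c p)
  then show ?case by (cases u; cases "hd u = c") (auto simp: repl'_lin)
qed

lemma om_split:
  assumes "1 \<le> i" "i < k"
  shows "om k = [1..<i] @ i # Suc i # [Suc (Suc i)..<Suc k]"
proof -
  have "om k = [1..<i] @ [i..<Suc k]"
    unfolding om_def using upt_add_eq_append[of 1 i "Suc k - i"] assms by (simp del: upt_Suc)
  then show ?thesis using upt_conv_Cons[of i "Suc k"] upt_conv_Cons[of "Suc i" "Suc k"] assms by (simp del: upt_Suc)
qed

lemma word_wt_last: "word_wt a b (p @ [a]) = word_wt a b p * r"
  by (simp add: letter_wt_def)

text \<open>\<open>E i\<close> merges the neighbours \<open>i\<close>, \<open>Suc i\<close> into two
  equal letters, with a factor \<open>r\<close> from the letter \<open>i\<close> in front;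
  \<open>F i\<close> splits the pair into both orders with coefficients 1 and \<open>s\<close>.
  Subtracting \<open>r\<close> times the vector leaves \<open>r * s\<close> times the swapped
  word.\<close>

lemma T_om:
  assumes "1 \<le> i" "i < k"
  shows "T i (delta (om k)) = (\<lambda>u. F i (E i (delta (om k))) u - r * delta (om k) u)"
proof -
  define p q where "p = [1..<i]" and "q = [Suc (Suc i)..<Suc k]"
  have o: "om k = p @ i # Suc i # q" unfolding p_def q_def by (rule om_split[OF assms])
  have l: "i - 1 = length p" by (simp add: p_def)
  have p: "i \<notin> set p" "Suc i \<notin> set p" and q: "i \<notin> set q" "Suc i \<notin> set q" by (auto simp: p_def q_def)
  have "repl i (Suc i) (delta ((p @ [i]) @ Suc i # q)) u = word_wt i (Suc i) (p @ [i]) * delta ((p @ [i]) @ i # q) u" for u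
    using p q by (intro repl_delta) auto
  then have e: "E i (delta (om k)) = (\<lambda>u. r * delta (p @ i # i # q) u)"
    using word_wt_free[of i p "Suc i"] p unfolding E_def o by (simp add: word_wt_last fun_eq_iff letter_wt_def)
  have f: "F i (delta (p @ i # i # q)) u = delta (p @ i # Suc i # q) u + s * delta (p @ Suc i # i # q) u" for u
    unfolding F_def using p q by (intro repl'_delta2) auto
  have t: "T i (delta (om k)) u = r * s * delta (p @ Suc i # i # q) u" for u
    unfolding T_def l o by (rule T0_delta) simp
  show ?thesis
  proof
    fix u
    have "F i (E i (delta (om k))) u = r * (delta (p @ i # Suc i # q) u + s * delta (p @ Suc i # i # q) u)"
      unfolding e lin_cmul[OF lin_F] f ..
    then show "T i (delta (om k)) u = F i (E i (delta (om k))) u - r * delta (om k) u"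
      unfolding t by (simp add: o algebra_simps)
  qed
qed

lemma om_letters: "set (om k) = {1..k}"
  by (auto simp: om_def)

text \<open>
  On the generating vector \<open>T\<^sub>i\<close> agrees with \<open>f\<^sub>i e\<^sub>i - r\<close>, which commutes with the Hecke algebra: this is
  right multiplication by \<open>T\<^sub>i\<close>.
\<close>

lemma wT_om:
  "set w \<subseteq> {1..<k} \<Longrightarrow> \<exists>y. maps y (mset (om k)) (mset (om k)) \<and> wordT w (delta (om k)) = opU y (delta (om k))"
proof (induction w)
  case Nil
  show ?case by (intro exI[of _ 1]) (simp add: maps_one xU_one)
next
  case (Cons i w)
  then obtain y where y: "maps y (mset (om k)) (mset (om k))" "wordT w (delta (om k)) = opU y (delta (om k))" by auto
  have i: "1 \<le> i" "i < k" using Cons.prems by auto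
  let ?\<nu> = "add_mset i (mset (om k) - {#Suc i#})"
  have si: "Suc i \<in># mset (om k)" using i by (simp add: om_letters)
  have e: "add_mset (Suc i) ?\<nu> = add_mset i (mset (om k))" using si by (simp add: add_mset_commute[of "Suc i"])
  have m: "maps (ff i * ee i - scal r) (mset (om k)) (mset (om k))"
    by (intro maps_diff maps_scal maps_mult[OF maps_E[OF i(1) e[symmetric]] maps_F[OF i(1) e]])
  have "wordT (i # w) (delta (om k)) = T i (opU y (delta (om k)))" by (simp add: y)
  also have "\<dots> = opU y (T i (delta (om k)))"
  proof -
    have "opT (gen i) = T i" by (auto simp: alg_op_linear fun_eq_iff)
    then show ?thesis using xT_xU[of "gen i" y "delta (om k)"] by simp
  qed
  also have "T i (delta (om k)) = opU (ff i * ee i - scal r) (delta (om k))"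
    unfolding T_om[OF i] by (simp add: alg_op_linear alg_op_gen_eq fun_eq_iff)
  finally have "wordT (i # w) (delta (om k)) = opU (y * (ff i * ee i - scal r)) (delta (om k))" by simp
  then show ?case using maps_mult[OF m y(1)] by blast
qed

lemma xT_om:
  "x \<in> Hfree k \<Longrightarrow> \<exists>y. maps y (mset (om k)) (mset (om k)) \<and> opT x (delta (om k)) = opU y (delta (om k))"
proof (induction rule: Free_induct)
  case zero
  show ?case by (intro exI[of _ "scal 0"]) (simp add: maps_scal fun_eq_iff alg_op_linear)
next
  case (single w c)
  then obtain y where y: "maps y (mset (om k)) (mset (om k))" "wordT w (delta (om k)) = opU y (delta (om k))"
    using wT_om[of w k] by (auto simp: hecke_gens_def)
  show ?case using maps_mult[OF y(1) maps_scal] y(2)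
    by (intro exI[of _ "scal c * y"]) (auto simp: alg_op_def[of T] fun_eq_iff)
next
  case (add x x')
  then obtain y y' where "maps y (mset (om k)) (mset (om k))" "opT x (delta (om k)) = opU y (delta (om k))"
    "maps y' (mset (om k)) (mset (om k))" "opT x' (delta (om k)) = opU y' (delta (om k))" by blast
  then show ?case by (intro exI[of _ "y + y'"]) (simp add: maps_add alg_op_linear fun_eq_iff)
qed

lemma finite_mset_lists: "finite {v. mset v = \<mu>}"
  by (cases "\<exists>v. mset v = \<mu>") (auto simp: mset_eq_finite)

text \<open>Every rearrangement of \<open>om k\<close> is the target of a normal form, up to the
  nonzero scalar \<open>(r * s) ^ length\<close>, by which the coefficients are divided.\<close>

lemma om_cyclic:
  assumes "supp (mset (om k)) g"
  shows "\<exists>x\<in>Hfree k. g = opT x (delta (om k))"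
proof -
  let ?V = "{v. mset v = mset (om k)}"
  have "\<forall>v\<in>?V. \<exists>w\<in>NF k. sends_delta w (om k) v" using sends_delta_surj[OF om_sorted(1), of _ k] om_sorted(2) by auto
  then obtain W where W: "\<And>v. v \<in> ?V \<Longrightarrow> W v \<in> NF k" "\<And>v. v \<in> ?V \<Longrightarrow> sends_delta (W v) (om k) v" by metis
  let ?x = "\<Sum>v\<in>?V. Poly_Mapping.single (W v) (g v / (r * s) ^ length (W v))"
  have "?x \<in> Hfree k"
    by (rule Free_sum, rule Free_single) (use W(1) NF_letters in \<open>auto simp: hecke_gens_def\<close>)
  moreover have "g z = opT ?x (delta (om k)) z" for z
  proof (cases "mset z = mset (om k)")
    case True
    then have lz: "length z = length (om k)" by (rule mset_eq_length)
    have "opT ?x (delta (om k)) z = (\<Sum>v\<in>?V. g v / (r * s) ^ length (W v) * wordT (W v) (delta (om k)) z)"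
      by (simp add: alg_op_def leval_sum)
    also have "\<dots> = (\<Sum>v\<in>?V. if v = z then g z else 0)"
    proof (rule sum.cong)
      fix v assume "v \<in> ?V"
      then have "wordT (W v) (delta (om k)) z = (r * s) ^ length (W v) * delta v z"
        using W(2) lz unfolding sends_delta_def by blast
      then show "g v / (r * s) ^ length (W v) * wordT (W v) (delta (om k)) z = (if v = z then g z else 0)"
        using r0 s0 by auto
    qed simp
    also have "\<dots> = g z" using True finite_mset_lists[of "mset (om k)"] by simp
    finally show ?thesis by simp
  next
    case False
    then show ?thesis using assms supp_xT[OF supp_delta] by (simp add: supp_def)
  qed
  ultimately show ?thesis by blast
qed

end

section \<open>The double centralizer argument\<close>

text \<open>Columns are treated one at a time. If some \<open>c0\<close> annihilates the other
  columns but not column \<open>j\<close>, it forces the coefficient of column \<open>j\<close>;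
  otherwise column \<open>j\<close> imposes no further condition and gets coefficient 0.\<close>

lemma fredholm:
  fixes B :: "'a \<Rightarrow> 'b \<Rightarrow> 'k::field"
  assumes "finite J" "finite I"
    "\<And>c. (\<And>j. j \<in> J \<Longrightarrow> (\<Sum>i\<in>I. c i * B i j) = 0) \<Longrightarrow> (\<Sum>i\<in>I. c i * t i) = 0"
  shows "\<exists>d. \<forall>i\<in>I. (\<Sum>j\<in>J. B i j * d j) = t i"
  using assms(1,3)
proof (induction J arbitrary: t rule: finite_induct)
  case empty
  have "t i = 0" if "i \<in> I" for i
    using empty[of "\<lambda>x. if x = i then 1 else 0"] that assms(2)
    by (simp add: if_distrib[of "\<lambda>z. z * _"] cong: if_cong)
  then show ?case by simp
next
  case (insert j J)
  show ?case
  proof (cases "\<exists>c0. (\<forall>j'\<in>J. (\<Sum>i\<in>I. c0 i * B i j') = 0) \<and> (\<Sum>i\<in>I. c0 i * B i j) \<noteq> 0")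
    case True
    then obtain c0 where c0: "\<And>j'. j' \<in> J \<Longrightarrow> (\<Sum>i\<in>I. c0 i * B i j') = 0" and nz: "(\<Sum>i\<in>I. c0 i * B i j) \<noteq> 0" by blast
    define l where "l = (\<Sum>i\<in>I. c0 i * t i) / (\<Sum>i\<in>I. c0 i * B i j)"
    have "\<exists>d. \<forall>i\<in>I. (\<Sum>j\<in>J. B i j * d j) = t i - l * B i j"
    proof (rule insert.IH)
      fix c assume c: "\<And>j'. j' \<in> J \<Longrightarrow> (\<Sum>i\<in>I. c i * B i j') = 0"
      \<comment> \<open>With this \<open>e\<close> the combination \<open>c - e * c0\<close>
        annihilates column \<open>j\<close> as well, so the hypothesis on \<open>t\<close> applies
        to it.\<close>
      define e where "e = (\<Sum>i\<in>I. c i * B i j) / (\<Sum>i\<in>I. c0 i * B i j)"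
      have lin: "(\<Sum>i\<in>I. (c i - e * c0 i) * h i) = (\<Sum>i\<in>I. c i * h i) - e * (\<Sum>i\<in>I. c0 i * h i)" for h
        by (simp add: left_diff_distrib sum_subtractf sum_distrib_left mult.assoc)
      have "(\<Sum>i\<in>I. (c i - e * c0 i) * t i) = 0"
      proof (rule insert.prems)
        fix j' assume "j' \<in> insert j J"
        then show "(\<Sum>i\<in>I. (c i - e * c0 i) * B i j') = 0"
          unfolding lin using c c0 nz by (auto simp: e_def)
      qed
      then have "(\<Sum>i\<in>I. c i * t i) = e * (\<Sum>i\<in>I. c0 i * t i)" unfolding lin by simp
      also have "\<dots> = l * (\<Sum>i\<in>I. c i * B i j)" by (simp add: e_def l_def)
      finally have 1: "(\<Sum>i\<in>I. c i * t i) = l * (\<Sum>i\<in>I. c i * B i j)" .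
      have "(\<Sum>i\<in>I. c i * (t i - l * B i j)) = (\<Sum>i\<in>I. c i * t i) - l * (\<Sum>i\<in>I. c i * B i j)"
        by (simp add: right_diff_distrib sum_subtractf sum_distrib_left mult.left_commute)
      then show "(\<Sum>i\<in>I. c i * (t i - l * B i j)) = 0" using 1 by simp
    qed
    then obtain d where d: "\<And>i. i \<in> I \<Longrightarrow> (\<Sum>j\<in>J. B i j * d j) = t i - l * B i j" by blast
    have "(\<Sum>j'\<in>insert j J. B i j' * (d(j := l)) j') = t i" if "i \<in> I" for i
    proof -
      have "(\<Sum>j'\<in>J. B i j' * (d(j := l)) j') = (\<Sum>j'\<in>J. B i j' * d j')"
        using insert.hyps by (intro sum.cong) auto
      then show ?thesis using insert.hyps d[OF that] by simp
    qed
    then show ?thesis by blast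
  next
    case False
    have "\<exists>d. \<forall>i\<in>I. (\<Sum>j\<in>J. B i j * d j) = t i"
    proof (rule insert.IH)
      fix c assume c: "\<And>j'. j' \<in> J \<Longrightarrow> (\<Sum>i\<in>I. c i * B i j') = 0"
      then show "(\<Sum>i\<in>I. c i * t i) = 0" using False insert.prems[of c] by blast
    qed
    then obtain d where d: "\<And>i. i \<in> I \<Longrightarrow> (\<Sum>j\<in>J. B i j * d j) = t i" by blast
    have "(\<Sum>j'\<in>insert j J. B i j' * (d(j := 0)) j') = t i" if "i \<in> I" for i
    proof -
      have "(\<Sum>j'\<in>J. B i j' * (d(j := 0)) j') = (\<Sum>j'\<in>J. B i j' * d j')"
        using insert.hyps by (intro sum.cong) auto
      then show ?thesis using insert.hyps d[OF that] by simp
    qed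
    then show ?thesis by blast
  qed
qed

context two_params begin

section \<open>Triangular decomposition\<close>

definition F_gens :: "gl_gen set" where "F_gens = {g. \<exists>j\<ge>1. g = GF j}"
definition E_gens :: "gl_gen set" where "E_gens = {g. \<exists>j\<ge>1. g = GE j}"

text \<open>
  Triangular decomposition on a weight space. Generators \<open>e\<^sub>j\<close>, \<open>f\<^sub>j\<close> with \<open>j \<ge> n\<close> either kill or leave
  the span of the words with letters at most \<open>n\<close>, so they disappear after restriction to it.
\<close>

inductive triangular :: "nat multiset \<Rightarrow> ((nat list \<Rightarrow> 'k) \<Rightarrow> nat list \<Rightarrow> 'k) \<Rightarrow> bool" for \<mu> where
  triangular_base: "set v \<subseteq> F_gens \<Longrightarrow> set w \<subseteq> E_gens \<Longrightarrow>
    (\<And>f. supp \<mu> f \<Longrightarrow> P f = (\<lambda>u. c * wordU v (wordU w f) u)) \<Longrightarrow> triangular \<mu> P"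
| triangular_add: "triangular \<mu> P \<Longrightarrow> triangular \<mu> Q \<Longrightarrow> (\<And>f. supp \<mu> f \<Longrightarrow> R f = (\<lambda>u. P f u + Q f u)) \<Longrightarrow> triangular \<mu> R"

lemma triangular_cong: "triangular \<mu> P \<Longrightarrow> (\<And>f. supp \<mu> f \<Longrightarrow> Q f = P f) \<Longrightarrow> triangular \<mu> Q"
proof (induction rule: triangular.induct)
  case (triangular_base v w P c)
  then show ?case by (intro triangular.triangular_base[of v w \<mu> Q c]) auto
next
  case (triangular_add P Q' R)
  then show ?case by (intro triangular.triangular_add[of \<mu> P Q' Q]) auto
qed

lemma triangular_cmul: "triangular \<mu> P \<Longrightarrow> triangular \<mu> (\<lambda>f u. a * P f u)"
proof (induction rule: triangular.induct)
  case (triangular_base v w P c)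
  then show ?case by (intro triangular.triangular_base[of v w \<mu> _ "a * c"]) (auto simp: mult.assoc)
next
  case (triangular_add P Q R)
  then show ?case by (intro triangular.triangular_add[OF triangular_add.IH]) (auto simp: algebra_simps)
qed

lemma triangular_F: "triangular \<mu> P \<Longrightarrow> j \<ge> 1 \<Longrightarrow> triangular \<mu> (\<lambda>f. F j (P f))"
proof (induction rule: triangular.induct)
  case (triangular_base v w P c)
  then show ?case by (intro triangular.triangular_base[of "GF j # v" w \<mu> _ c]) (auto simp: F_gens_def lin_cmul[OF lin_F])
next
  case (triangular_add P Q R)
  then show ?case by (intro triangular.triangular_add[OF triangular_add.IH]) (auto simp: lin_add[OF lin_F])
qed

text \<open>If the required letter is absent, the generator kills the weight space and any
  \<open>\<nu>\<close> does; \<open>\<mu>\<close> itself is taken.\<close>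

lemma Uop_weight:
  assumes "g \<in> EF_gens" "supp \<mu> f"
  obtains \<nu> where "\<And>f. supp \<mu> f \<Longrightarrow> supp \<nu> (Uop g f)"
proof -
  consider j where "g = GE j" "Suc j \<in># \<mu>" "1 \<le> j" | j where "g = GE j" "Suc j \<notin># \<mu>"
    | j where "g = GF j" "j \<in># \<mu>" "1 \<le> j" | j where "g = GF j" "j \<notin># \<mu>" using assms(1) by (auto simp: EF_gens_def)
  then show ?thesis
  proof cases
    case (1 j)
    then have e: "add_mset j \<mu> = add_mset (Suc j) (add_mset j (\<mu> - {#Suc j#}))" by (simp add: add_mset_commute[of "Suc j"])
    show ?thesis using mapsD(1)[OF maps_E[OF 1(3) e]] 1(1)
      by (intro that[of "add_mset j (\<mu> - {#Suc j#})"]) (simp add: alg_op_gen_eq)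
  next
    case (3 j)
    then have e: "add_mset (Suc j) \<mu> = add_mset j (add_mset (Suc j) (\<mu> - {#j#}))" by (simp add: add_mset_commute[of j])
    show ?thesis using mapsD(1)[OF maps_F[OF 3(3) e]] 3(1)
      by (intro that[of "add_mset (Suc j) (\<mu> - {#j#})"]) (simp add: alg_op_gen_eq)
  next
    case (2 j)
    then show ?thesis using that[of \<mu>] E_zero by (simp add: supp_zero)
  next
    case (4 j)
    then show ?thesis using that[of \<mu>] F_zero by (simp add: supp_zero)
  qed
qed

lemma word_weight: "set w \<subseteq> EF_gens \<Longrightarrow> \<exists>\<nu>. \<forall>f. supp \<mu> f \<longrightarrow> supp \<nu> (wordU w f)"
proof (induction w)
  case (Cons g w)
  then obtain \<nu> where "\<forall>f. supp \<mu> f \<longrightarrow> supp \<nu> (wordU w f)" by auto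
  moreover obtain \<kappa> where "\<And>f. supp \<nu> f \<Longrightarrow> supp \<kappa> (Uop g f)"
    using Uop_weight[of g \<nu> "\<lambda>u. 0"] Cons.prems supp_zero by auto
  ultimately show ?case by auto
qed auto

text \<open>\<open>E j\<close> is moved to the right through the word in the \<open>F\<close>. Only
  a factor \<open>F j\<close> obstructs, and its commutator is a scalar because everything to its
  right ends in a single weight \<open>\<nu>\<close>.\<close>

lemma triangular_E_base:
  assumes "set v \<subseteq> F_gens" "set w \<subseteq> E_gens" "j \<ge> 1"
  shows "triangular \<mu> (\<lambda>f. E j (wordU v (wordU w f)))"
  using assms(1)
proof (induction v)
  case Nil
  show ?case using assms by (intro triangular_base[of "[]" "GE j # w" _ _ 1]) (auto simp: E_gens_def)
next
  case (Cons g v)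
  then obtain i where i: "g = GF i" "i \<ge> 1" by (auto simp: F_gens_def)
  have IH: "triangular \<mu> (\<lambda>f. E j (wordU v (wordU w f)))" using Cons by simp
  show ?case
  proof (cases "i = j")
    case False
    then have "E j (wordU (g # v) f) = F i (E j (wordU v f))" for f
      using EF_comm_ne[of j i "wordU v f"] i by (simp add: fun_eq_iff)
    then show ?thesis using triangular_F[OF IH i(2)] by simp
  next
    case True
    have "set (v @ w) \<subseteq> EF_gens" using Cons.prems assms(2) by (auto simp: F_gens_def E_gens_def EF_gens_def)
    then obtain \<nu> where \<nu>: "\<And>f. supp \<mu> f \<Longrightarrow> supp \<nu> (wordU (v @ w) f)" using word_weight by blast
    have e: "E j (wordU (g # v) (wordU w f)) =
       (\<lambda>u. F j (E j (wordU v (wordU w f))) u + EF_coeff_mset j \<nu> * wordU v (wordU w f) u)" if "supp \<mu> f" for f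
      using EF_supp[OF \<nu>[OF that], of j] i True by simp
    have "triangular \<mu> (\<lambda>f u. EF_coeff_mset j \<nu> * wordU v (wordU w f) u)"
      using Cons.prems assms(2) by (intro triangular_base[of v w _ _ "EF_coeff_mset j \<nu>"]) auto
    from triangular_add[OF triangular_F[OF IH assms(3)] this e] show ?thesis .
  qed
qed

lemma triangular_E: "triangular \<mu> P \<Longrightarrow> j \<ge> 1 \<Longrightarrow> triangular \<mu> (\<lambda>f. E j (P f))"
proof (induction rule: triangular.induct)
  case (triangular_base v w P c)
  have "triangular \<mu> (\<lambda>f u. c * E j (wordU v (wordU w f)) u)"
    using triangular_base by (intro triangular_cmul triangular_E_base) auto
  then show ?case by (rule triangular_cong) (simp add: triangular_base.hyps(3) lin_cmul[OF lin_E])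
next
  case (triangular_add P Q R)
  then show ?case by (intro triangular.triangular_add[OF triangular_add.IH]) (auto simp: lin_add[OF lin_E])
qed

lemma triangular_word: "set w \<subseteq> EF_gens \<Longrightarrow> triangular \<mu> (wordU w)"
proof (induction w)
  case Nil
  show ?case by (rule triangular_base[of "[]" "[]" _ _ 1]) auto
next
  case (Cons g w)
  then consider j where "g = GE j" "j \<ge> 1" | j where "g = GF j" "j \<ge> 1" by (auto simp: EF_gens_def)
  then show ?case
  proof cases
    case (1 j)
    have "triangular \<mu> (\<lambda>f. E j (wordU w f))" using Cons 1 by (intro triangular_E) auto
    then show ?thesis by (rule triangular_cong) (simp add: 1)
  next
    case (2 j)
    have "triangular \<mu> (\<lambda>f. F j (wordU w f))" using Cons 2 by (intro triangular_F) auto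
    then show ?thesis by (rule triangular_cong) (simp add: 2)
  qed
qed

lemma triangular_xU: "y \<in> Free EF_gens \<Longrightarrow> triangular \<mu> (opU y)"
proof (induction rule: Free_induct)
  case zero
  show ?case by (rule triangular_base[of "[]" "[]" _ _ 0]) (auto simp: fun_eq_iff alg_op_linear)
next
  case (single w c)
  show ?case by (rule triangular_cong[OF triangular_cmul[OF triangular_word[OF single], of \<mu> c]]) (auto simp: fun_eq_iff alg_op_def)
next
  case (add x y)
  show ?case by (rule triangular_add[OF add.IH]) (auto simp: fun_eq_iff alg_op_linear)
qed

section \<open>Restriction to letters at most n\<close>

definition inside :: "nat \<Rightarrow> (nat list \<Rightarrow> 'k) \<Rightarrow> bool" where
  "inside n f \<longleftrightarrow> (\<forall>u. \<not> set u \<subseteq> {1..n} \<longrightarrow> f u = 0)"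

definition beyond :: "nat \<Rightarrow> (nat list \<Rightarrow> 'k) \<Rightarrow> bool" where
  "beyond n f \<longleftrightarrow> (\<forall>u. set u \<subseteq> {1..n} \<longrightarrow> f u = 0)"

definition restrict_letters :: "nat \<Rightarrow> (nat list \<Rightarrow> 'k) \<Rightarrow> nat list \<Rightarrow> 'k" where
  "restrict_letters n f u = (if set u \<subseteq> {1..n} then f u else 0)"

lemma supp_inside:
  assumes "supp \<mu> f" "set_mset \<mu> \<subseteq> {1..n}" shows "inside n f"
  unfolding inside_def
proof (intro allI impI)
  fix u assume "\<not> set u \<subseteq> {1..n}"
  then have "mset u \<noteq> \<mu>" using assms(2) by (metis set_mset_mset)
  then show "f u = 0" using assms(1) by (simp add: supp_def)
qed

lemma restrict_letters_inside: "inside n f \<Longrightarrow> restrict_letters n f = f"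
  by (auto simp: restrict_letters_def inside_def fun_eq_iff)

lemma E_eq_0: "(\<And>v. insert j (set v) = insert (Suc j) (set u) \<Longrightarrow> f v = 0) \<Longrightarrow> E j f u = 0"
proof -
  assume a: "\<And>v. insert j (set v) = insert (Suc j) (set u) \<Longrightarrow> f v = 0"
  have "repl j (Suc j) f u = repl j (Suc j) (\<lambda>v. 0) u"
  proof (rule repl_cong, rule a)
    fix v assume "add_mset j (mset v) = add_mset (Suc j) (mset u)"
    then have "set_mset (add_mset j (mset v)) = set_mset (add_mset (Suc j) (mset u))" by simp
    then show "insert j (set v) = insert (Suc j) (set u)" by simp
  qed
  then show ?thesis by (simp add: E_def repl_lin)
qed

lemma F_eq_0: "(\<And>v. insert (Suc j) (set v) = insert j (set u) \<Longrightarrow> f v = 0) \<Longrightarrow> F j f u = 0"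
proof -
  assume a: "\<And>v. insert (Suc j) (set v) = insert j (set u) \<Longrightarrow> f v = 0"
  have "repl' (Suc j) j f u = repl' (Suc j) j (\<lambda>v. 0) u"
  proof (rule repl'_cong, rule a)
    fix v assume "add_mset (Suc j) (mset v) = add_mset j (mset u)"
    then have "set_mset (add_mset (Suc j) (mset v)) = set_mset (add_mset j (mset u))" by simp
    then show "insert (Suc j) (set v) = insert j (set u)" by simp
  qed
  then show ?thesis by (simp add: F_def repl'_lin)
qed

lemma E_inside:
  assumes "inside n f" "1 \<le> j" "j < n" shows "inside n (E j f)"
  unfolding inside_def
proof (intro allI impI E_eq_0)
  fix u v assume u: "\<not> set u \<subseteq> {1..n}" and uv: "insert j (set v) = insert (Suc j) (set u)"
  have "set u \<subseteq> insert j (set v)" using uv by blast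
  then have "\<not> set v \<subseteq> {1..n}" using assms u by fastforce
  then show "f v = 0" using assms(1) by (simp add: inside_def)
qed

lemma E_kill:
  assumes "inside n f" "n \<le> j" shows "E j f = (\<lambda>u. 0)"
proof (rule ext, rule E_eq_0)
  fix u v assume "insert j (set v) = insert (Suc j) (set u)"
  then have "Suc j \<in> set v" by (metis insertCI insertE n_not_Suc_n)
  then have "\<not> set v \<subseteq> {1..n}" using assms(2) by auto
  then show "f v = 0" using assms(1) by (simp add: inside_def)
qed

lemma F_inside:
  assumes "inside n f" "1 \<le> j" "j < n" shows "inside n (F j f)"
  unfolding inside_def
proof (intro allI impI F_eq_0)
  fix u v assume u: "\<not> set u \<subseteq> {1..n}" and uv: "insert (Suc j) (set v) = insert j (set u)"
  have "set u \<subseteq> insert (Suc j) (set v)" using uv by blast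
  then have "\<not> set v \<subseteq> {1..n}" using assms u by fastforce
  then show "f v = 0" using assms(1) by (simp add: inside_def)
qed

lemma F_beyond:
  assumes "beyond n f" "1 \<le> j" shows "beyond n (F j f)"
  unfolding beyond_def
proof (intro allI impI F_eq_0)
  fix u v assume u: "set u \<subseteq> {1..n}" and uv: "insert (Suc j) (set v) = insert j (set u)"
  then have "Suc j \<in> set u" by (metis insertCI insertE n_not_Suc_n)
  then have "j \<in> {1..n}" using u assms(2) by auto
  then have "insert j (set u) \<subseteq> {1..n}" using u by simp
  then have "set v \<subseteq> {1..n}" unfolding uv[symmetric] by simp
  then show "f v = 0" using assms(1) by (simp add: beyond_def)
qed

lemma F_kill:
  assumes "n \<le> j" shows "beyond n (F j f)"
  unfolding beyond_def
proof (intro allI impI F_eq_0)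
  fix u v assume u: "set u \<subseteq> {1..n}" and uv: "insert (Suc j) (set v) = insert j (set u)"
  then have "Suc j \<in> set u" by (metis insertCI insertE n_not_Suc_n)
  then show "f v = 0" using u assms by auto
qed

definition EF_gens_below :: "nat \<Rightarrow> gl_gen set" where
  "EF_gens_below n = {g. \<exists>j. 1 \<le> j \<and> j < n \<and> (g = GE j \<or> g = GF j)}"

lemma word_op_U_zero: "wordU w (\<lambda>u. 0) = (\<lambda>u. 0)"
  by (rule lin_zero[OF lin_wU])

lemma E_word: "set w \<subseteq> E_gens \<Longrightarrow> inside n f \<Longrightarrow> inside n (wordU w f) \<and> (\<not> set w \<subseteq> EF_gens_below n \<longrightarrow> wordU w f = (\<lambda>u. 0))"
proof (induction w)
  case (Cons g w)
  then obtain j where j: "g = GE j" "j \<ge> 1" by (auto simp: E_gens_def)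
  have IH: "inside n (wordU w f)" "\<not> set w \<subseteq> EF_gens_below n \<Longrightarrow> wordU w f = (\<lambda>u. 0)" using Cons by auto
  show ?case
  proof (cases "j < n")
    case True
    then have "g \<in> EF_gens_below n" using j by (auto simp: EF_gens_below_def)
    then show ?thesis using E_inside[OF IH(1) j(2) True] IH(2) j(1) by (auto simp: lin_zero[OF lin_E])
  next
    case False
    then have "E j (wordU w f) = (\<lambda>u. 0)" using E_kill[OF IH(1)] by simp
    then show ?thesis using j by (simp add: inside_def)
  qed
qed auto

lemma F_word: "set w \<subseteq> F_gens \<Longrightarrow> \<not> set w \<subseteq> EF_gens_below n \<Longrightarrow> beyond n (wordU w f)"
proof (induction w)
  case (Cons g w)
  then obtain j where j: "g = GF j" "j \<ge> 1" by (auto simp: F_gens_def)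
  show ?case
  proof (cases "j < n")
    case True
    then have "g \<in> EF_gens_below n" using j by (auto simp: EF_gens_below_def)
    then have "beyond n (wordU w f)" using Cons by auto
    then show ?thesis using F_beyond j by simp
  next
    case False
    then show ?thesis using F_kill j by simp
  qed
qed auto

lemma F_word_inside: "set w \<subseteq> F_gens \<Longrightarrow> set w \<subseteq> EF_gens_below n \<Longrightarrow> inside n f \<Longrightarrow> inside n (wordU w f)"
proof (induction w)
  case (Cons g w)
  then obtain j where "g = GF j" "1 \<le> j" "j < n" by (auto simp: F_gens_def EF_gens_below_def)
  then show ?case using Cons F_inside by simp
qed simp

text \<open>The order of the factors is essential. The \<open>E\<close> part acts first and only
  lowers letters, so for j \<ge> n it finds no letter to act on. An \<open>F j\<close> with j \<ge>
  n creates a letter above n, which no later \<open>F\<close> brings back.\<close>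

lemma triangular_restrict_letters:
  "triangular \<mu> P \<Longrightarrow> set_mset \<mu> \<subseteq> {1..n} \<Longrightarrow> \<exists>y\<in>Free (EF_gens_below n). \<forall>f. supp \<mu> f \<longrightarrow> restrict_letters n (P f) = opU y f"
proof (induction rule: triangular.induct)
  case (triangular_base v w P c)
  have inside: "inside n f" if "supp \<mu> f" for f using supp_inside[OF that triangular_base.prems] .
  show ?case
  proof (cases "set v \<subseteq> EF_gens_below n \<and> set w \<subseteq> EF_gens_below n")
    case True
    have "restrict_letters n (P f) = opU (Poly_Mapping.single (v @ w) c) f" if f: "supp \<mu> f" for f
    proof -
      have "inside n (wordU v (wordU w f))"
        using E_word[OF triangular_base.hyps(2) inside[OF f]] True by (intro F_word_inside[OF triangular_base.hyps(1)]) auto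
      then show ?thesis unfolding triangular_base.hyps(3)[OF f] by (auto simp: restrict_letters_def inside_def alg_op_def fun_eq_iff)
    qed
    moreover have "Poly_Mapping.single (v @ w) c \<in> Free (EF_gens_below n)" using True by (intro Free_single) auto
    ultimately show ?thesis by blast
  next
    case False
    have "restrict_letters n (P f) = opU 0 f" if f: "supp \<mu> f" for f
    proof (cases "set w \<subseteq> EF_gens_below n")
      case True
      then have "beyond n (wordU v (wordU w f))" using False triangular_base.hyps(1) by (intro F_word) auto
      then show ?thesis unfolding triangular_base.hyps(3)[OF f] by (auto simp: restrict_letters_def beyond_def alg_op_linear fun_eq_iff)
    next
      case False
      then have "wordU w f = (\<lambda>u. 0)" using E_word[OF triangular_base.hyps(2) inside[OF f]] by blast
      then have "wordU v (wordU w f) = (\<lambda>u. 0)" by (simp only: word_op_U_zero)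
      then show ?thesis unfolding triangular_base.hyps(3)[OF f] by (simp add: restrict_letters_def[abs_def] alg_op_linear fun_eq_iff)
    qed
    then show ?thesis by blast
  qed
next
  case (triangular_add P Q R)
  then obtain y z where "y \<in> Free (EF_gens_below n)" "\<And>f. supp \<mu> f \<Longrightarrow> restrict_letters n (P f) = opU y f"
    "z \<in> Free (EF_gens_below n)" "\<And>f. supp \<mu> f \<Longrightarrow> restrict_letters n (Q f) = opU z f" by blast
  moreover have "restrict_letters n (R f) = (\<lambda>u. restrict_letters n (P f) u + restrict_letters n (Q f) u)" if "supp \<mu> f" for f
    using triangular_add.hyps(3)[OF that] by (auto simp: restrict_letters_def)
  ultimately show ?case by (intro bexI[of _ "y + z"]) (auto simp: alg_op_linear fun_eq_iff)
qed

text \<open>Vanishing on the generating vector puts \<open>x\<close> into the relation ideal, hence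
  it vanishes on all words of length \<open>k\<close>, also those with repeated letters.\<close>

lemma faithful:
  assumes "x \<in> Hfree k" "opT x (delta (om k)) = (\<lambda>u. 0)" "length u = k"
  shows "opT x f u = 0"
  using JH_alg_op[OF Free_faithful[OF om_sorted assms(1)]] assms(2,3) by simp

lemma faithful_eq:
  assumes "x \<in> Hfree k" "y \<in> Hfree k" "opT x (delta (om k)) = opT y (delta (om k))" "length u = k"
  shows "opT x f u = opT y f u"
  using faithful[of "x - y" k u f] assms by (simp add: Free_diff alg_op_linear fun_eq_iff)

end

text \<open>An endomorphism commuting with the quantum group of rank \<open>n\<close>, constrained
  only on weights with letters in 1, ..., n; for k > n the weight of \<open>om k\<close> is not
  among these.\<close>

locale commutant = two_params r s for r s :: "'k::field" +
  fixes n k :: nat and Phi :: "(nat list \<Rightarrow> 'k) \<Rightarrow> nat list \<Rightarrow> 'k"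
  assumes lin_Phi: "lin Phi"
    and Phi_supp: "\<And>\<mu> f. set_mset \<mu> \<subseteq> {1..n} \<Longrightarrow> size \<mu> = k \<Longrightarrow> supp \<mu> f \<Longrightarrow> supp \<mu> (Phi f)"
    and Phi_comm: "\<And>\<mu> f g. g \<in> EF_gens_below n \<Longrightarrow> set_mset \<mu> \<subseteq> {1..n} \<Longrightarrow> size \<mu> = k \<Longrightarrow> supp \<mu> f \<Longrightarrow>
       Phi (Uop g f) = Uop g (Phi f)"
begin

section \<open>Transport of the endomorphism to the weight of 1 2 ... k\<close>

definition adm :: "nat multiset \<Rightarrow> bool" where
  "adm \<mu> \<longleftrightarrow> set_mset \<mu> \<subseteq> {1..n} \<and> size \<mu> = k"

abbreviation "\<omega> \<equiv> mset (om k)"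
abbreviation "\<delta> \<equiv> (delta (om k) :: nat list \<Rightarrow> 'k)"
abbreviation "H \<equiv> Hfree k :: (nat list \<Rightarrow>\<^sub>0 'k) set"

lemma Phi_word:
  assumes "adm \<mu>" "supp \<mu> f"
  shows "set w \<subseteq> EF_gens_below n \<Longrightarrow> Phi (wordU w f) = wordU w (Phi f) \<and> (\<exists>\<nu>. adm \<nu> \<and> supp \<nu> (wordU w f))"
proof (induction w)
  case Nil
  show ?case using assms by auto
next
  case (Cons g w)
  then obtain \<nu> where \<nu>: "adm \<nu>" "supp \<nu> (wordU w f)" "Phi (wordU w f) = wordU w (Phi f)" by auto
  have g: "g \<in> EF_gens_below n" using Cons.prems by simp
  have "Phi (wordU (g # w) f) = wordU (g # w) (Phi f)"
    using Phi_comm[OF g _ _ \<nu>(2)] \<nu> by (simp add: adm_def)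
  moreover have "\<exists>\<kappa>. adm \<kappa> \<and> supp \<kappa> (Uop g (wordU w f))"
  proof -
    consider j where "g = GE j" "Suc j \<in># \<nu>" "1 \<le> j" "j < n" | j where "g = GE j" "Suc j \<notin># \<nu>"
    | j where "g = GF j" "j \<in># \<nu>" "1 \<le> j" "j < n" | j where "g = GF j" "j \<notin># \<nu>" using g by (auto simp: EF_gens_below_def)
    then show ?thesis
    proof cases
      case (1 j)
      let ?\<kappa> = "add_mset j (\<nu> - {#Suc j#})"
      have e: "add_mset j \<nu> = add_mset (Suc j) ?\<kappa>" using 1 by (simp add: add_mset_commute[of "Suc j"])
      have "supp ?\<kappa> (Uop g (wordU w f))"
        using mapsD(1)[OF maps_E[OF 1(3) e] \<nu>(2)] 1(1) by (simp add: alg_op_gen_eq)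
      moreover have "size ?\<kappa> = k" using e \<nu>(1) by (metis adm_def size_add_mset add_left_cancel Suc_inject)
      then have "adm ?\<kappa>" using \<nu>(1) 1 by (auto simp: adm_def dest: in_diffD)
      ultimately show ?thesis by blast
    next
      case (3 j)
      let ?\<kappa> = "add_mset (Suc j) (\<nu> - {#j#})"
      have e: "add_mset (Suc j) \<nu> = add_mset j ?\<kappa>" using 3 by (simp add: add_mset_commute[of j])
      have "supp ?\<kappa> (Uop g (wordU w f))"
        using mapsD(1)[OF maps_F[OF 3(3) e] \<nu>(2)] 3(1) by (simp add: alg_op_gen_eq)
      moreover have "size ?\<kappa> = k" using e \<nu>(1) by (metis adm_def size_add_mset add_left_cancel Suc_inject)
      then have "adm ?\<kappa>" using \<nu>(1) 3 by (auto simp: adm_def dest: in_diffD)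
      ultimately show ?thesis by blast
    next
      case (2 j)
      then show ?thesis using \<nu> E_zero by (auto simp: supp_zero)
    next
      case (4 j)
      then show ?thesis using \<nu> F_zero by (auto simp: supp_zero)
    qed
  qed
  ultimately show ?case by simp
qed

lemma Phi_xU:
  assumes "adm \<mu>" "supp \<mu> f" "y \<in> Free (EF_gens_below n)"
  shows "Phi (opU y f) = opU y (Phi f)"
  using assms(3)
proof (induction rule: Free_induct)
  case zero
  show ?case by (simp add: alg_op_def[abs_def] lin_zero[OF lin_Phi])
next
  case (single w c)
  then show ?case using Phi_word[OF assms(1,2)] by (simp add: alg_op_def[abs_def] lin_cmul[OF lin_Phi])
next
  case (add x y)
  have "opU (x + y) g = (\<lambda>u. opU x g u + opU y g u)" for g by (simp add: alg_op_linear fun_eq_iff)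
  then show ?case using add by (simp add: lin_add[OF lin_Phi])
qed

text \<open>On its way \<open>y\<close> may pass through letters above \<open>n\<close>, where
  \<open>Phi\<close> is not controlled. Restricted to letters at most \<open>n\<close> it agrees
  with some \<open>z\<close> in the generators below \<open>n\<close>; both end weights being
  admissible, \<open>y\<close> and \<open>z\<close> act alike on \<open>f\<close> and on
  \<open>Phi f\<close>.\<close>

lemma Phi_hom:
  assumes "adm \<mu>" "adm \<nu>" "maps y \<mu> \<nu>" "supp \<mu> f"
  shows "Phi (opU y f) = opU y (Phi f)"
proof -
  obtain z where z: "z \<in> Free (EF_gens_below n)" "\<And>f. supp \<mu> f \<Longrightarrow> restrict_letters n (opU y f) = opU z f"
    using triangular_restrict_letters[OF triangular_xU[OF mapsD(2)[OF assms(3)]], of \<mu> n] assms(1) unfolding adm_def by blast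
  have e: "opU y g = opU z g" if "supp \<mu> g" for g
  proof -
    have "restrict_letters n (opU y g) = opU y g"
      using mapsD(1)[OF assms(3) that] assms(2) unfolding adm_def by (intro restrict_letters_inside supp_inside[of \<nu>]) auto
    then show ?thesis using z(2)[OF that] by simp
  qed
  have "supp \<mu> (Phi f)" using Phi_supp assms(1,4) by (simp add: adm_def)
  then show ?thesis using e Phi_xU[OF assms(1,4) z(1)] assms(4) by simp
qed

text \<open>
  The pairs \<open>(\<Sum> b m, \<Sum> b (Phi m))\<close>; \<open>Phi_rel\<close> is not assumed to be single-valued.
\<close>

inductive Phi_rel :: "(nat list \<Rightarrow> 'k) \<Rightarrow> (nat list \<Rightarrow> 'k) \<Rightarrow> bool" where
  Phi_rel_base: "adm \<mu> \<Longrightarrow> supp \<mu> m \<Longrightarrow> maps b \<mu> \<omega> \<Longrightarrow> Phi_rel (opU b m) (opU b (Phi m))"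
| Phi_rel_zero: "Phi_rel (\<lambda>u. 0) (\<lambda>u. 0)"
| Phi_rel_add: "Phi_rel g g' \<Longrightarrow> Phi_rel h h' \<Longrightarrow> Phi_rel (\<lambda>u. g u + h u) (\<lambda>u. g' u + h' u)"

lemma Phi_rel_supp: "Phi_rel g g' \<Longrightarrow> supp \<omega> g \<and> supp \<omega> g'"
proof (induction rule: Phi_rel.induct)
  case (Phi_rel_base \<mu> m b)
  then have "supp \<mu> (Phi m)" using Phi_supp by (simp add: adm_def)
  then show ?case using Phi_rel_base by (auto dest: mapsD)
qed (auto simp: supp_zero supp_add)

text \<open>\<open>b\<close> followed by \<open>c\<close> is an arrow between admissible weights, to
  which \<open>Phi_hom\<close> applies. So \<open>g'\<close> behaves like a value of
  \<open>Phi\<close> at \<open>g\<close>, though \<open>Phi\<close> may be unknown in that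
  weight.\<close>

lemma Phi_rel_Phi: "Phi_rel g g' \<Longrightarrow> adm \<nu> \<Longrightarrow> maps c \<omega> \<nu> \<Longrightarrow> Phi (opU c g) = opU c g'"
proof (induction rule: Phi_rel.induct)
  case (Phi_rel_base \<mu> m b)
  then have "Phi (opU (c * b) m) = opU (c * b) (Phi m)"
    by (intro Phi_hom[of \<mu> \<nu>] maps_mult[of b \<mu> \<omega>])
  then show ?case by simp
qed (auto simp: lin_zero[OF lin_xU] lin_zero[OF lin_Phi] lin_add[OF lin_xU] lin_add[OF lin_Phi])

lemma Phi_rel_xU: "Phi_rel g g' \<Longrightarrow> maps b \<omega> \<omega> \<Longrightarrow> Phi_rel (opU b g) (opU b g')"
proof (induction rule: Phi_rel.induct)
  case (Phi_rel_base \<mu> m b')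
  have "Phi_rel (opU (b * b') m) (opU (b * b') (Phi m))"
    using Phi_rel_base by (intro Phi_rel.Phi_rel_base[of \<mu>] maps_mult[of b' \<mu> \<omega>])
  then show ?case by simp
qed (auto simp: lin_zero[OF lin_xU] lin_add[OF lin_xU] intro: Phi_rel_zero Phi_rel_add)

text \<open>\<open>opT x\<close> preserves weights and commutes with \<open>b\<close>, so it can be
  moved onto \<open>m\<close>. The new partner is built from \<open>Phi (opT x m)\<close>; it is not
  related to the old one, as \<open>Phi\<close> is not yet known to commute with Hecke
  operators.\<close>

lemma Phi_rel_xT: "Phi_rel g g' \<Longrightarrow> \<exists>h. Phi_rel (opT x g) h"
proof (induction rule: Phi_rel.induct)
  case (Phi_rel_base \<mu> m b)
  have "Phi_rel (opU b (opT x m)) (opU b (Phi (opT x m)))"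
    using Phi_rel_base by (intro Phi_rel.Phi_rel_base[of \<mu>] supp_xT)
  then show ?case by (auto simp: xT_xU)
qed (auto simp: lin_zero[OF lin_xT] lin_add[OF lin_xT] intro: Phi_rel_zero Phi_rel_add)

section \<open>The ideal and its identity element\<close>

definition reached :: "(nat list \<Rightarrow> 'k) set" where "reached = {g. \<exists>g'. Phi_rel g g'}"

lemma reached_zero: "(\<lambda>u. 0) \<in> reached"
  using Phi_rel_zero by (auto simp: reached_def)

lemma reached_add: "g \<in> reached \<Longrightarrow> h \<in> reached \<Longrightarrow> (\<lambda>u. g u + h u) \<in> reached"
  unfolding reached_def using Phi_rel_add by blast

lemma reached_xT: "g \<in> reached \<Longrightarrow> opT x g \<in> reached"
  unfolding reached_def using Phi_rel_xT by blast

lemma reached_cmul: "g \<in> reached \<Longrightarrow> (\<lambda>u. c * g u) \<in> reached"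
proof -
  have "opT (scal c) g = (\<lambda>u. c * g u)" by (auto simp: alg_op_def)
  then show "g \<in> reached \<Longrightarrow> (\<lambda>u. c * g u) \<in> reached" using reached_xT[of g "scal c"] by simp
qed

lemma reached_sum: "finite A \<Longrightarrow> (\<And>a. a \<in> A \<Longrightarrow> g a \<in> reached) \<Longrightarrow> (\<lambda>u. \<Sum>a\<in>A. c a * g a u) \<in> reached"
  by (induction A rule: finite_induct) (auto simp: reached_zero intro!: reached_add reached_cmul)

lemma reached_supp: "g \<in> reached \<Longrightarrow> supp \<omega> g"
  unfolding reached_def using Phi_rel_supp by blast

definition reached_ideal :: "(nat list \<Rightarrow>\<^sub>0 'k) set" where "reached_ideal = {x \<in> H. opT x \<delta> \<in> reached}"

lemma reached_ideal_H: "x \<in> reached_ideal \<Longrightarrow> x \<in> H"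
  by (simp add: reached_ideal_def)

lemma reached_ideal_left: "x \<in> H \<Longrightarrow> y \<in> reached_ideal \<Longrightarrow> x * y \<in> reached_ideal"
  by (auto simp: reached_ideal_def xT_mult reached_xT)

text \<open>On the generating vector, right multiplication by \<open>x\<close> is the action of an
  arrow \<open>b\<close> from the quantum group, under which the pairs of \<open>Phi_rel\<close> are
  stable.\<close>

lemma reached_ideal_right: "y \<in> reached_ideal \<Longrightarrow> x \<in> H \<Longrightarrow> y * x \<in> reached_ideal"
proof -
  assume y: "y \<in> reached_ideal" and x: "x \<in> H"
  obtain b where b: "maps b \<omega> \<omega>" "opT x \<delta> = opU b \<delta>" using xT_om[OF x] by blast
  have "opT (y * x) \<delta> = opU b (opT y \<delta>)" by (simp add: xT_mult b xT_xU)
  then show ?thesis using y x b Phi_rel_xU by (auto simp: reached_ideal_def reached_def)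
qed

lemma reached_ideal_diff: "x \<in> reached_ideal \<Longrightarrow> y \<in> reached_ideal \<Longrightarrow> x - y \<in> reached_ideal"
proof -
  assume xy: "x \<in> reached_ideal" "y \<in> reached_ideal"
  have "opT (x - y) \<delta> = (\<lambda>u. opT x \<delta> u + (-1) * opT y \<delta> u)" by (simp add: alg_op_linear fun_eq_iff)
  then show ?thesis using xy reached_add[OF _ reached_cmul[of _ "-1"]] by (auto simp: reached_ideal_def)
qed

lemma lift:
  assumes "g \<in> reached" shows "\<exists>x\<in>reached_ideal. opT x \<delta> = g"
proof -
  obtain x where x: "x \<in> H" "g = opT x \<delta>" using om_cyclic[OF reached_supp[OF assms]] by blast
  then have "x \<in> reached_ideal" using assms unfolding reached_ideal_def by simp
  then show ?thesis using x(2) by blast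
qed

lemma H_zero_tau:
  assumes "y \<in> H" "\<And>x. x \<in> H \<Longrightarrow> tau k (x * y) = 0"
  shows "opT y \<delta> = (\<lambda>u. 0)"
proof
  fix u
  show "opT y \<delta> u = 0"
  proof (cases "length u = k")
    case True
    then show ?thesis using tau_nondegenerate assms(2) by blast
  next
    case False
    then have "mset u \<noteq> \<omega>" using om_sorted(2)[of k] mset_eq_length by fastforce
    then show ?thesis using supp_xT[OF supp_delta] by (simp add: supp_def)
  qed
qed

text \<open>For \<open>x\<close> in the ideal, \<open>x * y\<close> is orthogonal to all of
  \<open>H\<close>, hence acts as 0. As \<open>y * h\<close> lies in the ideal, the square
  \<open>h * ((y * h) * y)\<close> of \<open>h * y\<close> acts as 0, so \<open>tau\<close> vanishes
  on \<open>h * y\<close> for every \<open>h\<close>, and nondegeneracy on \<open>H\<close> applies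
  to \<open>y\<close>.\<close>

lemma reached_ideal_nondegenerate:
  assumes y: "y \<in> reached_ideal" and t: "\<And>x. x \<in> reached_ideal \<Longrightarrow> tau k (x * y) = 0"
  shows "opT y \<delta> = (\<lambda>u. 0)"
proof -
  have z: "opT (x * y) f u = 0" if x: "x \<in> reached_ideal" and u: "length u = k" for x f u
  proof (rule faithful[OF _ _ u])
    show "x * y \<in> H" using x y reached_ideal_H by blast
    then show "opT (x * y) \<delta> = (\<lambda>u. 0)"
    proof (rule H_zero_tau)
      fix h assume "h \<in> H"
      then show "tau k (h * (x * y)) = 0" using t[OF reached_ideal_left[OF _ x]] by (simp add: mult.assoc)
    qed
  qed
  show ?thesis
  proof (rule H_zero_tau)
    show "y \<in> H" using y reached_ideal_H by blast
    fix h assume h: "h \<in> H"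
    show "tau k (h * y) = 0"
    proof (rule tau_nil)
      show "h * y \<in> H" using h y reached_ideal_H by blast
      fix f u assume u: "length (u :: nat list) = k"
      have "opT (h * y) (opT (h * y) f) u = opT h (opT ((y * h) * y) f) u"
        by (simp add: xT_mult)
      also have "\<dots> = 0"
        by (rule alg_op_T_zero) (use z[OF reached_ideal_right[OF y h]] u in \<open>auto dest: mset_eq_length\<close>)
      finally show "opT (h * y) (opT (h * y) f) u = 0" .
    qed
  qed
qed

lemma tau_vec: "tau k (x * y) = opT x (opT y \<delta>) (om k)"
  by (simp add: tau_def xT_mult)

lemma reached_spanned:
  "\<exists>B. finite B \<and> B \<subseteq> reached \<and> (\<forall>g\<in>reached. \<exists>d. g = (\<lambda>u. \<Sum>b\<in>B. d b * b u))"
proof -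
  interpret V: vector_space "\<lambda>(c::'k) (f::nat list \<Rightarrow> 'k) x. c * f x"
    by standard (auto simp: algebra_simps)
  have app: "(\<Sum>b\<in>B. (\<lambda>x. a b * b x)) t = (\<Sum>b\<in>B. a b * b t)" for a :: "(nat list \<Rightarrow> 'k) \<Rightarrow> 'k" and t B
    by (induction B rule: infinite_finite_induct) auto
  obtain B where B: "B \<subseteq> reached" "V.independent B" "reached \<subseteq> V.span B"
    using V.maximal_independent_subset by blast
  let ?D = "(\<lambda>v. delta v :: nat list \<Rightarrow> 'k) ` {v. mset v = \<omega>}"
  have "reached \<subseteq> V.span ?D"
  proof
    fix g assume g: "g \<in> reached"
    have e: "g = (\<Sum>v\<in>{v. mset v = \<omega>}. (\<lambda>x. g v * delta v x))"
    proof
      fix x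
      have "(\<Sum>v\<in>A. (\<lambda>x. g v * delta v x)) x = (\<Sum>v\<in>A. g v * delta v x)" for A
        by (induction A rule: infinite_finite_induct) auto
      then show "g x = (\<Sum>v\<in>{v. mset v = \<omega>}. (\<lambda>x. g v * delta v x)) x"
        using reached_supp[OF g] finite_mset_lists[of \<omega>] by (auto simp: supp_def if_distrib[of "\<lambda>z. _ * z"] cong: if_cong)
    qed
    show "g \<in> V.span ?D"
      by (subst e, intro V.span_sum V.span_scale V.span_base) auto
  qed
  then have "B \<subseteq> V.span ?D" using B(1) by blast
  then have fB: "finite B" using V.independent_span_bound[OF _ B(2), of ?D] finite_mset_lists by blast
  have "\<exists>d. g = (\<lambda>u. \<Sum>b\<in>B. d b * b u)" if "g \<in> reached" for g
  proof -
    have "g \<in> range (\<lambda>d. \<Sum>b\<in>B. (\<lambda>x. d b * b x))" using that B(3) V.span_finite[OF fB] by blast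
    then obtain d where "g = (\<Sum>b\<in>B. (\<lambda>x. d b * b x))" by blast
    then show ?thesis using app[of d B] by (intro exI[of _ d]) (simp add: fun_eq_iff)
  qed
  then show ?thesis using fB B(1) by blast
qed

text \<open>The functional \<open>tau\<close> on the ideal is represented through the trace form;
  the solvability condition of \<open>fredholm\<close> is nondegeneracy of that form. That the
  representing element is an identity follows in \<open>Phi_hecke\<close>.\<close>

lemma identity_element: "\<exists>i\<in>reached_ideal. \<forall>y\<in>reached_ideal. tau k (y * i) = tau k y"
proof -
  obtain B where B: "finite B" "B \<subseteq> reached" "\<And>g. g \<in> reached \<Longrightarrow> \<exists>d. g = (\<lambda>u. \<Sum>b\<in>B. d b * b u)"
    using reached_spanned by blast
  have "\<forall>b\<in>B. \<exists>x\<in>reached_ideal. opT x \<delta> = b" using lift B(2) by blast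
  then obtain Y where Y: "\<And>b. b \<in> B \<Longrightarrow> Y b \<in> reached_ideal" "\<And>b. b \<in> B \<Longrightarrow> opT (Y b) \<delta> = b" by metis
  define L where "L c = (\<Sum>b\<in>B. scal (c b) * Y b)" for c
  have Ld: "opT (L c) f = (\<lambda>u. \<Sum>b\<in>B. c b * opT (Y b) f u)" for c f
    by (auto simp: L_def alg_op_def leval_sum)
  have LI: "L c \<in> reached_ideal" for c
  proof -
    have "L c \<in> H" unfolding L_def using Y reached_ideal_H by (intro Free_sum Free_mult Free_scal) auto
    moreover have "opT (L c) \<delta> \<in> reached" unfolding Ld using Y B(1,2) by (intro reached_sum) auto
    ultimately show ?thesis by (simp add: reached_ideal_def)
  qed
  have tL: "tau k (L c) = (\<Sum>b\<in>B. c b * tau k (Y b))" for c by (simp add: tau_def Ld)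
  have tL': "tau k (L c * x) = (\<Sum>b\<in>B. c b * tau k (Y b * x))" for c x by (simp add: tau_def Ld xT_mult)
  have tR: "tau k (x * L c) = (\<Sum>b\<in>B. c b * tau k (x * Y b))" for c x
    unfolding tau_def xT_mult Ld lin_sum[OF lin_xT] lin_cmul[OF lin_xT] ..
  \<comment> \<open>Elements of the free algebra are compared through their vectors
    \<open>opT x \<delta>\<close>, which determine \<open>tau k (y * x)\<close> for all
    \<open>y\<close>. Here \<open>x\<close> stands on the right, hence the use of
    \<open>tau_comm\<close> below.\<close>
  have rep: "\<exists>c. \<forall>y. tau k (y * x) = tau k (y * L c)" "\<exists>c. tau k x = tau k (L c) \<and> (\<forall>y. tau k (y * x) = tau k (y * L c))" if x: "x \<in> reached_ideal" for x
  proof -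
    obtain c where c: "opT x \<delta> = (\<lambda>u. \<Sum>b\<in>B. c b * b u)" using B(3) x by (auto simp: reached_ideal_def)
    also have "\<dots> = opT (L c) \<delta>" unfolding Ld using Y(2) by (intro ext sum.cong) auto
    finally have e: "opT x \<delta> = opT (L c) \<delta>" .
    then show "\<exists>c. tau k x = tau k (L c) \<and> (\<forall>y. tau k (y * x) = tau k (y * L c))"
      by (intro exI[of _ c]) (simp add: tau_vec tau_def[of k x] tau_def[of k "L c"])
    then show "\<exists>c. \<forall>y. tau k (y * x) = tau k (y * L c)" by blast
  qed
  have "\<exists>d. \<forall>b\<in>B. (\<Sum>a\<in>B. tau k (Y b * Y a) * d a) = tau k (Y b)"
  proof (rule fredholm[OF B(1) B(1)])
    fix c assume c: "\<And>a. a \<in> B \<Longrightarrow> (\<Sum>b\<in>B. c b * tau k (Y b * Y a)) = 0"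
    have "opT (L c) \<delta> = (\<lambda>u. 0)"
    proof (rule reached_ideal_nondegenerate[OF LI])
      fix x assume x: "x \<in> reached_ideal"
      obtain d where "\<forall>y. tau k (y * x) = tau k (y * L d)" using rep(1)[OF x] by blast
      then have "tau k (L c * x) = tau k (L c * L d)" by blast
      also have "\<dots> = (\<Sum>a\<in>B. d a * tau k (L c * Y a))" by (rule tR)
      also have "\<dots> = 0" unfolding tL' using c by (intro sum.neutral) auto
      finally show "tau k (x * L c) = 0" using tau_comm[of x k "L c"] x LI reached_ideal_H by simp
    qed
    then show "(\<Sum>b\<in>B. c b * tau k (Y b)) = 0" unfolding tL[symmetric] by (simp add: tau_def)
  qed
  then obtain d where d: "\<And>b. b \<in> B \<Longrightarrow> (\<Sum>a\<in>B. tau k (Y b * Y a) * d a) = tau k (Y b)" by blast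
  have db: "tau k (L d * Y b) = tau k (Y b)" if "b \<in> B" for b
  proof -
    have "tau k (L d * Y b) = tau k (Y b * L d)" using tau_comm LI Y(1)[OF that] reached_ideal_H by blast
    also have "\<dots> = tau k (Y b)" unfolding tR using d[OF that] by (simp add: mult.commute)
    finally show ?thesis .
  qed
  show ?thesis
  proof (intro bexI[of _ "L d"] ballI LI)
    fix y assume y: "y \<in> reached_ideal"
    obtain c where c: "tau k y = tau k (L c)" "\<forall>x. tau k (x * y) = tau k (x * L c)" using rep(2)[OF y] by blast
    have "tau k (y * L d) = tau k (L d * y)" using tau_comm LI y reached_ideal_H by blast
    also have "\<dots> = tau k (L d * L c)" using c by blast
    also have "\<dots> = tau k y" unfolding tR c(1) tL using db by simp
    finally show "tau k (y * L d) = tau k y" .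
  qed
qed

text \<open>By retraction and cyclicity a vector \<open>m\<close> of admissible weight is
  \<open>opU d \<delta>\<close> for an arrow \<open>d\<close>. The identity \<open>i\<close> fixes
  \<open>opU b m\<close>, hence \<open>opU d (opT i \<delta>) = m\<close>. Pairing
  \<open>opT i \<delta>\<close> with \<open>opT h \<delta>\<close> gives
  \<open>Phi m = opU d (opT h \<delta>) = opT h m\<close>, with \<open>h\<close> independent of
  \<open>m\<close>.\<close>

lemma Phi_hecke:
  "\<exists>h\<in>H. \<forall>\<mu> m. adm \<mu> \<longrightarrow> supp \<mu> m \<longrightarrow> Phi m = opT h m"
proof -
  obtain i where i: "i \<in> reached_ideal" "\<And>y. y \<in> reached_ideal \<Longrightarrow> tau k (y * i) = tau k y" using identity_element by blast
  \<comment> \<open>For \<open>x\<close> in the ideal \<open>x * y\<close> lies there too, so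
    \<open>x * y * i\<close> and \<open>x * y\<close> have the same trace; nondegeneracy removes the
    trace.\<close>
  have right: "opT (y * i) \<delta> = opT y \<delta>" if y: "y \<in> reached_ideal" for y
  proof -
    have "opT (y * i - y) \<delta> = (\<lambda>u. 0)"
    proof (rule reached_ideal_nondegenerate)
      show "y * i - y \<in> reached_ideal" using y i by (intro reached_ideal_diff reached_ideal_left reached_ideal_H)
      fix x assume "x \<in> reached_ideal"
      then show "tau k (x * (y * i - y)) = 0"
        using i(2)[of "x * y"] y reached_ideal_H reached_ideal_left by (simp add: right_diff_distrib tau_linear mult.assoc)
    qed
    then show ?thesis by (simp add: alg_op_linear fun_eq_iff)
  qed
  \<comment> \<open>The right identity law becomes the left one inside the trace, where
    \<open>x * i * y\<close> may be replaced by \<open>x * y\<close>.\<close>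
  have left: "opT i (opT y \<delta>) = opT y \<delta>" if y: "y \<in> reached_ideal" for y
  proof -
    have "opT (i * y - y) \<delta> = (\<lambda>u. 0)"
    proof (rule reached_ideal_nondegenerate)
      show "i * y - y \<in> reached_ideal" using y i by (intro reached_ideal_diff reached_ideal_left reached_ideal_H)
      fix x assume x: "x \<in> reached_ideal"
      have "tau k (x * i * y) = tau k (x * y)"
        unfolding tau_def xT_mult[of _ y]
        by (rule faithful_eq[OF _ _ right[OF x]]) (use x i reached_ideal_H om_sorted in auto)
      then show "tau k (x * (i * y - y)) = 0" by (simp add: right_diff_distrib tau_linear mult.assoc)
    qed
    then show ?thesis by (simp add: alg_op_linear fun_eq_iff xT_mult)
  qed
  obtain \<iota> where \<iota>: "Phi_rel (opT i \<delta>) \<iota>" using i(1) by (auto simp: reached_ideal_def reached_def)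
  obtain h where h: "h \<in> H" "\<iota> = opT h \<delta>" using om_cyclic Phi_rel_supp[OF \<iota>] by blast
  have "Phi m = opT h m" if a: "adm \<mu>" and m: "supp \<mu> m" for \<mu> m
  proof -
    have "0 \<notin># \<mu>" "size \<mu> = k" using a by (auto simp: adm_def)
    then have "retract k \<mu>" by (rule retract_all)
    then obtain b c \<kappa> where bc: "maps b \<mu> \<omega>" "maps c \<omega> \<mu>" "\<kappa> \<noteq> 0"
      "\<And>f. supp \<mu> f \<Longrightarrow> opU c (opU b f) = (\<lambda>u. \<kappa> * f u)" unfolding retract_def by blast
    obtain x where x: "x \<in> H" "opU b m = opT x \<delta>" using om_cyclic[OF mapsD(1)[OF bc(1) m]] by blast
    obtain y where y: "maps y \<omega> \<omega>" "opT x \<delta> = opU y \<delta>" using xT_om[OF x(1)] by blast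
    define d where "d = scal (inverse \<kappa>) * (c * y)"
    have d: "maps d \<omega> \<mu>" unfolding d_def by (intro maps_mult[OF _ maps_scal] maps_mult[OF y(1) bc(2)])
    have "opU d \<delta> = (\<lambda>u. inverse \<kappa> * opU c (opU b m) u)"
      unfolding d_def x(2) y(2) by (simp add: fun_eq_iff)
    then have dm: "opU d \<delta> = m" using bc(3,4) m by (simp add: fun_eq_iff)
    have inj: "f = g" if "supp \<mu> f" "supp \<mu> g" "opU b f = opU b g" for f g
    proof -
      have "(\<lambda>u. \<kappa> * f u) = (\<lambda>u. \<kappa> * g u)" using bc(4)[OF that(1)] bc(4)[OF that(2)] that(3) by simp
      then show ?thesis using bc(3) by (simp add: fun_eq_iff)
    qed
    have di: "opU d (opT i \<delta>) = m"
    proof (rule inj)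
      show "supp \<mu> (opU d (opT i \<delta>))" using mapsD(1)[OF d] supp_xT[OF supp_delta] by blast
      have "opU b m \<in> reached" using Phi_rel_base[OF a m bc(1)] by (auto simp: reached_def)
      then obtain z where z: "z \<in> reached_ideal" "opT z \<delta> = opU b m" using lift by blast
      have "opU b (opU d (opT i \<delta>)) = opT i (opU b (opU d \<delta>))" by (simp add: xT_xU)
      also have "\<dots> = opT i (opT z \<delta>)" by (simp add: dm z)
      also have "\<dots> = opU b m" using left[OF z(1)] z(2) by simp
      finally show "opU b (opU d (opT i \<delta>)) = opU b m" .
    qed (rule m)
    have "Phi m = opU d \<iota>" using Phi_rel_Phi[OF \<iota> a d] by (simp add: di)
    also have "\<dots> = opT h (opU d \<delta>)" by (simp add: h(2) xT_xU)
    finally show ?thesis by (simp add: dm)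
  qed
  then show ?thesis using h(1) by blast
qed

end

section \<open>Comparison with the tensor powers of the natural module\<close>

lemma sum_words_append:
  "(\<Sum>v\<in>words n (p + q). h v) = (\<Sum>w\<in>words n p. \<Sum>z\<in>words n q. h (w @ z))"
proof -
  have "words n (p + q) = (\<lambda>(w, z). w @ z) ` (words n p \<times> words n q)"
  proof (intro equalityI subsetI)
    fix v assume v: "v \<in> words n (p + q)"
    then have "(take p v, drop p v) \<in> words n p \<times> words n q"
      by (auto simp: words_def dest: in_set_takeD in_set_dropD)
    then show "v \<in> (\<lambda>(w, z). w @ z) ` (words n p \<times> words n q)"
      by (intro image_eqI[of _ _ "(take p v, drop p v)"]) auto
  qed (clarsimp simp: words_def)
  moreover have "inj_on (\<lambda>(w, z). w @ z) (words n p \<times> words n q)" by (auto simp: inj_on_def words_def)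
  ultimately have "(\<Sum>v\<in>words n (p + q). h v) = (\<Sum>(w, z)\<in>words n p \<times> words n q. h (w @ z))"
    by (simp add: sum.reindex split_def)
  then show ?thesis by (simp add: sum.cartesian_product)
qed

lemma words_take_drop:
  "take p u \<in> words n p \<Longrightarrow> drop p u \<in> words n q \<Longrightarrow> u \<in> words n (p + q)"
  unfolding words_def by (metis (mono_tags, lifting) append_take_drop_id length_append mem_Collect_eq set_append Un_least)

lemma tens_rep:
  assumes A: "rep (words n p) A P" and B: "rep (words n q) B Q"
  shows "rep (words n (p + q)) (tens p A B) (\<lambda>f u. P (\<lambda>w. Q (\<lambda>z. f (w @ z)) (drop p u)) (take p u))"
proof -
  have cA: "A u v \<noteq> 0 \<Longrightarrow> u \<in> words n p \<and> v \<in> words n p" for u v using rep_carrier[OF A] by auto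
  have cB: "B u v \<noteq> 0 \<Longrightarrow> u \<in> words n q \<and> v \<in> words n q" for u v using rep_carrier[OF B] by auto
  have "tens p A B \<in> carrier (mat_alg (words n (p + q)))"
    unfolding mat_alg_simps mem_Collect_eq tens_def using cA cB words_take_drop by (metis mult_eq_0_iff)
  moreover have "P (\<lambda>w. Q (\<lambda>z. f (w @ z)) (drop p u)) (take p u) = (\<Sum>v\<in>words n (p + q). tens p A B u v * f v)"
    if u: "u \<in> words n (p + q)" for f u
  proof -
    have tu: "take p u \<in> words n p" "drop p u \<in> words n q"
      using u by (auto simp: words_def dest: in_set_takeD in_set_dropD)
    have "(\<Sum>v\<in>words n (p + q). tens p A B u v * f v)
       = (\<Sum>w\<in>words n p. \<Sum>z\<in>words n q. A (take p u) w * (B (drop p u) z * f (w @ z)))"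
      unfolding sum_words_append by (intro sum.cong refl) (auto simp: tens_def words_def mult.assoc)
    also have "\<dots> = P (\<lambda>w. Q (\<lambda>z. f (w @ z)) (drop p u)) (take p u)"
      unfolding rep_apply[OF A tu(1)] rep_apply[OF B tu(2)] by (simp add: sum_distrib_left)
    finally show ?thesis ..
  qed
  ultimately show ?thesis unfolding rep_def by blast
qed

section \<open>Generators and R-matrix on tensor powers\<close>

lemma words_1: "words n 1 = (\<lambda>x. [x]) ` {1..n}"
  by (auto simp: words_def length_Suc_conv)

lemma munit_tens: "tens 1 (munit a c) (munit b d) u v = (if u = [a, b] \<and> v = [c, d] then 1 else 0)"
  by (cases u; cases v) (auto simp: tens_def munit_def)

context two_params begin

lemma natural_rep:
  assumes "g \<in> gl_gens n"
  shows "rep (words n 1) (natural_gen n r s g) (Uop g)"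
proof -
  have un: "rep (words n 1) (munit a b) (\<lambda>f u. if u = [a] then f [b] else 0)"
    if "a \<in> {1..n}" "b \<in> {1..n}" for a b
    unfolding rep_def words_1 using that
    by (auto simp: munit_def sum.reindex inj_on_def if_distrib[of "\<lambda>z. z * _"] cong: if_cong)
  have di: "rep (words n 1) (diag_at n c i) (\<lambda>f u. c ^ cnt i u * f u)" if i: "i \<in> {1..n}" for c :: 'k and i
  proof -
    have d: "diag_at n c i = (\<lambda>u v. if \<exists>x\<in>{1..n}. u = [x] \<and> v = [x] then c ^ cnt i u else 0)"
    proof (intro ext)
      fix u v
      have S: "(\<Sum>l\<in>{1..n}-{i}. munit l l u v) = (if \<exists>x\<in>{1..n}-{i}. u = [x] \<and> v = [x] then 1 else (0::'k))"
      proof (cases "\<exists>x\<in>{1..n}-{i}. u = [x] \<and> v = [x]")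
        case True
        then obtain x where x: "x \<in> {1..n}-{i}" "u = [x]" "v = [x]" by blast
        have "(\<Sum>l\<in>{1..n}-{i}. munit l l u v) = (\<Sum>l\<in>{1..n}-{i}. if l = x then 1 else (0::'k))"
          using x by (intro sum.cong) (auto simp: munit_def)
        then show ?thesis using x True by simp
      next
        case False
        then have "munit l l u v = (0::'k)" if "l \<in> {1..n} - {i}" for l
          using that unfolding munit_def by auto
        then have "(\<Sum>l\<in>{1..n}-{i}. munit l l u v) = (0::'k)" by (intro sum.neutral) blast
        then show ?thesis using False by (simp only: if_False)
      qed
      show "diag_at n c i u v = (if \<exists>x\<in>{1..n}. u = [x] \<and> v = [x] then c ^ cnt i u else 0)"
      proof (cases "\<exists>x\<in>{1..n}. u = [x] \<and> v = [x]")
        case True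
        then obtain x where "x \<in> {1..n}" "u = [x]" "v = [x]" by blast
        then show ?thesis unfolding diag_at_def S by (cases "x = i") (auto simp: munit_def cnt_def)
      next
        case False
        then have "munit i i u v = (0::'k)" "\<not> (\<exists>x\<in>{1..n}-{i}. u = [x] \<and> v = [x])"
          using i by (auto simp: munit_def)
        moreover from this(2) have "(\<Sum>l\<in>{1..n}-{i}. munit l l u v) = (0::'k)"
          by (simp only: S if_False)
        ultimately show ?thesis unfolding diag_at_def using False by (simp only: if_False) simp
      qed
    qed
    show ?thesis unfolding rep_def words_1 d
      by (auto simp: sum.reindex inj_on_def if_distrib[of "\<lambda>z. z * _"] cong: if_cong)
  qed
  from assms consider j where "g = GE j" "j \<in> {1..<n}" | j where "g = GF j" "j \<in> {1..<n}"
    | i where "i \<in> {1..n}" "g = GA i \<or> g = GA_inv i \<or> g = GB i \<or> g = GB_inv i" by (auto simp: gl_gens_def)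
  then show ?thesis
  proof cases
    case (1 j)
    have "rep (words n 1) (munit j (Suc j)) (E j)"
    proof (rule rep_cong[OF un])
      fix f u assume "u \<in> words n 1"
      then obtain x where "u = [x]" unfolding words_1 by blast
      then show "(if u = [j] then f [Suc j] else 0) = E j f u" by (simp add: E_def)
    qed (use 1 in auto)
    then show ?thesis using 1 by simp
  next
    case (2 j)
    have "rep (words n 1) (munit (Suc j) j) (F j)"
    proof (rule rep_cong[OF un])
      fix f u assume "u \<in> words n 1"
      then obtain x where "u = [x]" unfolding words_1 by blast
      then show "(if u = [Suc j] then f [j] else 0) = F j f u" by (simp add: F_def)
    qed (use 2 in auto)
    then show ?thesis using 2 by simp
  next
    case (3 i)
    then show ?thesis using di[OF 3(1)] by auto
  qed
qed

lemma cnt_simps: "cnt i [] = 0" "cnt i (u @ v) = cnt i u + cnt i v" "cnt i [x] = (if x = i then 1 else 0)"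
  by (auto simp: cnt_def)

text \<open>The coproduct splits off the last tensor factor, as in \<open>repl_snoc\<close> and
  \<open>repl'_snoc\<close>, and \<open>omega\<close>, \<open>omega'\<close> act by exactly the
  letter weights built into \<open>repl\<close>, \<open>repl'\<close>. On the empty word the counit
  remains.\<close>

lemma tens_gen_rep: "g \<in> gl_gens n \<Longrightarrow> rep (words n k) (tens_gen n r s k g) (Uop g)"
proof (induction k arbitrary: g)
  case 0
  have "Uop g f [] = gl_counit g * f []" for f by (cases g) (auto simp: E_def F_def cnt_def)
  then show ?case by (auto simp: rep_def words_0)
next
  case (Suc k)
  interpret K: rep_alg "words n k" "gl_gens n" "tens_gen n r s k" Uop
    by standard (auto simp: finite_words Suc.IH)
  interpret N: rep_alg "words n 1" "gl_gens n" "natural_gen n r s" Uop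
    by standard (auto simp: finite_words natural_rep simp del: One_nat_def)
  have t: "rep (words n (k + 1)) (tens k (free_eval (End_tens n k) (tens_gen n r s k) x) (free_eval (End_tens n 1) (natural_gen n r s) y))
     (\<lambda>f u. opU x (\<lambda>w. opU y (\<lambda>z. f (w @ z)) (drop k u)) (take k u))"
    if "x \<in> Free (gl_gens n)" "y \<in> Free (gl_gens n)" for x y
    using that by (intro tens_rep K.rep_free_eval N.rep_free_eval)
  have u: "\<exists>w x. u = w @ [x] \<and> length w = k" if "u \<in> words n (k + 1)" for u
    using that by (cases u rule: rev_cases) (auto simp: words_def)
  have om: "opU (omega i) f u = word_wt i (Suc i) u * f u" "opU (omega' i) f u = word_wt (Suc i) i u * f u" for i f u
    by (simp_all add: omega_def omega'_def alg_op_gen_eq word_wt_pow cnt_def)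
  have omF: "omega i \<in> Free (gl_gens n)" "omega' i \<in> Free (gl_gens n)" if "i \<in> {1..<n}" for i
    using that by (auto simp: omega_def omega'_def gl_gens_def intro!: Free_mult Free_gen)
  have main: "rep (words n (k + 1)) (tens_gen n r s (Suc k) g) (Uop g)"
  proof -
    from Suc.prems consider j where "g = GE j" "j \<in> {1..<n}" | j where "g = GF j" "j \<in> {1..<n}"
      | i where "i \<in> {1..n}" "g = GA i \<or> g = GA_inv i \<or> g = GB i \<or> g = GB_inv i" by (auto simp: gl_gens_def)
    then show ?thesis
    proof cases
      case (1 j)
      have "rep (words n (k + 1)) (tens_gen n r s (Suc k) g)
         (\<lambda>f u. opU (ee j) (\<lambda>w. opU 1 (\<lambda>z. f (w @ z)) (drop k u)) (take k u) +
                opU (omega j) (\<lambda>w. opU (ee j) (\<lambda>z. f (w @ z)) (drop k u)) (take k u))"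
        using rep_add[OF t t, of "ee j" 1 "omega j" "ee j"] 1 Suc.prems omF[OF 1(2)] by (simp add: Free_gen)
      then show ?thesis
      proof (rule rep_cong)
        fix f u assume "u \<in> words n (k + 1)"
        then obtain w x where "u = w @ [x]" "length w = k" using u by blast
        then show "opU (ee j) (\<lambda>w. opU 1 (\<lambda>z. f (w @ z)) (drop k u)) (take k u) +
                opU (omega j) (\<lambda>w. opU (ee j) (\<lambda>z. f (w @ z)) (drop k u)) (take k u) = Uop g f u"
          by (auto simp: 1(1) xU_one alg_op_gen_eq om E_def repl_snoc)
      qed
    next
      case (2 j)
      have "rep (words n (k + 1)) (tens_gen n r s (Suc k) g)
         (\<lambda>f u. opU 1 (\<lambda>w. opU (ff j) (\<lambda>z. f (w @ z)) (drop k u)) (take k u) +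
                opU (ff j) (\<lambda>w. opU (omega' j) (\<lambda>z. f (w @ z)) (drop k u)) (take k u))"
        using rep_add[OF t t, of 1 "ff j" "ff j" "omega' j"] 2 Suc.prems omF[OF 2(2)] by (simp add: Free_gen)
      then show ?thesis
      proof (rule rep_cong)
        fix f u assume "u \<in> words n (k + 1)"
        then obtain w x where "u = w @ [x]" "length w = k" using u by blast
        then show "opU 1 (\<lambda>w. opU (ff j) (\<lambda>z. f (w @ z)) (drop k u)) (take k u) +
                opU (ff j) (\<lambda>w. opU (omega' j) (\<lambda>z. f (w @ z)) (drop k u)) (take k u) = Uop g f u"
          by (auto simp: 2(1) xU_one alg_op_gen_eq om F_def repl'_snoc repl'_lin)
      qed
    next
      case (3 i)
      then have cp: "gl_coprod g = [(gen g, gen g)]" by auto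
      have "rep (words n (k + 1)) (tens_gen n r s (Suc k) g)
         (\<lambda>f u. opU (gen g) (\<lambda>w. opU (gen g) (\<lambda>z. f (w @ z)) (drop k u)) (take k u))"
        using t[of "gen g" "gen g"] Suc.prems by (simp add: cp Free_gen)
      then show ?thesis
      proof (rule rep_cong)
        fix f u assume "u \<in> words n (k + 1)"
        then obtain w x where "u = w @ [x]" "length w = k" using u by blast
        then show "opU (gen g) (\<lambda>w. opU (gen g) (\<lambda>z. f (w @ z)) (drop k u)) (take k u) = Uop g f u"
          using 3(2) by (auto simp: alg_op_gen_eq cnt_simps power_add)
      qed
    qed
  qed
  then show ?case by simp
qed

text \<open>In the row of a two-letter word each sum has at most one nonzero entry. Multiplied by
  \<open>s\<close>, the coefficients r, 1/s, 1 - r/s, 1 become \<open>r * s\<close>, 1,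
  \<open>s - r\<close>, \<open>s\<close>.\<close>

lemma R_mat_rep: "rep (words n 2) (R_mat n r s) (\<lambda>f u. inverse s * T0 0 f u)"
proof -
  define P where "P = {(i, j). i \<in> {1..n} \<and> j \<in> {1..n} \<and> i < j}"
  have fP: "finite P" by (rule finite_subset[of _ "{1..n} \<times> {1..n}"]) (auto simp: P_def)
  define K where "K a b c d = (\<lambda>u v. if u = [a, b] \<and> v = [c, d] then 1 else (0::'k))" for a b c d :: nat
  have R: "R_mat n r s = (\<lambda>u v. r * (\<Sum>(i, j)\<in>P. K j i i j u v) + inverse s * (\<Sum>(i, j)\<in>P. K i j j i u v)
      + (1 - r * inverse s) * (\<Sum>(i, j)\<in>P. K j i j i u v) + (\<Sum>i\<in>{1..n}. K i i i i u v))"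
    unfolding R_mat_def P_def[symmetric] Let_def munit_tens K_def ..
  have rK: "rep (words n 2) (K a b c d) (\<lambda>f u. if u = [a, b] then f [c, d] else 0)"
    if "a \<in> {1..n}" "b \<in> {1..n}" "c \<in> {1..n}" "d \<in> {1..n}" for a b c d
  proof -
    have w: "[a, b] \<in> words n 2" "[c, d] \<in> words n 2" using that by (auto simp: words_def)
    show ?thesis unfolding rep_def K_def using w finite_words[of n 2]
      by (auto simp: if_distrib[of "\<lambda>z. z * _"] cong: if_cong split: if_splits)
  qed
  have rsum: "rep (words n 2) (\<lambda>u v. \<Sum>a\<in>S. A a u v) (\<lambda>f u. \<Sum>a\<in>S. Q a f u)"
    if "finite S" "\<And>a. a \<in> S \<Longrightarrow> rep (words n 2) (A a) (Q a)" for S :: "'z set" and A Q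
    using that
  proof (induction S rule: finite_induct)
    case empty show ?case using rep_zero by simp
  next
    case (insert a S)
    have "rep (words n 2) (\<lambda>u v. A a u v + (\<Sum>a\<in>S. A a u v)) (\<lambda>f u. Q a f u + (\<Sum>a\<in>S. Q a f u))"
      using insert by (intro rep_add) auto
    then show ?case using insert.hyps by simp
  qed
  have PI: "i \<in> {1..n}" "j \<in> {1..n}" if "(i, j) \<in> P" for i j using that by (auto simp: P_def)
  have "rep (words n 2) (R_mat n r s) (\<lambda>f u. r * (\<Sum>p\<in>P. if u = [snd p, fst p] then f [fst p, snd p] else 0)
     + inverse s * (\<Sum>p\<in>P. if u = [fst p, snd p] then f [snd p, fst p] else 0)
     + (1 - r * inverse s) * (\<Sum>p\<in>P. if u = [snd p, fst p] then f [snd p, fst p] else 0)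
     + (\<Sum>i\<in>{1..n}. if u = [i, i] then f [i, i] else 0))"
    unfolding R split_def
    by (intro rep_add rep_smult rsum rK fP finite_atLeastAtMost) (auto dest: PI)
  then show ?thesis
  proof (rule rep_cong)
    fix f :: "nat list \<Rightarrow> 'k" and u assume "u \<in> words n 2"
    then obtain a b where u: "u = [a, b]" "a \<in> {1..n}" "b \<in> {1..n}"
      by (auto simp: words_def numeral_2_eq_2 length_Suc_conv)
    have 1: "(\<Sum>p\<in>P. if u = [snd p, fst p] then h p else 0) = (if b < a then h (b, a) else (0::'k))" for h
    proof -
      have "(\<Sum>p\<in>P. if u = [snd p, fst p] then h p else 0) = (\<Sum>p\<in>P. if p = (b, a) then h p else 0)"
        using u by (intro sum.cong) auto
      then show ?thesis using fP u by (simp add: P_def)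
    qed
    have 2: "(\<Sum>p\<in>P. if u = [fst p, snd p] then h p else 0) = (if a < b then h (a, b) else (0::'k))" for h
    proof -
      have "(\<Sum>p\<in>P. if u = [fst p, snd p] then h p else 0) = (\<Sum>p\<in>P. if p = (a, b) then h p else 0)"
        using u by (intro sum.cong) auto
      then show ?thesis using fP u by (simp add: P_def)
    qed
    have 3: "(\<Sum>i\<in>{1..n}. if u = [i, i] then f [i, i] else 0) = (if a = b then f [a, a] else 0)"
    proof -
      have "(\<Sum>i\<in>{1..n}. if u = [i, i] then f [i, i] else 0) = (\<Sum>i\<in>{1..n}. if i = a then if a = b then f [a, a] else 0 else 0)"
        using u by (intro sum.cong) auto
      then show ?thesis using u by simp
    qed
    show "r * (\<Sum>p\<in>P. if u = [snd p, fst p] then f [fst p, snd p] else 0)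
     + inverse s * (\<Sum>p\<in>P. if u = [fst p, snd p] then f [snd p, fst p] else 0)
     + (1 - r * inverse s) * (\<Sum>p\<in>P. if u = [snd p, fst p] then f [snd p, fst p] else 0)
     + (\<Sum>i\<in>{1..n}. if u = [i, i] then f [i, i] else 0) = inverse s * T0 0 f u"
      unfolding 1 2 3 unfolding u(1) using s0 by (cases a b rule: linorder_cases) (auto simp: field_simps)
  qed
qed

lemma T0_prefix: "T0 (length w) f (w @ z) = T0 0 (\<lambda>z. f (w @ z)) z"
  by (induction w arbitrary: f) auto

lemma R_at_rep:
  assumes i: "1 \<le> i" "i < k"
  shows "rep (words n k) (s \<odot>\<^bsub>End_tens n k\<^esub> R_at n r s k i) (T i)"
proof -
  define m where "m = k - i - 1"
  have k: "k = (i - 1) + (2 + m)" using i by (simp add: m_def)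
  have "rep (words n ((i - 1) + (2 + m))) (R_at n r s k i)
     (\<lambda>f u. (\<lambda>f. f) (\<lambda>w. (\<lambda>f u. (\<lambda>f u. inverse s * T0 0 f u) (\<lambda>w. (\<lambda>f. f) (\<lambda>z. f (w @ z)) (drop 2 u)) (take 2 u))
         (\<lambda>z. f (w @ z)) (drop (i - 1) u)) (take (i - 1) u))"
    unfolding R_at_def m_def[symmetric]
    by (intro tens_rep R_mat_rep rep_one finite_words)
  from rep_smult[OF this, of s]
  have "rep (words n k) (s \<odot>\<^bsub>End_tens n k\<^esub> R_at n r s k i)
    (\<lambda>f u. s * (inverse s * T0 0 (\<lambda>w. f (take (i - 1) u @ w @ drop 2 (drop (i - 1) u))) (take 2 (drop (i - 1) u))))"
    unfolding k[symmetric] by simp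
  then show ?thesis
  proof (rule rep_cong)
    fix f :: "nat list \<Rightarrow> 'k" and u assume "u \<in> words n k"
    then have lu: "length u = (i - 1) + (2 + m)" using k by (simp add: words_def)
    define w x z where "w = take (i - 1) u" "x = take 2 (drop (i - 1) u)" "z = drop 2 (drop (i - 1) u)"
    have u: "u = w @ x @ z" unfolding w_x_z_def append_take_drop_id ..
    have l: "length w = i - 1" "length x = 2" unfolding w_x_z_def using lu by simp_all
    have "T i f u = T0 0 (\<lambda>z. f (w @ z)) (x @ z)" unfolding T_def u l(1)[symmetric] T0_prefix ..
    also have "\<dots> = T0 0 (\<lambda>v. f (w @ v @ z)) x" using l by (intro T0_append) simp
    finally show "s * (inverse s * T0 0 (\<lambda>w. f (take (i - 1) u @ w @ drop 2 (drop (i - 1) u))) (take 2 (drop (i - 1) u))) = T i f u"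
      unfolding w_x_z_def using s0 by simp
  qed
qed

section \<open>Surjectivity and injectivity of the Hecke map\<close>

lemma U_presented: "presented_rep (words n k) (gl_gens n) (tens_gen n r s k) Uop (gl_rels n r s)"
  by standard (auto simp: finite_words tens_gen_rep alg_op_gl_rels intro: gl_rels_Free[THEN subsetD])

lemma hecke_presented:
  "presented_rep (words n k) (hecke_gens k) (\<lambda>i. s \<odot>\<^bsub>End_tens n k\<^esub> R_at n r s k i) T (hecke_rels k r s)"
proof (unfold_locales)
  show "finite (words n k)" by (rule finite_words)
  show "rep (words n k) (s \<odot>\<^bsub>End_tens n k\<^esub> R_at n r s k g) (T g)" if "g \<in> hecke_gens k" for g
    using that by (intro R_at_rep) (auto simp: hecke_gens_def)
  show "hecke_rels k r s \<subseteq> Hfree k" by (rule hecke_rels_Free)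
  show "opT x f u = 0" if "x \<in> hecke_rels k r s" "u \<in> words n k" for x f u
    using that by (intro alg_op_hecke_rels) (auto simp: words_def)
qed

lemma schur_weyl:
  fixes n k :: nat
  assumes "k \<ge> 1"
  shows
    "hecke_map n r s k \<in> alg_hom (hecke k r s) (End_U n r s k) \<and>
     (\<forall>i\<in>{1..<k}. hecke_map n r s k (hecke_T k r s i) = s \<odot>\<^bsub>End_U n r s k\<^esub> R_at n r s k i) \<and>
     hecke_map n r s k ` carrier (hecke k r s) = carrier (End_U n r s k) \<and>
     (n \<ge> k \<longrightarrow> hecke_map n r s k \<in> alg_iso (hecke k r s) (End_U n r s k))"
proof -
  let ?I = "words n k"
  let ?h = "hecke_map n r s k"
  let ?\<rho> = "\<lambda>i. s \<odot>\<^bsub>End_tens n k\<^esub> R_at n r s k i"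
  let ?ev = "free_eval (mat_alg ?I) ?\<rho>"
  interpret U: presented_rep ?I "gl_gens n" "tens_gen n r s k" Uop "gl_rels n r s" by (rule U_presented)
  interpret H: presented_rep ?I "hecke_gens k" ?\<rho> T "hecke_rels k r s" by (rule hecke_presented)
  have E_simps: "mult (End_U n r s k) = mult (End_tens n k)" "one (End_U n r s k) = one (End_tens n k)"
    "add (End_U n r s k) = add (End_tens n k)" "smult (End_U n r s k) = smult (End_tens n k)" for n k
    by (simp_all add: End_U_def)
  have E_carrier: "\<phi> \<in> carrier (End_U n r s k) \<longleftrightarrow> \<phi> \<in> carrier (End_tens n k) \<and> (\<forall>u\<in>carrier (U_gl n r s).
        \<phi> \<otimes>\<^bsub>End_tens n k\<^esub> U_act n r s k u = U_act n r s k u \<otimes>\<^bsub>End_tens n k\<^esub> \<phi>)" for \<phi>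
    by (simp add: End_U_def)
  have hm: "?h = presented_eval (mat_alg ?I) ?\<rho>" unfolding hecke_map_def ..
  have img: "?h ` carrier (hecke k r s) = ?ev ` Hfree k"
    unfolding hm hecke_def by (rule H.presented_eval_image)
  have sub: "?ev x \<in> carrier (End_U n r s k)" if x: "x \<in> Hfree k" for x
    unfolding E_carrier
  proof (intro conjI ballI)
    note rx = H.rep_free_eval[OF x]
    show "?ev x \<in> carrier (End_tens n k)" using rx by (rule rep_carrier)
    fix u assume "u \<in> carrier (U_gl n r s)"
    then obtain y where y: "y \<in> Free (gl_gens n)" "u = rel_ideal (gl_gens n) (gl_rels n r s) +>\<^bsub>free_alg (gl_gens n)\<^esub> y"
      unfolding U_gl_def presented_carrier by blast
    have ry: "rep ?I (U_act n r s k u) (opU y)"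
      unfolding U_act_def y(2) U.presented_eval_coset[OF y(1)] by (rule U.rep_free_eval[OF y(1)])
    show "?ev x \<otimes>\<^bsub>End_tens n k\<^esub> U_act n r s k u = U_act n r s k u \<otimes>\<^bsub>End_tens n k\<^esub> ?ev x"
      using rep_comp[OF finite_words rx ry] rep_comp[OF finite_words ry rx]
      by (rule rep_unique[OF finite_words]) (simp add: xT_xU)
  qed
  have hom: "?h \<in> alg_hom (hecke k r s) (End_U n r s k)"
  proof -
    have h: "?h \<in> alg_hom (hecke k r s) (mat_alg ?I)"
      unfolding hm hecke_def by (rule H.presented_eval_hom)
    have c: "?h X \<in> carrier (End_U n r s k)" if "X \<in> carrier (hecke k r s)" for X
    proof -
      have "?h X \<in> ?ev ` Hfree k"
        unfolding img[symmetric] using that by (rule imageI)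
      then show ?thesis using sub by (elim imageE) (simp only:)
    qed
    from h have rh: "?h \<in> ring_hom (hecke k r s) (mat_alg ?I)"
      and sm: "\<forall>c. \<forall>x\<in>carrier (hecke k r s). ?h (c \<odot>\<^bsub>hecke k r s\<^esub> x) = c \<odot>\<^bsub>mat_alg ?I\<^esub> ?h x"
      unfolding alg_hom_def by blast+
    have "?h \<in> ring_hom (hecke k r s) (End_U n r s k)"
      by (rule ring_hom_memI, erule c, unfold E_simps)
        (rule ring_hom_mult[OF rh] ring_hom_add[OF rh] ring_hom_one[OF rh]; assumption)+
    then show ?thesis unfolding alg_hom_def E_simps using sm by blast
  qed
  have gens: "?h (hecke_T k r s i) = s \<odot>\<^bsub>End_U n r s k\<^esub> R_at n r s k i" if "i \<in> {1..<k}" for i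
    unfolding hm hecke_T_def E_simps by (rule H.presented_eval_gen) (use that in \<open>simp add: hecke_gens_def\<close>)
  have surj: "\<exists>h\<in>Hfree k. \<phi> = ?ev h" if \<phi>: "\<phi> \<in> carrier (End_U n r s k)" for \<phi>
  proof -
    define Phi where "Phi f u = (\<Sum>v\<in>?I. \<phi> u v * f v)" for f u
    have c\<phi>: "\<phi> \<in> carrier (mat_alg ?I)" using \<phi> E_carrier by blast
    then have out: "\<phi> u v \<noteq> 0 \<Longrightarrow> u \<in> ?I \<and> v \<in> ?I" for u v by auto
    have rP: "rep ?I \<phi> Phi" using c\<phi> unfolding rep_def Phi_def by blast
    have P0: "Phi f u = 0" if "u \<notin> ?I" for f u
      unfolding Phi_def using out that by (intro sum.neutral) auto
    have com: "Phi (Uop g f) u = Uop g (Phi f) u" if g: "g \<in> gl_gens n" and u: "u \<in> ?I" for g f u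
    proof -
      have "presented_gen (gl_gens n) (gl_rels n r s) g \<in> carrier (U_gl n r s)"
        unfolding U_gl_def presented_carrier presented_gen_def using Free_gen[OF g] by blast
      moreover have "U_act n r s k (presented_gen (gl_gens n) (gl_rels n r s) g) = tens_gen n r s k g"
        unfolding U_act_def by (rule U.presented_eval_gen[OF g])
      ultimately have e: "\<phi> \<otimes>\<^bsub>mat_alg ?I\<^esub> tens_gen n r s k g = tens_gen n r s k g \<otimes>\<^bsub>mat_alg ?I\<^esub> \<phi>"
        using \<phi> unfolding E_carrier by force
      note rg = tens_gen_rep[OF g, of k]
      have "Phi (Uop g f) u = (\<Sum>v\<in>?I. (\<phi> \<otimes>\<^bsub>mat_alg ?I\<^esub> tens_gen n r s k g) u v * f v)"
        by (rule rep_apply[OF rep_comp[OF finite_words rP rg] u])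
      also have "\<dots> = Uop g (Phi f) u" unfolding e
        by (rule rep_apply[OF rep_comp[OF finite_words rg rP] u, symmetric])
      finally show ?thesis .
    qed
    have \<phi>_delta: "Phi (delta v) u = \<phi> u v" if "v \<in> ?I" for u v
      unfolding Phi_def using that finite_words[of n k] by (simp add: if_distrib[of "\<lambda>z. _ * z"] cong: if_cong)
    have linP: "lin Phi"
      by (simp add: lin_def Phi_def sum.distrib sum_distrib_left algebra_simps)
    \<comment> \<open>Commuting with a_i and b_i makes powers of \<open>r\<close> and of
      \<open>s\<close> agree, hence powers of r/s; the exponents agree since r/s is not a root of
      unity.\<close>
    have wt: "mset u = mset v" if nz: "\<phi> u v \<noteq> 0" for u v
    proof -
      have uv: "u \<in> ?I" "v \<in> ?I" using out nz by auto
      have d: "c ^ cnt i u = c ^ cnt i v"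
        if "\<And>f. Phi (\<lambda>w. c ^ cnt i w * f w) u = c ^ cnt i u * Phi f u" for c i
      proof -
        have "(\<lambda>w. c ^ cnt i w * delta v w) = (\<lambda>w. c ^ cnt i v * delta v w)" by auto
        then have "c ^ cnt i v * \<phi> u v = c ^ cnt i u * \<phi> u v"
          using that[of "delta v"] by (simp only: lin_cmul[OF linP] \<phi>_delta[OF uv(2)])
        then show ?thesis using nz by simp
      qed
      have "cnt i u = cnt i v" if i: "i \<in> {1..n}" for i
      proof -
        have "r ^ cnt i u = r ^ cnt i v" using com[of "GA i" u] i uv by (intro d) (auto simp: gl_gens_def)
        moreover have "s ^ cnt i u = s ^ cnt i v" using com[of "GB i" u] i uv by (intro d) (auto simp: gl_gens_def)
        ultimately have "ratio ^ cnt i u = ratio ^ cnt i v" unfolding ratio_def by (simp add: power_mult_distrib power_inverse)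
        then show ?thesis by (rule ratio_inj)
      qed
      moreover have "count (mset w) i = 0" if "w \<in> ?I" "i \<notin> {1..n}" for w i
        using that by (auto simp: words_def count_eq_zero_iff)
      ultimately show ?thesis using uv by (intro multiset_eqI) (metis cnt_def)
    qed
    have Ps: "supp \<mu> (Phi f)" if "supp \<mu> f" for \<mu> f
      unfolding supp_def
    proof (intro allI impI)
      fix u assume "mset u \<noteq> \<mu>"
      then have "\<phi> u v * f v = 0" for v using that wt[of u v] by (auto simp: supp_def)
      then show "Phi f u = 0" unfolding Phi_def by (intro sum.neutral ballI)
    qed
    interpret commutant r s n k Phi
    proof
      show "lin Phi" by (rule linP)
      show "supp \<mu> (Phi f)" if "supp \<mu> f" for \<mu> f by (rule Ps[OF that])
      fix \<mu> f g assume g: "g \<in> EF_gens_below n" and \<mu>: "set_mset \<mu> \<subseteq> {1..n}" "size \<mu> = k" and f: "supp \<mu> f"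
      have gg: "g \<in> gl_gens n" using g by (auto simp: EF_gens_below_def gl_gens_def)
      show "Phi (Uop g f) = Uop g (Phi f)"
      proof
        fix u show "Phi (Uop g f) u = Uop g (Phi f) u"
        proof (cases "u \<in> ?I")
          case True then show ?thesis using com gg by blast
        next
          case False
          have "Uop g (Phi f) u = 0"
          proof -
            obtain j where j: "1 \<le> j" "j < n" "g = GE j \<or> g = GF j" using g by (auto simp: EF_gens_below_def)
            \<comment> \<open>A generator below \<open>n\<close> maps an admissible weight to words
              with letters in 1, ..., n, so both sides vanish off \<open>?I\<close>.\<close>
            have uI: "u \<in> ?I" if "add_mset a \<mu> = add_mset b (mset u)" "a \<in> {1..n}" for a b
            proof -
              have "size (add_mset a \<mu>) = size (add_mset b (mset u))" "set_mset (add_mset a \<mu>) = set_mset (add_mset b (mset u))"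
                using that(1) by simp_all
              then show ?thesis using \<mu> that(2) by (auto simp: words_def)
            qed
            have "add_mset j \<mu> \<noteq> add_mset (Suc j) (mset u)" "add_mset (Suc j) \<mu> \<noteq> add_mset j (mset u)"
              using False j(1,2) uI[of j "Suc j"] uI[of "Suc j" j] by fastforce+
            then show ?thesis using E_outside[OF Ps[OF f]] F_outside[OF Ps[OF f]] j(3) by auto
          qed
          then show ?thesis using P0[OF False] by simp
        qed
      qed
    qed
    obtain h where h: "h \<in> Hfree k" "\<And>\<mu> m. adm \<mu> \<Longrightarrow> supp \<mu> m \<Longrightarrow> Phi m = opT h m"
      using Phi_hecke by blast
    have "\<phi> = ?ev h"
    proof (rule rep_unique[OF finite_words rP H.rep_free_eval[OF h(1)]])
      fix f :: "nat list \<Rightarrow> 'k" and u assume u: "u \<in> ?I"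
      \<comment> \<open>\<open>h\<close> is known on single weights only; both operators respect
        weights, so \<open>f\<close> may be cut down to the weight of \<open>u\<close>.\<close>
      define m where "m v = (if mset v = mset u then f v else 0)" for v
      have "\<phi> u v * f v = \<phi> u v * m v" for v
        using wt[of u v] by (cases "\<phi> u v = 0") (simp_all add: m_def)
      then have "Phi f u = Phi m u" unfolding Phi_def by (intro sum.cong refl)
      also have "\<dots> = opT h m u"
        using h(2)[of "mset u" m] u by (simp add: adm_def words_def supp_def m_def)
      also have "\<dots> = opT h f u" by (rule alg_op_T_cong) (simp add: m_def)
      finally show "Phi f u = opT h f u" .
    qed
    then show ?thesis using h(1) by blast
  qed
  have onto: "?h ` carrier (hecke k r s) = carrier (End_U n r s k)"
    unfolding img using sub surj by blast
  have inj: "inj_on (?h) (carrier (hecke k r s))" if nk: "n \<ge> k"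
    unfolding hm hecke_def
  proof (rule H.presented_eval_inj)
    fix x assume x: "x \<in> Hfree k" and z: "?ev x = \<zero>\<^bsub>mat_alg ?I\<^esub>"
    show "x \<in> JH k"
    proof (rule Free_faithful[OF om_sorted x])
      fix v assume v: "mset v = mset (om k)"
      \<comment> \<open>For n \<ge> k the faithful weight space of 1 2 ... k lies inside the given
        tensor power.\<close>
      have "om k \<in> ?I" using nk om_sorted(2)[of k] by (auto simp: words_def om_letters)
      then have "v \<in> ?I" using words_mset v by blast
      then show "opT x (delta (om k)) v = 0" using rep_apply[OF H.rep_free_eval[OF x]] z by simp
    qed
  qed
  show ?thesis using hom gens onto inj by (auto simp: alg_iso_def bij_betw_def)
qed

end

theorem theorem6p6:
  fixes r s :: "'k::alg_closed_field" and n k :: nat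
  assumes "n \<ge> 1" and "r \<noteq> 0" and "s \<noteq> 0" and "r \<noteq> s"
    and "\<forall>m\<ge>1. (r * inverse s) ^ m \<noteq> 1"
    and "k \<ge> 1"
  shows
    "hecke_map n r s k \<in> alg_hom (hecke k r s) (End_U n r s k) \<and>
     (\<forall>i\<in>{1..<k}. hecke_map n r s k (hecke_T k r s i) = s \<odot>\<^bsub>End_U n r s k\<^esub> R_at n r s k i) \<and>
     hecke_map n r s k ` carrier (hecke k r s) = carrier (End_U n r s k) \<and>
     (n \<ge> k \<longrightarrow> hecke_map n r s k \<in> alg_iso (hecke k r s) (End_U n r s k))"
proof -
  interpret two_params r s using assms(2,3,5) by unfold_locales auto
  show ?thesis using assms(6) by (rule schur_weyl)
qed

end
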